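(* Assume that $V\in C^1(\mathbb{R}^N)$ satisfies (V1) there exist $a_-\neq a_+\in\mathbb{R}^N$ such that $V(a_+)=V(a_-)=0$, and $V(x)>0$ for $x\in\mathbb{R}^N\setminus\{a_-,a_+\}$; (V2) $\liminf_{|x|\to+\infty}V(x)=:\nu_0>0$; and that $\nabla V$ is locally Lipschitz continuous in $\mathbb{R}^N$. Let $(c_n)\subset(0,c_{dw})$ be any sequence with $c_n\to0^+$ and, for each $n$, let $q_{c_n}$ be a minimization solution (as defined in the context) of $\ddot q=\nabla V(q)$ at energy $-c_n$ relative to the decomposition $\mathcal{V}^{c_n}=\mathcal{V}^{c_n}_-\cup\mathcal{V}^{c_n}_+$ given in the context. Then, up to translations and a subsequence, $q_{c_n}\to q_0$ in $C^2_{loc}(\mathbb{R},\mathbb{R}^N)$ (that is, there are a subsequence $(c_{n_k})$ and reals $\tau_k$ with $q_{c_{n_k}}(\cdot-\tau_k)\to q_0$ in $C^2_{loc}(\mathbb{R},\mathbb{R}^N)$), where $q_0$ is a solution of $\ddot q=\nabla V(q)$ on $\mathbb{R}$ of heteroclinic type between $a_-$ and $a_+$, i.e. it satisfies $$q_0(t)\to a_\pm\quad\text{and}\quad\dot q_0(t)\to0\quad\text{as } t\to\pm\infty.$$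
   Context: $N\ge2$ is an integer; $\mathrm{dist}$ is Euclidean distance; $B_r(x)$ is the open ball; $\mathcal{V}^c:=\{x\in\mathbb{R}^N:V(x)\le c\}$. Choice of $c_{dw}$ and decomposition. Let $\varrho_0:=\frac14|a_--a_+|$. The number $c_{dw}\in(0,\nu_0)$ is fixed so small that for every $c\in[0,c_{dw})$ the set $\mathcal{V}^c$ is the disjoint union of two compact sets $\mathcal{V}^c_-,\mathcal{V}^c_+$ with $a_-\in\mathcal{V}^c_-\subset B_{\varrho_0}(a_-)$ and $a_+\in\mathcal{V}^c_+\subset B_{\varrho_0}(a_+)$ (such a $c_{dw}$ exists). Variational setting for a decomposition $\mathcal{V}^c=\mathcal{V}^c_-\cup\mathcal{V}^c_+$ into closed sets at positive distance. $\Gamma_c$ is the set of $q\in H^1_{loc}(\mathbb{R},\mathbb{R}^N)$ such that $V(q(t))\ge c$ for all $t$ and $\liminf_{t\to-\infty}\mathrm{dist}(q(t),\mathcal{V}^c_-)=\liminf_{t\to+\infty}\mathrm{dist}(q(t),\mathcal{V}^c_+)=0$. $J_c(q):=\int_{\mathbb{R}}\tfrac12|\dot q|^2+(V(q)-c)\,dt$ and $m_c:=\inf_{\Gamma_c}J_c$. Let $R>0$ be such that $m_c=\inf\{J_c(q):q\in\Gamma_c,\|q\|_{L^\infty}\le R\}$ (such $R$ exists in the present setting), $4\rho_0:=\mathrm{dist}(\mathcal{V}^c_-\cap B_R(0),\mathcal{V}^c_+\cap B_R(0))>0$, and $\mathcal{M}_c:=\{q\in\Gamma_c:\mathrm{dist}(q(0),\mathcal{V}^c)=\rho_0,\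 J_c(q)=m_c,\ \|q\|_{L^\infty}\le R\}$, which is nonempty. For $q\in\mathcal{M}_c$ let $\alpha_q:=\sup\{t:q(t)\in\mathcal{V}^c_-\}$ if $q(\mathbb{R})\cap\mathcal{V}^c_-\ne\emptyset$, $\alpha_q:=-\infty$ otherwise; $\omega_q:=\inf\{t>\alpha_q:q(t)\in\mathcal{V}^c_+\}$ if $q(\mathbb{R})\cap\mathcal{V}^c_+\neq\emptyset$, $\omega_q:=+\infty$ otherwise. Minimization solution. Given $q\in\mathcal{M}_c$, the minimization solution $q_c$ generated by $q$ at energy $-c$ is: $q_c=q$ if $\alpha_q=-\infty$, $\omega_q=+\infty$; if $\alpha_q=-\infty$ and $\omega_q<+\infty$, $q_c=q$ on $(-\infty,\omega_q]$ extended to $\mathbb{R}$ by reflection $q_c(2\omega_q-t)=q_c(t)$; if $\alpha_q>-\infty$ and $\omega_q=+\infty$, $q_c=q$ on $[\alpha_q,+\infty)$ extended by reflection $q_c(2\alpha_q-t)=q_c(t)$; if both are finite, $q_c=q$ on $[\alpha_q,\omega_q]$ extended by reflection about $\omega_q$ and then $2(\omega_q-\alpha_q)$-periodically to $\mathbb{R}$. Then $q_c\in C^2(\mathbb{R},\mathbb{R}^N)$ solves $\ddot q=\nabla V(q)$, has energy $\tfrac12|\dot q_c|^2-V(q_c)\equiv-c$, and satisfies $\inf_t\mathrm{dist}(q_c(t),\mathcal{V}^c_\pm)=0$. *)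

theory Defs
  imports "HOL-Analysis.Analysis"
begin

definition locally_lipschitz :: "('a::metric_space \<Rightarrow> 'b::metric_space) \<Rightarrow> bool" where
  "locally_lipschitz f \<longleftrightarrow> (\<forall>x. \<exists>e>0. \<exists>L. L-lipschitz_on (ball x e) f)"

definition sublevel :: "('a \<Rightarrow> real) \<Rightarrow> real \<Rightarrow> 'a set" where
  "sublevel V c = {x. V x \<le> c}"

text \<open>
  The decompositions of the sublevel sets below level \<open>cdw\<close>; \<open>Vm c\<close> and \<open>Vp c\<close> are the
  components around \<open>am\<close> and \<open>ap\<close>, and \<open>nu0\<close> is the (possibly infinite) lower limit
  of \<open>V\<close> at infinity.
\<close>

definition double_well_decomposition ::
  "('a::euclidean_space \<Rightarrow> real) \<Rightarrow> 'a \<Rightarrow> 'a \<Rightarrow> ereal \<Rightarrow> real \<Rightarrow>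
    (real \<Rightarrow> 'a set) \<Rightarrow> (real \<Rightarrow> 'a set) \<Rightarrow> bool" where
  "double_well_decomposition V am ap nu0 cdw Vm Vp \<longleftrightarrow>
     0 < cdw \<and> ereal cdw < nu0 \<and>
     (\<forall>c. 0 \<le> c \<and> c < cdw \<longrightarrow>
        sublevel V c = Vm c \<union> Vp c \<and> Vm c \<inter> Vp c = {} \<and>
        compact (Vm c) \<and> compact (Vp c) \<and>
        am \<in> Vm c \<and> Vm c \<subseteq> ball am (dist am ap / 4) \<and>
        ap \<in> Vp c \<and> Vp c \<subseteq> ball ap (dist am ap / 4))"

text \<open>Testing weak derivatives with \<open>C\<^sup>1\<close> or with smooth compactly supported functions is equivalent.\<close>

definition test_function :: "(real \<Rightarrow> real) \<Rightarrow> bool" where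
  "test_function \<phi> \<longleftrightarrow> \<phi> C1_differentiable_on UNIV \<and> compact (closure {t. \<phi> t \<noteq> 0})"

definition loc_L2 :: "(real \<Rightarrow> 'a::euclidean_space) \<Rightarrow> bool" where
  "loc_L2 f \<longleftrightarrow> f \<in> borel_measurable lborel \<and>
     (\<forall>a b. set_integrable lborel {a..b} (\<lambda>t. (norm (f t))\<^sup>2))"

definition is_weak_derivative ::
  "(real \<Rightarrow> 'a::euclidean_space) \<Rightarrow> (real \<Rightarrow> 'a) \<Rightarrow> bool" where
  "is_weak_derivative q g \<longleftrightarrow>
     (\<forall>\<phi>. test_function \<phi> \<longrightarrow>
        (LBINT t. deriv \<phi> t *\<^sub>R q t) = - (LBINT t. \<phi> t *\<^sub>R g t))"

text \<open>
  Elements of \<open>H\<^sup>1\<^sub>l\<^sub>o\<^sub>c(\<real>)\<close> are identified with their continuous representatives, since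
  pointwise values are used throughout.
\<close>

definition H1_loc :: "(real \<Rightarrow> 'a::euclidean_space) set" where
  "H1_loc = {q. continuous_on UNIV q \<and> loc_L2 q \<and> (\<exists>g. loc_L2 g \<and> is_weak_derivative q g)}"

text \<open>Any two choices agree almost everywhere, so that integrals do not depend on the choice.\<close>

definition weak_deriv :: "(real \<Rightarrow> 'a::euclidean_space) \<Rightarrow> real \<Rightarrow> 'a" where
  "weak_deriv q = (SOME g. loc_L2 g \<and> is_weak_derivative q g)"

definition Gamma ::
  "('a::euclidean_space \<Rightarrow> real) \<Rightarrow> real \<Rightarrow> 'a set \<Rightarrow> 'a set \<Rightarrow> (real \<Rightarrow> 'a) set" where
  "Gamma V c Am Ap = {q \<in> H1_loc. (\<forall>t. c \<le> V (q t)) \<and>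
     Liminf at_bot (\<lambda>t. ereal (infdist (q t) Am)) = 0 \<and>
     Liminf at_top (\<lambda>t. ereal (infdist (q t) Ap)) = 0}"

text \<open>On \<open>Gamma V c Am Ap\<close> the integrand is nonnegative, so \<open>ennreal\<close> does not truncate it.\<close>

definition action :: "('a::euclidean_space \<Rightarrow> real) \<Rightarrow> real \<Rightarrow> (real \<Rightarrow> 'a) \<Rightarrow> ennreal" where
  "action V c q =
     (\<integral>\<^sup>+t. ennreal ((norm (weak_deriv q t))\<^sup>2 / 2 + (V (q t) - c)) \<partial>lborel)"

definition min_action ::
  "('a::euclidean_space \<Rightarrow> real) \<Rightarrow> real \<Rightarrow> 'a set \<Rightarrow> 'a set \<Rightarrow> ennreal" where
  "min_action V c Am Ap = (INF q \<in> Gamma V c Am Ap. action V c q)"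

definition Linf_le :: "(real \<Rightarrow> 'a::euclidean_space) \<Rightarrow> real \<Rightarrow> bool" where
  "Linf_le q R \<longleftrightarrow> (AE t in lborel. norm (q t) \<le> R)"

definition rho :: "'a::euclidean_space set \<Rightarrow> 'a set \<Rightarrow> real \<Rightarrow> real" where
  "rho Am Ap R = setdist (Am \<inter> ball 0 R) (Ap \<inter> ball 0 R) / 4"

text \<open>
  Since \<open>setdist\<close> is \<open>0\<close> when an argument is empty, the last conjunct also says that both
  sets meet the ball.
\<close>

definition admissible_radius ::
  "('a::euclidean_space \<Rightarrow> real) \<Rightarrow> real \<Rightarrow> 'a set \<Rightarrow> 'a set \<Rightarrow> real \<Rightarrow> bool" where
  "admissible_radius V c Am Ap R \<longleftrightarrow>
     R > 0 \<and>
     min_action V c Am Ap = (INF q \<in> {q \<in> Gamma V c Am Ap. Linf_le q R}. action V c q) \<and>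
     rho Am Ap R > 0"

definition minimizers ::
  "('a::euclidean_space \<Rightarrow> real) \<Rightarrow> real \<Rightarrow> 'a set \<Rightarrow> 'a set \<Rightarrow> real \<Rightarrow> (real \<Rightarrow> 'a) set" where
  "minimizers V c Am Ap R = {q \<in> Gamma V c Am Ap.
     infdist (q 0) (sublevel V c) = rho Am Ap R \<and>
     action V c q = min_action V c Am Ap \<and> Linf_le q R}"

text \<open>
  In \<open>ereal\<close> the supremum of the empty set is \<open>-\<infinity>\<close> and its infimum is \<open>\<infinity>\<close>, which are the
  values prescribed when \<open>q\<close> does not meet \<open>Am\<close>, respectively \<open>Ap\<close>.
\<close>

definition alpha :: "'a set \<Rightarrow> (real \<Rightarrow> 'a) \<Rightarrow> ereal" where
  "alpha Am q = Sup {ereal t |t. q t \<in> Am}"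

definition omega :: "'a set \<Rightarrow> 'a set \<Rightarrow> (real \<Rightarrow> 'a) \<Rightarrow> ereal" where
  "omega Am Ap q = Inf {ereal t |t. alpha Am q < ereal t \<and> q t \<in> Ap}"

text \<open>
  In each case the stated symmetry and periodicity laws determine \<open>qc\<close> from the piece of
  \<open>q\<close> on which the two agree.
\<close>

definition generated_by ::
  "'a set \<Rightarrow> 'a set \<Rightarrow> (real \<Rightarrow> 'a) \<Rightarrow> (real \<Rightarrow> 'a) \<Rightarrow> bool" where
  "generated_by Am Ap q qc \<longleftrightarrow>
     (alpha Am q = -\<infinity> \<and> omega Am Ap q = \<infinity> \<and> qc = q) \<or>
     (\<exists>w. alpha Am q = -\<infinity> \<and> omega Am Ap q = ereal w \<and>
        (\<forall>t\<le>w. qc t = q t) \<and> (\<forall>t. qc (2 * w - t) = qc t)) \<or>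
     (\<exists>a. alpha Am q = ereal a \<and> omega Am Ap q = \<infinity> \<and>
        (\<forall>t\<ge>a. qc t = q t) \<and> (\<forall>t. qc (2 * a - t) = qc t)) \<or>
     (\<exists>a w. alpha Am q = ereal a \<and> omega Am Ap q = ereal w \<and>
        (\<forall>t\<in>{a..w}. qc t = q t) \<and> (\<forall>t. qc (2 * w - t) = qc t) \<and>
        (\<forall>t. qc (t + 2 * (w - a)) = qc t))"

definition minimization_solution ::
  "('a::euclidean_space \<Rightarrow> real) \<Rightarrow> real \<Rightarrow> 'a set \<Rightarrow> 'a set \<Rightarrow> (real \<Rightarrow> 'a) \<Rightarrow> bool" where
  "minimization_solution V c Am Ap qc \<longleftrightarrow>
     (\<exists>R q. admissible_radius V c Am Ap R \<and> q \<in> minimizers V c Am Ap R \<and>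
        generated_by Am Ap q qc)"

definition vderiv :: "(real \<Rightarrow> 'a::real_normed_vector) \<Rightarrow> real \<Rightarrow> 'a" where
  "vderiv u = (\<lambda>t. vector_derivative u (at t))"

definition C2 :: "(real \<Rightarrow> 'a::real_normed_vector) \<Rightarrow> bool" where
  "C2 u \<longleftrightarrow> (\<forall>t. u differentiable (at t)) \<and> (\<forall>t. vderiv u differentiable (at t)) \<and>
     continuous_on UNIV (vderiv (vderiv u))"

definition converges_C2_loc ::
  "(nat \<Rightarrow> real \<Rightarrow> 'a::real_normed_vector) \<Rightarrow> (real \<Rightarrow> 'a) \<Rightarrow> bool" where
  "converges_C2_loc u u0 \<longleftrightarrow> (\<forall>k. C2 (u k)) \<and> C2 u0 \<and>
     (\<forall>K. compact K \<longrightarrow>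
        (\<forall>j\<le>2. uniform_limit K (\<lambda>k. (vderiv ^^ j) (u k)) ((vderiv ^^ j) u0) sequentially))"

definition solves_newton ::
  "('a::real_normed_vector \<Rightarrow> 'a) \<Rightarrow> (real \<Rightarrow> 'a) \<Rightarrow> bool" where
  "solves_newton G q \<longleftrightarrow> C2 q \<and> (\<forall>t. vderiv (vderiv q) t = G (q t))"

end

theory Submission
  imports Defs
begin

text \<open>
  A minimizer of \<open>J\<^sub>c\<close> has action bounded uniformly in \<open>c\<close>: join the midpoint of the wells to
  both components of the sublevel set by segments. Since \<open>V - c\<close> is bounded below far from the
  origin, the action bounds the minimizers uniformly. Dilating time on a half-line
  shows that kinetic and potential energy of a minimizer agree, and a single outer variation shows that
  it solves Newton's equation wherever \<open>V(q) > c\<close>; as the velocity vanishes where \<open>V(q) = c\<close>,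
  reflections extend this to a global solution of energy \<open>-c\<close>.

  Translate each solution so that at time \<open>0\<close> it is equidistant from the wells. By Gronwall's inequality
  a subsequence converges to a solution \<open>q\<^sub>0\<close> of energy \<open>0\<close> and finite action, so \<open>V(q\<^sub>0)\<close> vanishes at
  \<open>\<plusminus>\<infinity>\<close>. If \<open>q\<^sub>0\<close> came close to \<open>a\<^sub>-\<close> after time \<open>1\<close>, then replacing the past of the
  minimizers by a short segment into the well around \<open>a\<^sub>-\<close> would save the fixed amount
  \<open>\<integral>\<^sub>0\<^sup>1 V(q\<^sub>0)\<close>, contradicting minimality; symmetrically for \<open>a\<^sub>+\<close> and negative times.
\<close>

section \<open>Functions with a locally square integrable derivative\<close>

text \<open>Minimality belongs to the H^1 minimizer, but the limit is taken of its reflected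
  extension, which can be periodic with infinite total action. The limit itself reconciles the two:
  it stays at positive potential for all times, so on every bounded time interval the extensions
  eventually lie strictly above the level \<open>c\<close>, hence away from all reflection points,
  and coincide there with the minimizers. The normalisation at time 0 keeps the limit from being the
  rest point at a well. Admissible paths satisfy \<open>c \<le> V (q t)\<close>, so two-sided
  variations exist only where the inequality is strict; this is why the equation is first obtained
  on the pieces between the wells and only then continued. Weak derivatives are determined only up
  to null sets and \<open>weak_deriv\<close> is an arbitrary choice. All estimates are therefore
  made for a pair \<open>q\<close>, \<open>g\<close> in which \<open>g\<close> integrates to the
  increments of \<open>q\<close>.\<close>

definition has_L2_deriv :: "(real \<Rightarrow> 'a::euclidean_space) \<Rightarrow> (real \<Rightarrow> 'a) \<Rightarrow> bool" where
  "has_L2_deriv q g \<longleftrightarrow> loc_L2 g \<and> (\<forall>a b. a \<le> b \<longrightarrow> (g has_integral (q b - q a)) {a..b})"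

lemma norm_le_square_add_one: "norm x \<le> (norm x)\<^sup>2 + 1" for x :: "'a::real_normed_vector"
proof -
  have "0 \<le> (norm x - 1)\<^sup>2" by simp
  then show ?thesis by (simp add: power2_diff) (smt (verit) norm_ge_zero)
qed

lemma loc_L2_set_integrable:
  fixes g :: "real \<Rightarrow> 'a::euclidean_space"
  assumes "loc_L2 g"
  shows "set_integrable lborel {a..b} g"
proof -
  have m: "g \<in> borel_measurable lborel" using assms by (simp add: loc_L2_def)
  have "set_integrable lborel {a..b} (\<lambda>t. (norm (g t))\<^sup>2 + 1)"
    using assms borel_integrable_atLeastAtMost'[of a b "\<lambda>_. 1::real"]
    by (intro set_integral_add) (auto simp: loc_L2_def)
  then show ?thesis
    by (rule set_integrable_bound)
      (use m norm_le_square_add_one in \<open>auto simp: set_borel_measurable_def intro!: AE_I2\<close>)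
qed

lemma set_integrable_lborel_absolutely:
  fixes f :: "real \<Rightarrow> 'a::euclidean_space"
  assumes "set_integrable lborel S f"
  shows "f absolutely_integrable_on S"
proof -
  have "integrable lborel (\<lambda>x. indicator S x *\<^sub>R f x)" using assms by (simp add: set_integrable_def)
  then have "integrable lebesgue (\<lambda>x. indicator S x *\<^sub>R f x)"
    by (subst integrable_completion) auto
  then show ?thesis by (simp add: set_integrable_def)
qed

lemma loc_L2_absolutely_integrable:
  fixes g :: "real \<Rightarrow> 'a::euclidean_space"
  shows "loc_L2 g \<Longrightarrow> g absolutely_integrable_on {a..b}"
  by (intro set_integrable_lborel_absolutely loc_L2_set_integrable)

lemma continuous_loc_L2:
  fixes g :: "real \<Rightarrow> 'a::euclidean_space"
  assumes "continuous_on UNIV g"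
  shows "loc_L2 g"
  unfolding loc_L2_def
proof (intro conjI allI)
  show "g \<in> borel_measurable lborel" using assms borel_measurable_continuous_onI by simp
  fix a b :: real
  have "continuous_on {a..b} (\<lambda>t. (norm (g t))\<^sup>2)"
    using assms by (intro continuous_intros) (auto intro: continuous_on_subset)
  then show "set_integrable lborel {a..b} (\<lambda>t. (norm (g t))\<^sup>2)"
    by (rule borel_integrable_atLeastAtMost')
qed

lemma has_L2_deriv_integral:
  "has_L2_deriv q g \<Longrightarrow> a \<le> b \<Longrightarrow> integral {a..b} g = q b - q a"
  by (auto simp: has_L2_deriv_def)

lemma has_L2_deriv_continuous:
  fixes q :: "real \<Rightarrow> 'a::euclidean_space"
  assumes "has_L2_deriv q g"
  shows "continuous_on S q"
proof -
  have "continuous_on {-n..n} q" for n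
  proof -
    have "g integrable_on {-n..n}"
      using assms loc_L2_absolutely_integrable[of g "-n" n] by (simp add: has_L2_deriv_def absolutely_integrable_on_def)
    then have "continuous_on {-n..n} (\<lambda>x. q (-n) + integral {-n..x} g)"
      by (intro continuous_intros indefinite_integral_continuous_1)
    then show ?thesis
      by (rule continuous_on_eq) (use assms in \<open>auto simp: has_L2_deriv_integral\<close>)
  qed
  have "isCont q t" for t
    by (rule continuous_on_interior[OF \<open>continuous_on {-(\<bar>t\<bar>+1)..\<bar>t\<bar>+1} q\<close>]) auto
  then show ?thesis by (simp add: continuous_at_imp_continuous_on)
qed

text \<open>On a partition into equal pieces the bounds telescope to \<open>e * (G b - G a)\<close>,
  for every positive \<open>e\<close>. This replaces differentiation almost everywhere: the paths
  are only absolutely continuous, so identities between increments and integrals are checked on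
  short intervals up to such an error.\<close>

lemma additive_small_imp_zero:
  fixes D :: "real \<Rightarrow> real \<Rightarrow> 'a::real_normed_vector" and G :: "real \<Rightarrow> real"
  assumes "a \<le> b"
    and add: "\<And>x y z. a \<le> x \<Longrightarrow> x \<le> y \<Longrightarrow> y \<le> z \<Longrightarrow> z \<le> b \<Longrightarrow> D x z = D x y + D y z"
    and small: "\<And>e. e > 0 \<Longrightarrow> \<exists>d>0. \<forall>x y. a \<le> x \<longrightarrow> x \<le> y \<longrightarrow> y \<le> b \<longrightarrow> y - x < d \<longrightarrow>
      norm (D x y) \<le> e * (G y - G x)"
  shows "D a b = 0"
proof -
  have bd: "norm (D a b) \<le> e * (G b - G a)" if e: "e > 0" for e
  proof -
    obtain d where d: "d > 0" "\<And>x y. a \<le> x \<Longrightarrow> x \<le> y \<Longrightarrow> y \<le> b \<Longrightarrow> y - x < d \<Longrightarrow> norm (D x y) \<le> e * (G y - G x)"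
      using small[OF e] by blast
    obtain n :: nat where n: "(b - a) / d < real n" using reals_Archimedean2 by blast
    have "0 \<le> (b - a) / d" using assms(1) d by simp
    then have n0: "0 < real n" using n by linarith
    define h where "h = (b - a) / real n"
    have h: "0 \<le> h" "h < d" "real n * h = b - a"
      using n n0 d assms(1) by (auto simp: h_def field_simps)
    have "norm (D a (a + real k * h)) \<le> e * (G (a + real k * h) - G a)" if "k \<le> n" for k
      using that
    proof (induction k)
      case 0
      have "D a a = D a a + D a a" by (rule add) (use assms(1) in auto)
      then show ?case by simp
    next
      case (Suc k)
      have le: "real (Suc k) * h \<le> real n * h" using Suc.prems h(1) by (intro mult_right_mono) auto
      have *: "a \<le> a + real k * h" "a + real k * h \<le> a + real (Suc k) * h" "a + real (Suc k) * h \<le> b"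
        using h le by (auto simp: algebra_simps)
      have "norm (D a (a + real (Suc k) * h)) \<le> norm (D a (a + real k * h)) + norm (D (a + real k * h) (a + real (Suc k) * h))"
        using add[of a "a + real k * h" "a + real (Suc k) * h"] * by (simp add: norm_triangle_ineq)
      also have "\<dots> \<le> e * (G (a + real k * h) - G a) + e * (G (a + real (Suc k) * h) - G (a + real k * h))"
        using Suc.prems * h by (intro add_mono[OF Suc.IH] d(2)) (auto simp: distrib_right)
      finally show ?case by (simp add: algebra_simps)
    qed
    from this[of n] show ?thesis using h by simp
  qed
  show ?thesis
  proof (rule ccontr)
    assume "D a b \<noteq> 0"
    then have p: "norm (D a b) > 0" by simp
    define M where "M = \<bar>G b - G a\<bar> + 1"
    have M: "M > 0" "G b - G a \<le> M" by (auto simp: M_def)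
    have "norm (D a b) \<le> norm (D a b) / (2 * M) * (G b - G a)"
      using p M by (intro bd) simp
    also have "\<dots> \<le> norm (D a b) / (2 * M) * M"
      using p M by (intro mult_left_mono) auto
    also have "\<dots> = norm (D a b) / 2" using M by simp
    finally show False using p by simp
  qed
qed

section \<open>Integration by parts against a locally square integrable derivative\<close>

lemma scaleR_set_integrable:
  fixes g :: "real \<Rightarrow> 'a::euclidean_space" and \<Theta> :: "real \<Rightarrow> real"
  assumes "continuous_on UNIV \<Theta>" "loc_L2 g"
  shows "set_integrable lborel {a..b} (\<lambda>r. \<Theta> r *\<^sub>R g r)"
proof -
  have "compact (\<Theta> ` {a..b})"
    using assms(1) by (intro compact_continuous_image) (auto intro: continuous_on_subset)
  then obtain B where B: "\<forall>x\<in>\<Theta> ` {a..b}. norm x \<le> B"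
    using compact_imp_bounded bounded_pos by metis
  have m: "g \<in> borel_measurable borel" "\<Theta> \<in> borel_measurable borel"
    using assms borel_measurable_continuous_onI by (auto simp: loc_L2_def)
  have "set_integrable lborel {a..b} (\<lambda>r. B * norm (g r))"
    using loc_L2_set_integrable[OF assms(2)] by (intro set_integrable_mult_right) (simp add: set_integrable_norm)
  then show ?thesis
    by (rule set_integrable_bound)
      (use m B in \<open>auto simp: set_borel_measurable_def intro!: AE_I2 mult_right_mono order_trans[OF _ abs_ge_self]\<close>)
qed

lemma scaleR_absolutely_integrable:
  fixes g :: "real \<Rightarrow> 'a::euclidean_space" and \<Theta> :: "real \<Rightarrow> real"
  assumes "continuous_on UNIV \<Theta>" "loc_L2 g"
  shows "(\<lambda>r. \<Theta> r *\<^sub>R g r) absolutely_integrable_on {a..b}"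
  by (intro set_integrable_lborel_absolutely scaleR_set_integrable assms)

lemma by_parts_L2:
  fixes q :: "real \<Rightarrow> 'a::euclidean_space" and \<Theta> \<theta> :: "real \<Rightarrow> real"
  assumes q: "has_L2_deriv q g"
    and der: "\<And>t. (\<Theta> has_real_derivative \<theta> t) (at t)" and cont: "continuous_on UNIV \<theta>"
    and "a \<le> b"
  shows "((\<lambda>r. \<theta> r *\<^sub>R q r + \<Theta> r *\<^sub>R g r) has_integral (\<Theta> b *\<^sub>R q b - \<Theta> a *\<^sub>R q a)) {a..b}"
proof -
  have cT: "continuous_on UNIV \<Theta>"
    using der DERIV_continuous_on[of UNIV \<Theta> \<theta>] by auto
  have cq: "continuous_on S q" for S by (rule has_L2_deriv_continuous[OF q])
  have L2: "loc_L2 g" using q by (simp add: has_L2_deriv_def)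
  have gi: "g integrable_on {x..y}" "(\<lambda>r. norm (g r)) integrable_on {x..y}" for x y
    using loc_L2_absolutely_integrable[OF L2, of x y] by (auto simp: absolutely_integrable_on_def)
  define f where "f = (\<lambda>r. \<theta> r *\<^sub>R q r + \<Theta> r *\<^sub>R g r)"
  have fi: "f integrable_on {x..y}" for x y
  proof -
    have "continuous_on {x..y} (\<lambda>r. \<theta> r *\<^sub>R q r)"
      using cont cq by (intro continuous_intros) (auto intro: continuous_on_subset)
    moreover have "(\<lambda>r. \<Theta> r *\<^sub>R g r) integrable_on {x..y}"
      using scaleR_absolutely_integrable[OF cT L2] by (auto simp: absolutely_integrable_on_def)
    ultimately show ?thesis unfolding f_def
      by (intro integrable_add integrable_continuous_interval[of _ _ "\<lambda>r. \<theta> r *\<^sub>R q r"])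
  qed
  define D where "D = (\<lambda>x y. \<Theta> y *\<^sub>R q y - \<Theta> x *\<^sub>R q x - integral {x..y} f)"
  define G where "G = (\<lambda>y. integral {a..y} (\<lambda>r. norm (g r) + 1))"
  have "D a b = 0"
  proof (rule additive_small_imp_zero[where G = G, OF \<open>a \<le> b\<close>])
    fix x y z assume "a \<le> x" "x \<le> y" "y \<le> z" "z \<le> b"
    then have "integral {x..z} f = integral {x..y} f + integral {y..z} f"
      using Henstock_Kurzweil_Integration.integral_combine[of x y z f] fi by simp
    then show "D x z = D x y + D y z" by (simp add: D_def)
  next
    fix e :: real assume e: "e > 0"
    obtain B where B: "B > 0" "\<And>r. r \<in> {a..b} \<Longrightarrow> \<bar>\<theta> r\<bar> \<le> B"
    proof -
      have "compact (\<theta> ` {a..b})"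
        using cont by (intro compact_continuous_image) (auto intro: continuous_on_subset)
      then obtain B where "B > 0" "\<forall>x\<in>\<theta> ` {a..b}. norm x \<le> B"
        using compact_imp_bounded bounded_pos by metis
      then show ?thesis using that by auto
    qed
    have "uniformly_continuous_on {a..b} \<Theta>" "uniformly_continuous_on {a..b} q"
      using cT cq by (auto intro!: compact_uniformly_continuous intro: continuous_on_subset)
    then obtain d1 d2 where d: "d1 > 0" "d2 > 0"
      "\<And>x y. x \<in> {a..b} \<Longrightarrow> y \<in> {a..b} \<Longrightarrow> dist x y < d1 \<Longrightarrow> dist (\<Theta> x) (\<Theta> y) < e"
      "\<And>x y. x \<in> {a..b} \<Longrightarrow> y \<in> {a..b} \<Longrightarrow> dist x y < d2 \<Longrightarrow> dist (q x) (q y) < e / B"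
      unfolding uniformly_continuous_on_def using e B(1) by (metis zero_less_divide_iff dist_commute)
    show "\<exists>d>0. \<forall>x y. a \<le> x \<longrightarrow> x \<le> y \<longrightarrow> y \<le> b \<longrightarrow> y - x < d \<longrightarrow> norm (D x y) \<le> e * (G y - G x)"
    proof (intro exI[of _ "min d1 d2"] conjI allI impI)
      show "0 < min d1 d2" using d by simp
      fix x y assume xy: "a \<le> x" "x \<le> y" "y \<le> b" "y - x < min d1 d2"
      have 1: "((\<lambda>r. \<Theta> y *\<^sub>R g r + \<theta> r *\<^sub>R q x) has_integral (\<Theta> y *\<^sub>R (q y - q x) + (\<Theta> y - \<Theta> x) *\<^sub>R q x)) {x..y}"
      proof (intro has_integral_add has_integral_cmul has_integral_scaleR_left)
        show "(g has_integral q y - q x) {x..y}" using q xy by (simp add: has_L2_deriv_def)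
        show "(\<theta> has_integral \<Theta> y - \<Theta> x) {x..y}"
          using xy der by (intro fundamental_theorem_of_calculus)
            (auto simp: has_real_derivative_iff_has_vector_derivative[symmetric] has_field_derivative_at_within)
      qed
      have 2: "(f has_integral integral {x..y} f) {x..y}" using fi by blast
      have Deq: "D x y = (\<Theta> y *\<^sub>R (q y - q x) + (\<Theta> y - \<Theta> x) *\<^sub>R q x) - integral {x..y} f"
        by (simp add: D_def algebra_simps)
      have hD: "((\<lambda>r. (\<Theta> y *\<^sub>R g r + \<theta> r *\<^sub>R q x) - f r) has_integral D x y) {x..y}"
        unfolding Deq by (rule has_integral_diff[OF 1 2])
      have "norm (integral {x..y} (\<lambda>r. (\<Theta> y *\<^sub>R g r + \<theta> r *\<^sub>R q x) - f r)) \<le> integral {x..y} (\<lambda>r. e * (norm (g r) + 1))"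
      proof (rule integral_norm_bound_integral)
        show "(\<lambda>r. (\<Theta> y *\<^sub>R g r + \<theta> r *\<^sub>R q x) - f r) integrable_on {x..y}" using hD by blast
        show "(\<lambda>r. e * (norm (g r) + 1)) integrable_on {x..y}"
          using gi by (intro integrable_on_mult_right integrable_add) auto
        fix r assume r: "r \<in> {x..y}"
        have "(\<Theta> y *\<^sub>R g r + \<theta> r *\<^sub>R q x) - f r = (\<Theta> y - \<Theta> r) *\<^sub>R g r + \<theta> r *\<^sub>R (q x - q r)"
          by (simp add: f_def algebra_simps)
        then have "norm ((\<Theta> y *\<^sub>R g r + \<theta> r *\<^sub>R q x) - f r) \<le> \<bar>\<Theta> y - \<Theta> r\<bar> * norm (g r) + \<bar>\<theta> r\<bar> * norm (q x - q r)"
          by (metis norm_triangle_ineq norm_scaleR)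
        also have "\<dots> \<le> e * norm (g r) + B * (e / B)"
        proof (intro add_mono mult_mono)
          show "\<bar>\<Theta> y - \<Theta> r\<bar> \<le> e" using d(3)[of y r] xy r by (auto simp: dist_real_def)
          show "norm (q x - q r) \<le> e / B" using d(4)[of x r] xy r by (auto simp: dist_real_def dist_norm)
        qed (use B e xy r in auto)
        finally show "norm ((\<Theta> y *\<^sub>R g r + \<theta> r *\<^sub>R q x) - f r) \<le> e * (norm (g r) + 1)"
          using B by (simp add: algebra_simps)
      qed
      also have "\<dots> = e * integral {x..y} (\<lambda>r. norm (g r) + 1)" by simp
      also have "integral {x..y} (\<lambda>r. norm (g r) + 1) = G y - G x"
        using Henstock_Kurzweil_Integration.integral_combine[of a x y "\<lambda>r. norm (g r) + 1"] xy
          integrable_add[OF gi(2)[of a y] integrable_const_ivl[of 1 a y]]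
        unfolding G_def by simp
      finally show "norm (D x y) \<le> e * (G y - G x)" using hD by (simp add: integral_unique)
    qed
  qed
  then show ?thesis using fi[of a b] by (simp add: D_def f_def has_integral_iff)
qed

definition prim :: "(real \<Rightarrow> 'a::euclidean_space) \<Rightarrow> real \<Rightarrow> 'a" where
  "prim f t = (if 0 \<le> t then integral {0..t} f else - integral {t..0} f)"

lemma has_integral_prim:
  fixes f :: "real \<Rightarrow> 'a::euclidean_space"
  assumes "\<And>a b. f integrable_on {a..b}" "a \<le> b"
  shows "(f has_integral (prim f b - prim f a)) {a..b}"
proof -
  have "integral {a..b} f = prim f b - prim f a"
    using Henstock_Kurzweil_Integration.integral_combine[of 0 a b f]
      Henstock_Kurzweil_Integration.integral_combine[of a 0 b f]
      Henstock_Kurzweil_Integration.integral_combine[of a b 0 f] assms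
    by (cases "0 \<le> a"; cases "0 \<le> b") (auto simp: prim_def algebra_simps)
  then show ?thesis using assms(1)[of a b] by (simp add: has_integral_iff)
qed

lemma has_L2_deriv_prim: "loc_L2 g \<Longrightarrow> has_L2_deriv (prim g) g"
  using has_integral_prim[of g] loc_L2_absolutely_integrable[of g]
  by (auto simp: has_L2_deriv_def absolutely_integrable_on_def)

lemma prim_has_vector_derivative:
  fixes f :: "real \<Rightarrow> 'a::euclidean_space"
  assumes "continuous_on UNIV f"
  shows "(prim f has_vector_derivative f t) (at t)"
proof -
  have c: "continuous_on S f" for S using assms continuous_on_subset by blast
  have i: "f integrable_on {a..b}" for a b using c integrable_continuous_interval by blast
  have "((\<lambda>u. integral {t-1..u} f) has_vector_derivative f t) (at t within {t-1..t+1})"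
    by (rule integral_has_vector_derivative) (use c in auto)
  then have "((\<lambda>u. prim f (t-1) + integral {t-1..u} f) has_vector_derivative f t) (at t within {t-1..t+1})"
    by (auto intro!: derivative_eq_intros)
  then have "(prim f has_vector_derivative f t) (at t within {t-1..t+1})"
  proof (rule has_vector_derivative_transform[rotated 2])
    fix u assume "u \<in> {t-1..t+1}"
    then show "prim f u = prim f (t-1) + integral {t-1..u} f"
      using has_integral_prim[of f "t-1" u] i by (simp add: integral_unique)
  qed auto
  then show ?thesis by (simp add: at_within_Icc_at)
qed

section \<open>Weak derivatives and primitives\<close>

lemma integral_lborel_support:
  fixes f :: "real \<Rightarrow> 'a::euclidean_space"
  assumes "set_integrable lborel {a..b} f" "\<And>t. t \<notin> {a..b} \<Longrightarrow> f t = 0"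
  shows "integrable lborel f" "(LBINT t. f t) = integral {a..b} f"
proof -
  have eq: "(\<lambda>t. indicator {a..b} t *\<^sub>R f t) = f" using assms(2) by (auto simp: indicator_def)
  show "integrable lborel f" using assms(1) unfolding set_integrable_def eq .
  have "(LBINT t. f t) = (LINT t:{a..b}|lborel. f t)" unfolding set_lebesgue_integral_def eq ..
  then show "(LBINT t. f t) = integral {a..b} f"
    using set_borel_integral_eq_integral(2)[OF assms(1)] by simp
qed

lemma test_functionE:
  assumes "test_function \<phi>"
  obtains n where "n > 0" "\<And>t. (\<phi> has_real_derivative deriv \<phi> t) (at t)" "continuous_on UNIV (deriv \<phi>)"
    "\<And>t. t \<notin> {-n<..<n} \<Longrightarrow> \<phi> t = 0" "\<And>t. t \<notin> {-n<..<n} \<Longrightarrow> deriv \<phi> t = 0"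
proof -
  obtain D where D: "\<And>t. (\<phi> has_real_derivative D t) (at t)" "continuous_on UNIV D"
    using assms unfolding test_function_def C1_differentiable_on_def
    by (auto simp: has_real_derivative_iff_has_vector_derivative)
  have dD: "deriv \<phi> = D" using D(1) DERIV_imp_deriv by blast
  have "bounded (closure {t. \<phi> t \<noteq> 0})" using assms compact_imp_bounded by (auto simp: test_function_def)
  then obtain n where n: "n > 0" "\<And>t. t \<in> closure {t. \<phi> t \<noteq> 0} \<Longrightarrow> norm t \<le> n"
    unfolding bounded_pos by blast
  have z: "\<phi> t = 0" if "\<bar>t\<bar> > n" for t
    using n(2)[of t] that closure_subset[of "{t. \<phi> t \<noteq> 0}"] by auto
  have z': "D t = 0" if "\<bar>t\<bar> > n" for t
  proof -
    have "open {s::real. \<bar>s\<bar> > n}" by (intro open_Collect_less continuous_intros)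
    then have "eventually (\<lambda>s. \<phi> s = 0) (nhds t)"
      unfolding eventually_nhds using that z by (intro exI[of _ "{s. \<bar>s\<bar> > n}"]) auto
    then have "((\<lambda>_. 0) has_real_derivative D t) (at t)"
      using DERIV_cong_ev[of t t \<phi> "\<lambda>_. 0" "D t" "D t"] D(1)[of t] by simp
    then show ?thesis using DERIV_unique[OF _ DERIV_const] by metis
  qed
  \<comment> \<open>One unit beyond the support, so that \<open>\<phi>\<close> and its derivative
    vanish at the end points as well.\<close>
  show ?thesis
    by (rule that[of "n+1"]) (use n(1) D z z' dD in auto)
qed

lemma has_L2_deriv_weak_derivative:
  fixes q :: "real \<Rightarrow> 'a::euclidean_space"
  assumes q: "has_L2_deriv q g"
  shows "is_weak_derivative q g"
  unfolding is_weak_derivative_def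
proof (intro allI impI)
  fix \<phi> assume "test_function \<phi>"
  then obtain n where n: "n > 0" "\<And>t. (\<phi> has_real_derivative deriv \<phi> t) (at t)" "continuous_on UNIV (deriv \<phi>)"
    "\<And>t. t \<notin> {-n<..<n} \<Longrightarrow> \<phi> t = 0" "\<And>t. t \<notin> {-n<..<n} \<Longrightarrow> deriv \<phi> t = 0" by (rule test_functionE) blast
  have c: "continuous_on UNIV \<phi>" using n(2) DERIV_continuous_on[of UNIV \<phi> "deriv \<phi>"] by auto
  have L2: "loc_L2 g" "loc_L2 q" using q has_L2_deriv_continuous[OF q] continuous_loc_L2 by (auto simp: has_L2_deriv_def)
  have i1: "set_integrable lborel {-n..n} (\<lambda>t. deriv \<phi> t *\<^sub>R q t)" by (intro scaleR_set_integrable n L2)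
  have i2: "set_integrable lborel {-n..n} (\<lambda>t. \<phi> t *\<^sub>R g t)" by (intro scaleR_set_integrable c L2)
  have "((\<lambda>r. deriv \<phi> r *\<^sub>R q r + \<phi> r *\<^sub>R g r) has_integral (\<phi> n *\<^sub>R q n - \<phi> (-n) *\<^sub>R q (-n))) {-n..n}"
    using n by (intro by_parts_L2[OF q]) auto
  moreover have "((\<lambda>r. deriv \<phi> r *\<^sub>R q r + \<phi> r *\<^sub>R g r) has_integral
     ((LBINT t. deriv \<phi> t *\<^sub>R q t) + (LBINT t. \<phi> t *\<^sub>R g t))) {-n..n}"
  proof (intro has_integral_add)
    have "deriv \<phi> t *\<^sub>R q t = 0" "\<phi> t *\<^sub>R g t = 0" if "t \<notin> {-n..n}" for t
      using n(4)[of t] n(5)[of t] that by auto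
    then show "((\<lambda>r. deriv \<phi> r *\<^sub>R q r) has_integral (LBINT t. deriv \<phi> t *\<^sub>R q t)) {-n..n}"
        "((\<lambda>r. \<phi> r *\<^sub>R g r) has_integral (LBINT t. \<phi> t *\<^sub>R g t)) {-n..n}"
      using integral_lborel_support(2)[OF i1] integral_lborel_support(2)[OF i2]
        set_borel_integral_eq_integral(1)[OF i1] set_borel_integral_eq_integral(1)[OF i2]
      by (auto simp: has_integral_iff)
  qed
  ultimately have "(LBINT t. deriv \<phi> t *\<^sub>R q t) + (LBINT t. \<phi> t *\<^sub>R g t) = \<phi> n *\<^sub>R q n - \<phi> (-n) *\<^sub>R q (-n)"
    by (rule has_integral_unique[rotated])
  then have "(LBINT t. deriv \<phi> t *\<^sub>R q t) + (LBINT t. \<phi> t *\<^sub>R g t) = 0"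
    using n(4)[of n] n(4)[of "-n"] by simp
  then show "(LBINT t. deriv \<phi> t *\<^sub>R q t) = - (LBINT t. \<phi> t *\<^sub>R g t)" by (simp add: eq_neg_iff_add_eq_0)
qed

lemma has_L2_deriv_H1_loc:
  "has_L2_deriv q g \<Longrightarrow> q \<in> H1_loc"
  unfolding H1_loc_def
  using has_L2_deriv_weak_derivative[of q g] has_L2_deriv_continuous[of q g UNIV] continuous_loc_L2[of q]
  unfolding has_L2_deriv_def by blast

lemma test_function_integrable:
  fixes q :: "real \<Rightarrow> 'a::euclidean_space"
  assumes "test_function \<phi>" "loc_L2 q"
  shows "integrable lborel (\<lambda>t. deriv \<phi> t *\<^sub>R q t)"
proof -
  from assms(1) obtain n where n: "n > 0" "continuous_on UNIV (deriv \<phi>)"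
    "\<And>t. t \<notin> {-n<..<n} \<Longrightarrow> deriv \<phi> t = 0" by (rule test_functionE) blast
  show ?thesis
    by (rule integral_lborel_support(1)[where a = "-n" and b = n])
      (use n assms scaleR_set_integrable in auto)
qed

text \<open>Testing with the derivative \<open>(t - a)(b - t)(Q t \<bullet> v - m)\<close>, where \<open>m\<close> makes its integral vanish.\<close>
lemma weak_derivative_zero:
  fixes Q :: "real \<Rightarrow> 'a::euclidean_space"
  assumes cQ: "continuous_on UNIV Q"
    and weak: "\<And>\<phi>. test_function \<phi> \<Longrightarrow> (LBINT t. deriv \<phi> t *\<^sub>R Q t) = 0"
    and "a < b"
  shows "Q a = Q b"
proof -
  \<comment> \<open>Only the component of \<open>Q\<close> along this vector is tested:
    \<open>f a = f b\<close> then says that the vector is orthogonal to itself.\<close>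
  define v where "v = Q a - Q b"
  \<comment> \<open>The larger interval puts \<open>a\<close> and \<open>b\<close> where the weight
    \<open>w\<close> is positive; at its own end points the weight vanishes and nothing could be
    concluded.\<close>
  define a' b' where "a' = a - 1" and "b' = b + 1"
  define f where "f = (\<lambda>t. Q t \<bullet> v)"
  define w where "w = (\<lambda>t. (t - a') * (b' - t))"
  define m where "m = integral {a'..b'} (\<lambda>t. w t * f t) / integral {a'..b'} w"
  \<comment> \<open>Cutting \<open>w\<close> off at 0 extends the function by zero and keeps it
    continuous, so its primitive \<open>\<phi>\<close> is of class C^1. The mean value zero makes
    \<open>\<phi>\<close> vanish again to the right of \<open>b'\<close>.\<close>
  define \<psi> where "\<psi> = (\<lambda>t. max 0 (w t) * (f t - m))"
  define \<phi> where "\<phi> = (\<lambda>t. prim \<psi> t - prim \<psi> a')"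
  have ab: "a' < b'" using assms by (simp add: a'_def b'_def)
  have wpos: "w t > 0" if "t \<in> {a'<..<b'}" for t using that by (auto simp: w_def)
  have wneg: "w t \<le> 0" if "t \<notin> {a'<..<b'}" for t
    using that ab by (auto simp: w_def not_less intro: mult_nonpos_nonneg mult_nonneg_nonpos)
  have wnn: "w t \<ge> 0" if "t \<in> {a'..b'}" for t using that by (auto simp: w_def)
  have cf: "continuous_on S f" for S unfolding f_def using cQ by (intro continuous_intros) (auto intro: continuous_on_subset)
  have cw: "continuous_on S w" for S unfolding w_def by (intro continuous_intros)
  have cp: "continuous_on S \<psi>" for S unfolding \<psi>_def by (intro continuous_intros cf cw)
  have wint: "integral {a'..b'} w \<noteq> 0"
    using integral_eq_0_iff[OF cw, of a' b'] ab wnn wpos[of "(a'+b')/2"] by force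
  have p0: "\<psi> t = 0" if "t \<notin> {a'<..<b'}" for t using wneg[OF that] by (simp add: \<psi>_def)
  have pe: "\<psi> t = w t * (f t - m)" if "t \<in> {a'..b'}" for t using wnn[OF that] by (simp add: \<psi>_def)
  have ii: "\<psi> integrable_on {x..y}" for x y by (intro integrable_continuous_interval cp)
  have "integral {a'..b'} \<psi> = integral {a'..b'} (\<lambda>t. w t * f t - m * w t)"
    by (rule integral_cong) (simp add: pe algebra_simps)
  also have "\<dots> = integral {a'..b'} (\<lambda>t. w t * f t) - m * integral {a'..b'} w"
    by (subst Henstock_Kurzweil_Integration.integral_diff)
      (auto intro!: integrable_continuous_interval continuous_intros cf cw)
  also have "\<dots> = 0" using wint by (simp add: m_def)
  finally have int0: "integral {a'..b'} \<psi> = 0" .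
  have dphi: "(\<phi> has_real_derivative \<psi> t) (at t)" for t
    unfolding has_real_derivative_iff_has_vector_derivative \<phi>_def
    using prim_has_vector_derivative[OF cp, of t] by (auto intro!: derivative_eq_intros)
  then have ddphi: "deriv \<phi> = \<psi>" using DERIV_imp_deriv by blast
  have phi0: "\<phi> t = 0" if "t \<notin> {a'..b'}" for t
  proof (cases "t \<le> a'")
    case True
    have "(\<psi> has_integral prim \<psi> a' - prim \<psi> t) {t..a'}" using True ii by (intro has_integral_prim) auto
    moreover have "(\<psi> has_integral 0) {t..a'}"
      by (rule has_integral_is_0) (auto intro!: p0)
    ultimately have "prim \<psi> a' - prim \<psi> t = 0" by (rule has_integral_unique)
    then show ?thesis by (simp add: \<phi>_def)
  next
    case False
    then have t: "t > b'" using that by auto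
    have "(\<psi> has_integral prim \<psi> t - prim \<psi> a') {a'..t}" using False ii by (intro has_integral_prim) auto
    moreover have "(\<psi> has_integral 0 + 0) {a'..t}"
    proof (rule has_integral_combine[of a' b' t])
      show "(\<psi> has_integral 0) {a'..b'}" using int0 ii[of a' b'] by (simp add: has_integral_iff)
      show "(\<psi> has_integral 0) {b'..t}" by (rule has_integral_is_0) (auto intro!: p0)
    qed (use ab t in auto)
    ultimately have "prim \<psi> t - prim \<psi> a' = 0 + 0" by (rule has_integral_unique)
    then show ?thesis by (simp add: \<phi>_def)
  qed
  have "test_function \<phi>"
    unfolding test_function_def C1_differentiable_on_def
  proof (intro conjI exI[of _ \<psi>] ballI)
    show "(\<phi> has_vector_derivative \<psi> x) (at x)" for x
      using dphi by (simp add: has_real_derivative_iff_has_vector_derivative)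
    have "closure {t. \<phi> t \<noteq> 0} \<subseteq> {a'..b'}" using phi0 by (intro closure_minimal subsetI closed_atLeastAtMost) blast
    then show "compact (closure {t. \<phi> t \<noteq> 0})"
      by (metis compact_eq_bounded_closed bounded_subset closed_closure compact_Icc)
  qed (rule cp)
  from weak[OF this] have z: "(LBINT t. \<psi> t *\<^sub>R Q t) = 0" by (simp add: ddphi)
  have "(LBINT t. \<psi> t *\<^sub>R Q t) = integral {a'..b'} (\<lambda>t. \<psi> t *\<^sub>R Q t)"
    using p0 cQ by (intro integral_lborel_support scaleR_set_integrable continuous_loc_L2 cp) auto
  then have "integral {a'..b'} (\<lambda>t. \<psi> t *\<^sub>R Q t) \<bullet> v = 0" using z by simp
  moreover have "integral {a'..b'} (\<lambda>t. \<psi> t *\<^sub>R Q t) \<bullet> v = integral {a'..b'} (\<lambda>t. (\<psi> t *\<^sub>R Q t) \<bullet> v)"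
    by (rule integral_linear[OF _ bounded_linear_inner_left, unfolded o_def, symmetric])
      (intro integrable_continuous_interval continuous_intros cp continuous_on_subset[OF cQ] subset_UNIV)
  ultimately have z1: "integral {a'..b'} (\<lambda>t. \<psi> t * f t) = 0" by (simp add: f_def)
  \<comment> \<open>As \<open>\<psi>\<close> has mean zero, \<open>f\<close> may be replaced by
    \<open>f - m\<close> in the tested integral, which becomes a weighted square.\<close>
  have "integral {a'..b'} (\<lambda>t. w t * (f t - m)\<^sup>2) = integral {a'..b'} (\<lambda>t. \<psi> t * f t - m * \<psi> t)"
    by (rule integral_cong) (simp add: pe algebra_simps power2_eq_square)
  also have "\<dots> = 0"
    by (subst Henstock_Kurzweil_Integration.integral_diff)
      (auto intro!: integrable_continuous_interval continuous_intros cf cp simp: z1 int0)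
  finally have "integral {a'..b'} (\<lambda>t. w t * (f t - m)\<^sup>2) = 0" .
  moreover have "continuous_on {a'..b'} (\<lambda>t. w t * (f t - m)\<^sup>2)" by (intro continuous_intros cf cw)
  ultimately have "\<forall>t\<in>{a'..b'}. w t * (f t - m)\<^sup>2 = 0"
    using integral_eq_0_iff[of a' b' "\<lambda>t. w t * (f t - m)\<^sup>2"] ab wnn by simp
  then have "f t = m" if "t \<in> {a'<..<b'}" for t using wpos[OF that] that by force
  then have "f a = f b" using assms(3) by (simp add: a'_def b'_def)
  then have "v \<bullet> v = 0" by (simp add: f_def v_def inner_diff)
  then show ?thesis by (simp add: v_def)
qed

text \<open>The difference between \<open>q\<close> and a primitive of \<open>g\<close> is
  continuous with weak derivative zero, hence constant. This turns the definition of
  \<open>H1_loc\<close> into a statement about increments, which all later constructions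
  use.\<close>

lemma weak_derivative_has_L2_deriv:
  fixes q :: "real \<Rightarrow> 'a::euclidean_space"
  assumes "continuous_on UNIV q" "loc_L2 g" "is_weak_derivative q g"
  shows "has_L2_deriv q g"
  unfolding has_L2_deriv_def
proof (intro conjI allI impI)
  fix a b :: real assume "a \<le> b"
  have P: "has_L2_deriv (prim g) g" using assms(2) by (rule has_L2_deriv_prim)
  have cP: "continuous_on UNIV (prim g)" by (rule has_L2_deriv_continuous[OF P])
  have "q a - prim g a = q b - prim g b"
  proof (cases "a = b")
    case False
    show ?thesis
    proof (rule weak_derivative_zero)
      show "continuous_on UNIV (\<lambda>t. q t - prim g t)" using assms(1) cP by (intro continuous_intros)
      fix \<phi> assume t: "test_function \<phi>"
      have "(LBINT t. deriv \<phi> t *\<^sub>R q t) = (LBINT t. deriv \<phi> t *\<^sub>R prim g t)"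
        using assms(3) has_L2_deriv_weak_derivative[OF P] t by (simp add: is_weak_derivative_def)
      moreover have "integrable lborel (\<lambda>t. deriv \<phi> t *\<^sub>R q t)" "integrable lborel (\<lambda>t. deriv \<phi> t *\<^sub>R prim g t)"
        using t assms(1) cP by (auto intro: test_function_integrable continuous_loc_L2)
      ultimately show "(LBINT t. deriv \<phi> t *\<^sub>R (q t - prim g t)) = 0"
        by (simp add: scaleR_diff_right)
    qed (use False \<open>a \<le> b\<close> in simp)
  qed simp
  then have eq: "q b - q a = prim g b - prim g a" by (simp add: algebra_simps)
  show "(g has_integral q b - q a) {a..b}"
    using P \<open>a \<le> b\<close> unfolding eq has_L2_deriv_def by blast
qed fact

text \<open>Closed intervals are stable under intersection and generate the Borel sets, and
  vanishing of the integral passes to complements and disjoint unions. The function is cut off to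
  \<open>[-n, n]\<close> first, since it is integrable only locally.\<close>

lemma interval_integrals_zero_imp_AE_zero:
  fixes h :: "real \<Rightarrow> 'a::euclidean_space"
  assumes i: "\<And>a b. set_integrable lborel {a..b} h"
    and z: "\<And>a b. integral {a..b} h = 0"
  shows "AE t in lborel. h t = 0"
proof -
  have "AE t in lborel. indicator {- real n..real n} t *\<^sub>R h t = 0" for n :: nat
  proof (rule sigma_finite_measure.density_zero[OF lborel.sigma_finite_measure_axioms])
    let ?f = "\<lambda>t. indicator {- real n..real n} t *\<^sub>R h t"
    show f: "integrable lborel ?f" using i[of "-real n" "real n"] by (simp add: set_integrable_def)
    have si: "set_integrable lborel B ?f" if "B \<in> sets borel" for B
      using integrable_mult_indicator[OF _ f, of B] that by (simp add: set_integrable_def)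
    have ivl: "(LINT t:{a..b}|lborel. ?f t) = 0" for a b :: real
    proof -
      have "(LINT t:{a..b}|lborel. ?f t) = (LINT t:{max a (-real n)..min b (real n)}|lborel. h t)"
        unfolding set_lebesgue_integral_def
        by (rule Bochner_Integration.integral_cong) (auto simp: indicator_def)
      also have "\<dots> = 0" using set_borel_integral_eq_integral(2)[OF i] z by simp
      finally show ?thesis .
    qed
    fix A :: "real set" assume "A \<in> sets lborel"
    then have "A \<in> sigma_sets UNIV (range (\<lambda>(a, b). {a..b::real}))"
      by (simp add: borel_eq_atLeastAtMost)
    then show "(LINT t:A|lborel. ?f t) = 0"
    proof (induction rule: sigma_sets_induct_disjoint[rotated 2, consumes 1, case_names basic empty compl union])
      case (basic B)
      then show ?case using ivl by auto
    next
      case empty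
      show ?case by (simp add: set_lebesgue_integral_def)
    next
      case (compl B)
      have B: "B \<in> sets borel" using compl(1) by (simp add: borel_eq_atLeastAtMost)
      \<comment> \<open>The cut-off function lives on one interval, so its integral over the whole
        line is among those known to vanish.\<close>
      have "(LINT t:UNIV|lborel. ?f t) = (LINT t:{-real n..real n}|lborel. ?f t)"
        unfolding set_lebesgue_integral_def by (rule Bochner_Integration.integral_cong) (auto simp: indicator_def)
      then have "(LINT t:UNIV|lborel. ?f t) = 0" using ivl by simp
      moreover have "(LINT t:UNIV|lborel. ?f t) = (LINT t:B|lborel. ?f t) + (LINT t:UNIV - B|lborel. ?f t)"
        using set_integral_Un[of B "UNIV - B" lborel ?f] si[of B] si[of "UNIV - B"] B by auto
      ultimately show ?case using compl by simp
    next
      case (union B)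
      have B: "B k \<in> sets borel" for k using union(2) by (auto simp: borel_eq_atLeastAtMost)
      have "(LINT t:(\<Union>k. B k)|lborel. ?f t) = (\<Sum>k. (LINT t:B k|lborel. ?f t))"
        using B union(1) si[of "\<Union>k. B k"]
        by (intro lebesgue_integral_countable_add) (auto simp: disjoint_family_on_def)
      then show ?case using union by simp
    next
      show "Int_stable (range (\<lambda>(a, b). {a..b::real}))"
        unfolding Int_stable_def by (auto simp: image_iff) 
    qed simp
  qed
  then have "AE t in lborel. \<forall>n. indicator {- real n..real n} t *\<^sub>R h t = 0"
    unfolding AE_all_countable by blast
  then show ?thesis
  proof eventually_elim
    case (elim t)
    obtain n :: nat where "\<bar>t\<bar> \<le> real n" using real_arch_simple by blast
    then show "h t = 0" using elim[rule_format, of n] by (auto simp: indicator_def split: if_splits)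
  qed
qed

lemma has_L2_deriv_unique:
  assumes "has_L2_deriv q g" "has_L2_deriv q g'"
  shows "AE t in lborel. g t = g' t"
proof -
  have L: "loc_L2 g" "loc_L2 g'" using assms by (auto simp: has_L2_deriv_def)
  have "AE t in lborel. g t - g' t = 0"
  proof (rule interval_integrals_zero_imp_AE_zero)
    fix a b :: real
    show "set_integrable lborel {a..b} (\<lambda>t. g t - g' t)"
      using L by (intro set_integral_diff loc_L2_set_integrable)
    show "integral {a..b} (\<lambda>t. g t - g' t) = 0"
    proof (cases "a \<le> b")
      case True
      then have "((\<lambda>t. g t - g' t) has_integral (q b - q a) - (q b - q a)) {a..b}"
        using assms by (intro has_integral_diff) (auto simp: has_L2_deriv_def)
      then show ?thesis by (simp add: integral_unique)
    qed simp
  qed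
  then show ?thesis by simp
qed

text \<open>This is the Lagrangian, the integrand of the action. In the conserved energy of a
  solution the potential enters with the opposite sign.\<close>

definition energy :: "('a::euclidean_space \<Rightarrow> real) \<Rightarrow> real \<Rightarrow> (real \<Rightarrow> 'a) \<Rightarrow> (real \<Rightarrow> 'a) \<Rightarrow> real \<Rightarrow> real" where
  "energy V c q g t = (norm (g t))\<^sup>2 / 2 + (V (q t) - c)"

abbreviation action_on where
  "action_on A V c q g \<equiv> (\<integral>\<^sup>+t\<in>A. ennreal (energy V c q g t) \<partial>lborel)"

lemma H1_loc_weak_deriv:
  assumes "q \<in> H1_loc"
  shows "has_L2_deriv q (weak_deriv q)"
proof -
  have "\<exists>g. loc_L2 g \<and> is_weak_derivative q g" using assms by (simp add: H1_loc_def)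
  then have "loc_L2 (weak_deriv q) \<and> is_weak_derivative q (weak_deriv q)"
    unfolding weak_deriv_def by (rule someI_ex)
  then show ?thesis using assms by (intro weak_derivative_has_L2_deriv) (auto simp: H1_loc_def)
qed

text \<open>Two derivatives of the same path agree almost everywhere, so the choice inside
  \<open>weak_deriv\<close> can be replaced by whatever derivative a constructed path comes
  with.\<close>

lemma action_eq:
  assumes "has_L2_deriv q g"
  shows "action V c q = (\<integral>\<^sup>+t. ennreal (energy V c q g t) \<partial>lborel)"
proof -
  have "has_L2_deriv q (weak_deriv q)"
    by (rule H1_loc_weak_deriv[OF has_L2_deriv_H1_loc[OF assms]])
  from has_L2_deriv_unique[OF this assms] show ?thesis
    unfolding action_def energy_def by (intro nn_integral_cong_AE) auto
qed

lemma energy_measurable: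
  fixes V :: "'a::euclidean_space \<Rightarrow> real"
  assumes "has_L2_deriv q g" "continuous_on UNIV V"
  shows "energy V c q g \<in> borel_measurable borel"
proof -
  have "g \<in> borel_measurable borel" using assms(1) by (simp add: has_L2_deriv_def loc_L2_def)
  moreover have "q \<in> borel_measurable borel"
    using has_L2_deriv_continuous[OF assms(1)] borel_measurable_continuous_onI by blast
  moreover have "V \<in> borel_measurable borel" using assms(2) borel_measurable_continuous_onI by blast
  ultimately show ?thesis unfolding energy_def[abs_def] by measurable
qed

section \<open>Gluing, dilating and reflecting paths\<close>

lemma has_L2_deriv_join:
  fixes f h :: "real \<Rightarrow> 'a::euclidean_space"
  assumes f: "has_L2_deriv f f'" and h: "has_L2_deriv h h'" and fh: "f s = h s"
  shows "has_L2_deriv (\<lambda>t. if t \<le> s then f t else h t) (\<lambda>t. if t \<le> s then f' t else h' t)"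
    (is "has_L2_deriv ?q ?g")
  unfolding has_L2_deriv_def loc_L2_def
proof (intro conjI allI impI)
  have L: "loc_L2 f'" "loc_L2 h'" using f h by (auto simp: has_L2_deriv_def)
  have m: "f' \<in> borel_measurable borel" "h' \<in> borel_measurable borel" using L by (auto simp: loc_L2_def)
  then show mg: "?g \<in> borel_measurable lborel" by measurable
  fix a b :: real
  have "set_integrable lborel {a..b} (\<lambda>t. (norm (f' t))\<^sup>2 + (norm (h' t))\<^sup>2)"
    using L by (intro set_integral_add) (auto simp: loc_L2_def)
  then show "set_integrable lborel {a..b} (\<lambda>t. (norm (?g t))\<^sup>2)"
  proof (rule set_integrable_bound)
    show "set_borel_measurable lborel {a..b} (\<lambda>t. (norm (?g t))\<^sup>2)"
      using mg unfolding set_borel_measurable_def by simp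
  qed (auto intro!: AE_I2)
  assume ab: "a \<le> b"
  have *: "(?g has_integral ?q b - ?q a) {a..b}" if "a \<le> b" "b \<le> s" for a b
  proof (rule has_integral_eq[of _ f'])
    show "(f' has_integral ?q b - ?q a) {a..b}" using f that by (auto simp: has_L2_deriv_def)
  qed (use that in auto)
  \<comment> \<open>On this side \<open>?g\<close> and \<open>h'\<close> can differ at the joint
    \<open>s\<close> only, and one point does not affect the integral.\<close>
  have **: "(?g has_integral ?q b - ?q a) {a..b}" if "a \<le> b" "s \<le> a" for a b
  proof (rule has_integral_spike_finite[of "{s}" _ _ h'])
    have "b = s" if "b \<le> s" using \<open>a \<le> b\<close> \<open>s \<le> a\<close> that by linarith
    moreover have "a = s" if "a \<le> s" using \<open>s \<le> a\<close> that by linarith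
    ultimately have "?q a = h a" "?q b = h b" using fh by (auto split: if_splits)
    then show "(h' has_integral ?q b - ?q a) {a..b}" using h that by (auto simp: has_L2_deriv_def)
  qed (use that in auto)
  show "(?g has_integral ?q b - ?q a) {a..b}"
  proof (cases "b \<le> s \<or> s \<le> a")
    case True
    then show ?thesis using * ** ab by blast
  next
    case False
    then have "(?g has_integral (?q s - ?q a) + (?q b - ?q s)) {a..b}"
      by (intro has_integral_combine[of a s b] * **) auto
    then show ?thesis by simp
  qed
qed

text \<open>The factor \<open>m = 1\<close> gives translations; other factors give the dilations
  behind equipartition.\<close>

lemma has_L2_deriv_affine:
  fixes q :: "real \<Rightarrow> 'a::euclidean_space"
  assumes q: "has_L2_deriv q g" and m: "m > 0"
  shows "has_L2_deriv (\<lambda>t. q (m * t + k)) (\<lambda>t. m *\<^sub>R g (m * t + k))"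
  unfolding has_L2_deriv_def loc_L2_def
proof (intro conjI allI impI)
  have L: "loc_L2 g" using q by (auto simp: has_L2_deriv_def)
  have mg: "g \<in> borel_measurable borel" using L by (auto simp: loc_L2_def)
  then show "(\<lambda>t. m *\<^sub>R g (m * t + k)) \<in> borel_measurable lborel" by measurable
  fix a b :: real
  have "integrable lborel (\<lambda>t. indicator {m*a+k..m*b+k} t * (norm (g t))\<^sup>2)"
    using L by (auto simp: loc_L2_def set_integrable_def)
  then have "integrable lborel (\<lambda>t. indicator {m*a+k..m*b+k} (k + m * t) * (norm (g (k + m * t)))\<^sup>2)"
    by (rule lborel_integrable_real_affine) (use m in simp)
  then have "integrable lborel (\<lambda>t. m\<^sup>2 * (indicator {m*a+k..m*b+k} (k + m * t) * (norm (g (k + m * t)))\<^sup>2))"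
    by (rule integrable_mult_right)
  also have "(\<lambda>t. m\<^sup>2 * (indicator {m*a+k..m*b+k} (k + m * t) * (norm (g (k + m * t)))\<^sup>2)) =
      (\<lambda>t. indicator {a..b} t *\<^sub>R (norm (m *\<^sub>R g (m * t + k)))\<^sup>2)"
    using m by (auto simp: fun_eq_iff indicator_def power_mult_distrib add.commute)
  finally show "set_integrable lborel {a..b} (\<lambda>t. (norm (m *\<^sub>R g (m * t + k)))\<^sup>2)"
    by (simp add: set_integrable_def)
  assume ab: "a \<le> b"
  have "(g has_integral q (m*b+k) - q (m*a+k)) (cbox (m*a+k) (m*b+k))"
    using q m ab by (auto simp: has_L2_deriv_def)
  from has_integral_affinity'[OF this m, of k] m
  have "((\<lambda>t. g (m * t + k)) has_integral (1/m) *\<^sub>R (q (m*b+k) - q (m*a+k))) {a..b}"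
    by (simp add: divide_inverse_commute mult.assoc[symmetric])
  from has_integral_cmul[OF this, of m] m
  show "((\<lambda>t. m *\<^sub>R g (m * t + k)) has_integral q (m*b+k) - q (m*a+k)) {a..b}" by simp
qed

lemma has_L2_deriv_reflect:
  fixes q :: "real \<Rightarrow> 'a::euclidean_space"
  assumes q: "has_L2_deriv q g"
  shows "has_L2_deriv (\<lambda>t. q (- t)) (\<lambda>t. - g (- t))"
  unfolding has_L2_deriv_def loc_L2_def
proof (intro conjI allI impI)
  have L: "loc_L2 g" using q by (auto simp: has_L2_deriv_def)
  have mg: "g \<in> borel_measurable borel" using L by (auto simp: loc_L2_def)
  then show "(\<lambda>t. - g (- t)) \<in> borel_measurable lborel" by measurable
  fix a b :: real
  have "integrable lborel (\<lambda>t. indicator {-b..-a} t * (norm (g t))\<^sup>2)"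
    using L by (auto simp: loc_L2_def set_integrable_def)
  then have "integrable lborel (\<lambda>t. indicator {-b..-a} (0 + (-1) * t) * (norm (g (0 + (-1) * t)))\<^sup>2)"
    by (rule lborel_integrable_real_affine) simp
  also have "(\<lambda>t. indicator {-b..-a} (0 + (-1) * t) * (norm (g (0 + (-1) * t)))\<^sup>2) =
      (\<lambda>t. indicator {a..b} t *\<^sub>R (norm (- g (- t)))\<^sup>2)"
    by (auto simp: fun_eq_iff indicator_def)
  finally show "set_integrable lborel {a..b} (\<lambda>t. (norm (- g (- t)))\<^sup>2)"
    by (simp add: set_integrable_def)
  assume ab: "a \<le> b"
  have "(g has_integral q (-a) - q (-b)) {-b..-a}" using q ab by (auto simp: has_L2_deriv_def)
  then have "((\<lambda>t. g (-t)) has_integral q (-a) - q (-b)) {a..b}"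
    using has_integral_reflect_lemma_real[of g _ "-b" "-a"] by simp
  from has_integral_neg[OF this] show "((\<lambda>t. - g (- t)) has_integral q (- b) - q (- a)) {a..b}" by simp
qed

lemma has_L2_deriv_const: "has_L2_deriv (\<lambda>t. x) (\<lambda>t. 0)"
  by (auto simp: has_L2_deriv_def continuous_loc_L2)

lemma has_L2_deriv_linear: "has_L2_deriv (\<lambda>t. x + t *\<^sub>R d) (\<lambda>t. d)"
proof -
  have "((\<lambda>t. d) has_integral (b - a) *\<^sub>R d) {a..b}" if "a \<le> b" for a b :: real
    using has_integral_const_real[of d a b] that by simp
  then show ?thesis by (auto simp: has_L2_deriv_def continuous_loc_L2 algebra_simps)
qed

lemma action_join:
  fixes V :: "'a::euclidean_space \<Rightarrow> real"
  assumes f: "has_L2_deriv f f'" and h: "has_L2_deriv h h'" and fh: "f s = h s"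
    and V: "continuous_on UNIV V"
  shows "action V c (\<lambda>t. if t \<le> s then f t else h t) =
     action_on {..s} V c f f' + action_on {s<..} V c h h'"
proof -
  have [measurable]: "energy V c f f' \<in> borel_measurable borel" "energy V c h h' \<in> borel_measurable borel"
    using energy_measurable f h V by blast+
  have "action V c (\<lambda>t. if t \<le> s then f t else h t) =
    (\<integral>\<^sup>+t. ennreal (energy V c f f' t) * indicator {..s} t + ennreal (energy V c h h' t) * indicator {s<..} t \<partial>lborel)"
    unfolding action_eq[OF has_L2_deriv_join[OF f h fh]]
    by (intro nn_integral_cong) (auto simp: energy_def indicator_def)
  also have "\<dots> = action_on {..s} V c f f' + action_on {s<..} V c h h'"
    by (rule nn_integral_add) measurable
  finally show ?thesis .
qed

lemma action_split:
  fixes V :: "'a::euclidean_space \<Rightarrow> real"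
  assumes f: "has_L2_deriv f f'" and V: "continuous_on UNIV V"
  shows "action V c f =
     action_on {..s} V c f f' + action_on {s<..} V c f f'"
  using action_join[OF f f refl V, of c s] by simp

section \<open>Competitors\<close>

lemma Liminf_eq_zero_iff:
  assumes "\<And>t. 0 \<le> f t"
  shows "Liminf F (\<lambda>t. ereal (f t)) = 0 \<longleftrightarrow> (\<forall>e>0. \<exists>\<^sub>F t in F. f t < e)"
proof
  assume L: "Liminf F (\<lambda>t. ereal (f t)) = 0"
  show "\<forall>e>0. \<exists>\<^sub>F t in F. f t < e"
  proof (intro allI impI)
    fix e :: real assume "e > 0"
    show "\<exists>\<^sub>F t in F. f t < e"
    proof (rule ccontr)
      assume "\<not> (\<exists>\<^sub>F t in F. f t < e)"
      then have "eventually (\<lambda>t. ereal e \<le> ereal (f t)) F" by (simp add: not_frequently not_less)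
      then have "ereal e \<le> Liminf F (\<lambda>t. ereal (f t))" by (rule Liminf_bounded)
      then show False using L \<open>e > 0\<close> by simp
    qed
  qed
next
  assume R: "\<forall>e>0. \<exists>\<^sub>F t in F. f t < e"
  have "0 \<le> Liminf F (\<lambda>t. ereal (f t))" using assms by (intro Liminf_bounded) auto
  moreover have "\<not> 0 < Liminf F (\<lambda>t. ereal (f t))"
  proof
    assume "0 < Liminf F (\<lambda>t. ereal (f t))"
    then obtain e where e: "0 < ereal e" "ereal e < Liminf F (\<lambda>t. ereal (f t))"
      using ereal_dense2 by blast
    from less_LiminfD[OF e(2)] have "eventually (\<lambda>t. \<not> f t < e) F" by (simp add: eventually_mono)
    with R e(1) show False by (auto simp: frequently_def)
  qed
  ultimately show "Liminf F (\<lambda>t. ereal (f t)) = 0" by (simp add: antisym_conv1 not_less)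
qed

text \<open>The form in which membership is transferred to competitors: only visits near the wells
  at arbitrarily early and late times count, and these survive a change on a bounded interval, a
  dilation, or a new tail.\<close>

lemma Gamma_iff:
  "q \<in> Gamma V c Am Ap \<longleftrightarrow> q \<in> H1_loc \<and> (\<forall>t. c \<le> V (q t)) \<and>
     (\<forall>e>0. \<forall>T. \<exists>t\<le>T. infdist (q t) Am < e) \<and> (\<forall>e>0. \<forall>T. \<exists>t\<ge>T. infdist (q t) Ap < e)"
proof -
  have "(\<exists>\<^sub>F t in at_bot. P t) \<longleftrightarrow> (\<forall>T. \<exists>t\<le>T. P t)" "(\<exists>\<^sub>F t in at_top. P t) \<longleftrightarrow> (\<forall>T. \<exists>t\<ge>T. P t)"
    for P :: "real \<Rightarrow> bool"
    by (auto simp: frequently_def eventually_at_bot_linorder eventually_at_top_linorder)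
  then show ?thesis unfolding Gamma_def by (simp add: Liminf_eq_zero_iff infdist_nonneg)
qed

lemma first_hitting_time:
  fixes f :: "real \<Rightarrow> real"
  assumes c: "continuous_on {0..1} f" and "c \<le> f 0" "f 1 \<le> c"
  obtains \<theta> where "\<theta> \<in> {0..1}" "f \<theta> = c" "\<And>t. t \<in> {0..\<theta>} \<Longrightarrow> c \<le> f t"
proof -
  define S where "S = {t \<in> {0..1}. f t \<in> {..c}}"
  have S: "compact S" "S \<noteq> {}"
  proof -
    show "S \<noteq> {}" using assms by (auto simp: S_def)
    have "closed S" unfolding S_def using continuous_closed_preimage[OF c, of "{..c}"]
      by (simp add: vimage_def Int_def)
    moreover have "bounded S" by (rule bounded_subset[of "{0..1}"]) (auto simp: S_def)
    ultimately show "compact S" by (simp add: compact_eq_bounded_closed)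
  qed
  obtain \<theta> where th: "\<theta> \<in> S" "\<And>t. t \<in> S \<Longrightarrow> \<theta> \<le> t" using compact_attains_inf[OF S] by blast
  have lt: "c < f t" if "t \<in> {0..<\<theta>}" for t using th(1) th(2)[of t] that by (force simp: S_def)
  have "f \<theta> = c"
  proof (rule ccontr)
    assume "f \<theta> \<noteq> c"
    then have "f \<theta> < c" using th by (auto simp: S_def)
    have "continuous_on {0..\<theta>} f" using c th by (auto simp: S_def intro: continuous_on_subset)
    then obtain x where "0 \<le> x" "x \<le> \<theta>" "f x = c"
      using IVT2'[of f \<theta> c 0] \<open>f \<theta> < c\<close> assms th by (auto simp: S_def)
    then show False using lt[of x] \<open>f \<theta> < c\<close> by (cases "x = \<theta>") auto
  qed
  show ?thesis
  proof (rule that[of \<theta>])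
    show "c \<le> f t" if "t \<in> {0..\<theta>}" for t using lt[of t] \<open>f \<theta> = c\<close> that by (cases "t = \<theta>") auto
  qed (use th \<open>f \<theta> = c\<close> in \<open>auto simp: S_def\<close>)
qed

text \<open>The path follows the segment towards \<open>a\<close> until \<open>V\<close> first takes
  the value \<open>c\<close>, in time 1 whatever the distance, and then rests. Stopping at the first
  hit respects the constraint, and resting at level \<open>c\<close> costs nothing; so the action
  comes from \<open>[0, 1]\<close>, where the speed is at most \<open>dist x a\<close>. The
  hypothesis on \<open>K\<close> places the stopping point in the intended component.\<close>

lemma ray_to_well:
  fixes V :: "'a::euclidean_space \<Rightarrow> real"
  assumes V: "continuous_on UNIV V" and "0 \<le> c" "V a \<le> c" "c \<le> V x"
    and K: "\<And>z. z \<in> closed_segment x a \<Longrightarrow> V z \<le> c \<Longrightarrow> z \<in> K"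
    and B: "\<And>z. z \<in> closed_segment x a \<Longrightarrow> V z \<le> B"
  obtains l l' where "has_L2_deriv l l'" "l 0 = x" "\<And>t. 0 \<le> t \<Longrightarrow> c \<le> V (l t)" "\<And>t. 1 \<le> t \<Longrightarrow> l t \<in> K"
    "action_on {0..} V c l l' \<le> ennreal ((dist x a)\<^sup>2 / 2 + B)"
proof -
  define \<gamma> where "\<gamma> = (\<lambda>t. x + t *\<^sub>R (a - x))"
  have c\<gamma>: "continuous_on {0..1} (\<lambda>t. V (\<gamma> t))"
    unfolding \<gamma>_def by (intro continuous_on_compose2[OF V] continuous_intros) auto
  have "c \<le> V (\<gamma> 0)" "V (\<gamma> 1) \<le> c" using assms by (auto simp: \<gamma>_def)
  then obtain \<theta> where th: "\<theta> \<in> {0..1}" "V (\<gamma> \<theta>) = c" "\<And>t. t \<in> {0..\<theta>} \<Longrightarrow> c \<le> V (\<gamma> t)"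
    using first_hitting_time[OF c\<gamma>] by blast
  have seg: "\<gamma> t \<in> closed_segment x a" if "t \<in> {0..1}" for t
    unfolding closed_segment_def \<gamma>_def using that by (auto intro!: exI[of _ t] simp: algebra_simps)
  define y where "y = \<gamma> \<theta>"
  define l l' where "l = (\<lambda>t. if t \<le> 1 then x + t *\<^sub>R (y - x) else y)"
    and "l' = (\<lambda>t::real. if t \<le> 1 then y - x else 0)"
  have yK: "y \<in> K" using K[OF seg[OF th(1)]] th(2) by (simp add: y_def)
  have L: "has_L2_deriv l l'"
    unfolding l_def l'_def by (rule has_L2_deriv_join[OF has_L2_deriv_linear has_L2_deriv_const]) simp
  have lg: "l t = \<gamma> (t * \<theta>)" "t * \<theta> \<in> {0..\<theta>}" "t * \<theta> \<in> {0..1}" if "t \<in> {0..1}" for t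
  proof -
    show "l t = \<gamma> (t * \<theta>)" using that by (simp add: l_def y_def \<gamma>_def)
    show "t * \<theta> \<in> {0..\<theta>}" using that th(1) by (auto simp: mult_left_le_one_le)
    then show "t * \<theta> \<in> {0..1}" using th(1) by auto
  qed
  have dy: "norm (y - x) \<le> dist x a"
    using th(1) by (auto simp: y_def \<gamma>_def dist_norm norm_minus_commute mult_left_le_one_le)
  define M where "M = (dist x a)\<^sup>2 / 2 + B"
  have le: "energy V c l l' t \<le> M" if "t \<in> {0..1}" for t
  proof -
    have "(norm (l' t))\<^sup>2 \<le> (dist x a)\<^sup>2" using that dy by (auto simp: l'_def intro: power_mono)
    moreover have "V (l t) \<le> B" using lg[OF that] B seg by simp
    ultimately show ?thesis using \<open>0 \<le> c\<close> unfolding energy_def M_def by linarith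
  qed
  have z: "energy V c l l' t = 0" if "t > 1" for t
    using that th(2) by (simp add: energy_def l_def l'_def y_def)
  have "action_on {0..} V c l l' \<le> (\<integral>\<^sup>+t\<in>{0..1::real}. ennreal M \<partial>lborel)"
  proof (rule nn_integral_mono)
    fix t :: real
    show "ennreal (energy V c l l' t) * indicator {0..} t \<le> ennreal M * indicator {0..1} t"
      using le[of t] z[of t] by (cases "t > 1") (auto simp: indicator_def intro: ennreal_leI)
  qed
  also have "\<dots> = ennreal M" by (simp add: nn_integral_cmult_indicator)
  finally have cost: "action_on {0..} V c l l' \<le> ennreal M" .
  show ?thesis
  proof (rule that[OF L])
    show "c \<le> V (l t)" if "0 \<le> t" for t
    proof (cases "t \<le> 1")
      case True
      then show ?thesis using lg[of t] th(3) that by auto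
    next
      case False
      then show ?thesis using th(2) by (simp add: l_def y_def)
    qed
    show "l t \<in> K" if "1 \<le> t" for t using yK that by (cases "t = 1") (auto simp: l_def)
  qed (use cost in \<open>auto simp: l_def M_def\<close>)
qed

lemma nn_integral_half_line_affine:
  fixes f :: "real \<Rightarrow> real"
  assumes [measurable]: "f \<in> borel_measurable borel"
  shows "m > 0 \<Longrightarrow> (\<integral>\<^sup>+t\<in>{s<..}. ennreal (f t) \<partial>lborel) =
      ennreal m * (\<integral>\<^sup>+t\<in>{s'<..}. ennreal (f (m * (t - s') + s)) \<partial>lborel)"
    and "(\<integral>\<^sup>+t\<in>{..s}. ennreal (f (s - t)) \<partial>lborel) = (\<integral>\<^sup>+t\<in>{0..}. ennreal (f t) \<partial>lborel)"
proof -
  assume m: "m > 0"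
  have "(\<integral>\<^sup>+t\<in>{s<..}. ennreal (f t) \<partial>lborel) =
    ennreal \<bar>m\<bar> * (\<integral>\<^sup>+t. ennreal (f ((s - m * s') + m * t)) * indicator {s<..} ((s - m * s') + m * t) \<partial>lborel)"
    using m by (intro nn_integral_real_affine) auto
  also have "(\<lambda>t. ennreal (f ((s - m * s') + m * t)) * indicator {s<..} ((s - m * s') + m * t)) =
    (\<lambda>t. ennreal (f (m * (t - s') + s)) * indicator {s'<..} t)"
    using m by (auto simp: fun_eq_iff indicator_def algebra_simps)
  finally show "(\<integral>\<^sup>+t\<in>{s<..}. ennreal (f t) \<partial>lborel) =
      ennreal m * (\<integral>\<^sup>+t\<in>{s'<..}. ennreal (f (m * (t - s') + s)) \<partial>lborel)" using m by simp
next
  have "(\<integral>\<^sup>+t\<in>{0..}. ennreal (f t) \<partial>lborel) =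
    ennreal \<bar>-1\<bar> * (\<integral>\<^sup>+t. ennreal (f (s + (-1) * t)) * indicator {0..} (s + (-1) * t) \<partial>lborel)"
    by (intro nn_integral_real_affine) auto
  also have "(\<lambda>t. ennreal (f (s + (-1) * t)) * indicator {0..} (s + (-1) * t)) =
    (\<lambda>t. ennreal (f (s - t)) * indicator {..s} t)"
    by (auto simp: fun_eq_iff indicator_def)
  finally show "(\<integral>\<^sup>+t\<in>{..s}. ennreal (f (s - t)) \<partial>lborel) = (\<integral>\<^sup>+t\<in>{0..}. ennreal (f t) \<partial>lborel)" by simp
qed

text \<open>The factors 1 match the shape that \<open>has_L2_deriv_affine\<close> produces for a
  translation.\<close>

lemma energy_shift:
  "energy V c (\<lambda>t. q (1 * t + k)) (\<lambda>t. 1 *\<^sub>R g (1 * t + k)) t = energy V c q g (t + k)"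
  by (simp add: energy_def)

text \<open>Of \<open>minimizers\<close> only the comparison with all other paths is kept, together
  with an explicit derivative. The radius in \<open>minimizers\<close> may vary with the level, so a
  bound uniform in the level has to be derived from this comparison.\<close>

definition minimal :: "('a::euclidean_space \<Rightarrow> real) \<Rightarrow> real \<Rightarrow> 'a set \<Rightarrow> 'a set \<Rightarrow> (real \<Rightarrow> 'a) \<Rightarrow> (real \<Rightarrow> 'a) \<Rightarrow> bool" where
  "minimal V c Am Ap q g \<longleftrightarrow> has_L2_deriv q g \<and> q \<in> Gamma V c Am Ap \<and>
     (\<forall>p\<in>Gamma V c Am Ap. action V c q \<le> action V c p)"

lemma minimizers_minimal:
  assumes "q \<in> minimizers V c Am Ap R"
  shows "minimal V c Am Ap q (weak_deriv q)"
  using assms H1_loc_weak_deriv[of q]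
  by (auto simp: minimizers_def minimal_def min_action_def Gamma_def intro: INF_lower2)

lemma join_right_competitor:
  fixes V :: "'a::euclidean_space \<Rightarrow> real"
  assumes V: "continuous_on UNIV V" and q: "has_L2_deriv q g" "q \<in> Gamma V c Am Ap"
    and l: "has_L2_deriv l l'" "l 0 = q s" "\<And>t. 0 \<le> t \<Longrightarrow> c \<le> V (l t)" "\<And>t. 1 \<le> t \<Longrightarrow> l t \<in> Ap"
  shows "(\<lambda>t. if t \<le> s then q t else l (1 * t + (- s))) \<in> Gamma V c Am Ap"
    and "action V c (\<lambda>t. if t \<le> s then q t else l (1 * t + (- s))) \<le>
      action_on {..s} V c q g + action_on {0..} V c l l'"
proof -
  have l2: "has_L2_deriv (\<lambda>t. l (1 * t + (- s))) (\<lambda>t. 1 *\<^sub>R l' (1 * t + (- s)))"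
    by (intro has_L2_deriv_affine l) simp
  have G: "\<exists>t\<le>T. infdist (q t) Am < e" if "e > 0" for e T using q(2) that by (simp add: Gamma_iff)
  show "(\<lambda>t. if t \<le> s then q t else l (1 * t + (- s))) \<in> Gamma V c Am Ap"
    unfolding Gamma_iff
  proof (intro conjI allI impI)
    show "(\<lambda>t. if t \<le> s then q t else l (1 * t + (- s))) \<in> H1_loc"
      by (rule has_L2_deriv_H1_loc[OF has_L2_deriv_join[OF q(1) l2]]) (simp add: l)
    fix t show "c \<le> V (if t \<le> s then q t else l (1 * t + (- s)))"
      using q(2) l(3)[of "t - s"] by (auto simp: Gamma_iff)
  next
    fix e T :: real assume "e > 0"
    from G[OF this, of "min s T"] obtain t where "t \<le> min s T" "infdist (q t) Am < e" by blast
    then show "\<exists>t\<le>T. infdist (if t \<le> s then q t else l (1 * t + (- s))) Am < e"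
      by (intro exI[of _ t]) auto
    have "l (1 * max T (s+1) + (-s)) \<in> Ap" by (intro l(4)) simp
    then show "\<exists>t\<ge>T. infdist (if t \<le> s then q t else l (1 * t + (- s))) Ap < e"
      using \<open>e > 0\<close> by (intro exI[of _ "max T (s + 1)"]) auto
  qed
  have [measurable]: "energy V c l l' \<in> borel_measurable borel" by (rule energy_measurable[OF l(1) V])
  have "action_on {s<..} V c (\<lambda>t. l (1 * t + (- s))) (\<lambda>t. 1 *\<^sub>R l' (1 * t + (- s)))
     = action_on {0<..} V c l l'"
    using nn_integral_half_line_affine(1)[of "energy V c l l'" 1 0 s] by (simp only: energy_shift) simp
  also have "\<dots> \<le> action_on {0..} V c l l'"
    by (intro nn_integral_mono) (auto simp: indicator_def)
  finally show "action V c (\<lambda>t. if t \<le> s then q t else l (1 * t + (- s))) \<le>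
      action_on {..s} V c q g + action_on {0..} V c l l'"
    by (subst action_join[OF q(1) l2 _ V]) (auto simp: l intro: add_left_mono)
qed

text \<open>The conditions on \<open>q\<close> concern its late times and not membership in
  \<open>Gamma\<close>. Hence \<open>q\<close> may itself be a ray into the other well, and two rays
  from a common point form a competitor.\<close>

lemma join_left_competitor:
  fixes V :: "'a::euclidean_space \<Rightarrow> real"
  assumes V: "continuous_on UNIV V" and q: "has_L2_deriv q g" "\<And>t. s \<le> t \<Longrightarrow> c \<le> V (q t)"
    "\<And>e T. e > 0 \<Longrightarrow> \<exists>t\<ge>T. infdist (q t) Ap < e"
    and l: "has_L2_deriv l l'" "l 0 = q s" "\<And>t. 0 \<le> t \<Longrightarrow> c \<le> V (l t)" "\<And>t. 1 \<le> t \<Longrightarrow> l t \<in> Am"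
  shows "(\<lambda>t. if t \<le> s then l (s - t) else q t) \<in> Gamma V c Am Ap"
    and "action V c (\<lambda>t. if t \<le> s then l (s - t) else q t) =
      action_on {0..} V c l l' + action_on {s<..} V c q g"
proof -
  have l2: "has_L2_deriv (\<lambda>t. l (s - t)) (\<lambda>t. - l' (s - t))"
    using has_L2_deriv_affine[OF has_L2_deriv_reflect[OF l(1)], of 1 "-s"] by simp
  show "(\<lambda>t. if t \<le> s then l (s - t) else q t) \<in> Gamma V c Am Ap"
    unfolding Gamma_iff
  proof (intro conjI allI impI)
    show "(\<lambda>t. if t \<le> s then l (s - t) else q t) \<in> H1_loc"
      by (rule has_L2_deriv_H1_loc[OF has_L2_deriv_join[OF l2 q(1)]]) (simp add: l)
    fix t show "c \<le> V (if t \<le> s then l (s - t) else q t)"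
      using q(2) l(3)[of "s - t"] by auto
  next
    fix e T :: real assume "e > 0"
    from q(3)[OF this, of "max (s + 1) T"] obtain t where "t \<ge> max (s + 1) T" "infdist (q t) Ap < e" by blast
    then show "\<exists>t\<ge>T. infdist (if t \<le> s then l (s - t) else q t) Ap < e"
      by (intro exI[of _ t]) auto
    have "l (s - min T (s-1)) \<in> Am" by (intro l(4)) simp
    then show "\<exists>t\<le>T. infdist (if t \<le> s then l (s - t) else q t) Am < e"
      using \<open>e > 0\<close> by (intro exI[of _ "min T (s - 1)"]) auto
  qed
  have [measurable]: "energy V c l l' \<in> borel_measurable borel" by (rule energy_measurable[OF l(1) V])
  have e: "energy V c (\<lambda>t. l (s - t)) (\<lambda>t. - l' (s - t)) t = energy V c l l' (s - t)" for t
    by (simp add: energy_def)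
  show "action V c (\<lambda>t. if t \<le> s then l (s - t) else q t) =
      action_on {0..} V c l l' + action_on {s<..} V c q g"
    by (subst action_join[OF l2 q(1) _ V]) (auto simp: l e nn_integral_half_line_affine(2))
qed

text \<open>The minimizer and the competitor share their past up to \<open>s\<close>, whose action
  cancels because it is finite.\<close>

lemma minimal_right_tail:
  fixes V :: "'a::euclidean_space \<Rightarrow> real"
  assumes V: "continuous_on UNIV V" and q: "minimal V c Am Ap q g" and fin: "action V c q < \<infinity>"
    and l: "has_L2_deriv l l'" "l 0 = q s" "\<And>t. 0 \<le> t \<Longrightarrow> c \<le> V (l t)" "\<And>t. 1 \<le> t \<Longrightarrow> l t \<in> Ap"
  shows "action_on {s<..} V c q g \<le> action_on {0..} V c l l'"
proof -
  have q': "has_L2_deriv q g" "q \<in> Gamma V c Am Ap" using q by (auto simp: minimal_def)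
  have sp: "action V c q = action_on {..s} V c q g + action_on {s<..} V c q g"
    by (rule action_split[OF q'(1) V])
  have "action V c q \<le> action V c (\<lambda>t. if t \<le> s then q t else l (1 * t + (- s)))"
    using join_right_competitor(1)[OF V q' l] q by (simp add: minimal_def)
  also have "\<dots> \<le> action_on {..s} V c q g + action_on {0..} V c l l'"
    by (rule join_right_competitor(2)[OF V q' l])
  finally show ?thesis using fin unfolding sp
    by (subst (asm) ennreal_add_left_cancel_le) (auto simp: top_unique less_top)
qed

lemma minimal_left_tail:
  fixes V :: "'a::euclidean_space \<Rightarrow> real"
  assumes V: "continuous_on UNIV V" and q: "minimal V c Am Ap q g" and fin: "action V c q < \<infinity>"
    and l: "has_L2_deriv l l'" "l 0 = q s" "\<And>t. 0 \<le> t \<Longrightarrow> c \<le> V (l t)" "\<And>t. 1 \<le> t \<Longrightarrow> l t \<in> Am"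
  shows "action_on {..s} V c q g \<le> action_on {0..} V c l l'"
proof -
  have q': "has_L2_deriv q g" "\<And>t. s \<le> t \<Longrightarrow> c \<le> V (q t)" "\<And>e T. e > 0 \<Longrightarrow> \<exists>t\<ge>T. infdist (q t) Ap < e"
    using q by (auto simp: minimal_def Gamma_iff)
  have sp: "action V c q = action_on {s<..} V c q g + action_on {..s} V c q g"
    by (simp add: action_split[OF q'(1) V, of c s] add.commute)
  have "action V c q \<le> action V c (\<lambda>t. if t \<le> s then l (s - t) else q t)"
    using join_left_competitor(1)[OF V q' l] q by (simp add: minimal_def)
  also have "\<dots> = action_on {s<..} V c q g + action_on {0..} V c l l'"
    using join_left_competitor(2)[OF V q' l] by (simp add: add.commute)
  finally show ?thesis using fin unfolding sp
    by (subst (asm) ennreal_add_left_cancel_le) (auto simp: top_unique less_top)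
qed

section \<open>Minimizers\<close>

lemma nn_integral_Icc:
  fixes f :: "real \<Rightarrow> real"
  assumes "set_integrable lborel {a..b} f" "\<And>t. t \<in> {a..b} \<Longrightarrow> 0 \<le> f t"
  shows "(\<integral>\<^sup>+t\<in>{a..b}. ennreal (f t) \<partial>lborel) = ennreal (integral {a..b} f)"
proof -
  have eq: "(\<lambda>t. ennreal (f t) * indicator {a..b} t) = (\<lambda>t. ennreal (indicator {a..b} t *\<^sub>R f t))"
    by (auto simp: indicator_def fun_eq_iff)
  have "(\<integral>\<^sup>+t. ennreal (indicator {a..b} t *\<^sub>R f t) \<partial>lborel) = ennreal (LINT t:{a..b}|lborel. f t)"
    unfolding set_lebesgue_integral_def
    using assms by (intro nn_integral_eq_integral) (auto simp: set_integrable_def indicator_def intro!: AE_I2)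
  then show ?thesis unfolding eq using set_borel_integral_eq_integral(2)[OF assms(1)] by simp
qed

lemma potential_integrable:
  fixes V :: "'a::euclidean_space \<Rightarrow> real"
  assumes "has_L2_deriv q g" "continuous_on UNIV V"
  shows "set_integrable lborel {a..b} (\<lambda>t. V (q t) - c)"
proof -
  have "continuous_on {a..b} (\<lambda>t. V (q t) - c)"
    by (intro continuous_intros continuous_on_compose2[OF assms(2)] has_L2_deriv_continuous[OF assms(1)]) auto
  then show ?thesis by (rule borel_integrable_atLeastAtMost')
qed

lemma kinetic_integrable:
  assumes "has_L2_deriv q g"
  shows "set_integrable lborel {a..b} (\<lambda>t. (norm (g t))\<^sup>2 / 2)"
  using assms by (intro set_integrable_divide) (auto simp: has_L2_deriv_def loc_L2_def)

lemma energy_integrable: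
  fixes V :: "'a::euclidean_space \<Rightarrow> real"
  assumes "has_L2_deriv q g" "continuous_on UNIV V"
  shows "set_integrable lborel {a..b} (energy V c q g)"
  unfolding energy_def[abs_def]
  using kinetic_integrable[OF assms(1)] potential_integrable[OF assms] by (rule set_integral_add(1))

text \<open>With \<open>insert a A\<close> an open half-line starting at \<open>a\<close> still
  covers the closed interval, as one point carries no integral.\<close>

lemma integral_le_half_line:
  fixes f :: "real \<Rightarrow> real"
  assumes "set_integrable lborel {a..b} f" "\<And>t. t \<in> {a..b} \<Longrightarrow> 0 \<le> f t"
    and "(\<integral>\<^sup>+t\<in>A. ennreal (f t) \<partial>lborel) \<le> ennreal C" "{a..b} \<subseteq> insert a A" "0 \<le> C"
  shows "integral {a..b} f \<le> C"
proof -
  have "(\<integral>\<^sup>+t\<in>{a..b}. ennreal (f t) \<partial>lborel) \<le> (\<integral>\<^sup>+t\<in>A. ennreal (f t) \<partial>lborel)"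
  proof (rule nn_integral_mono_AE)
    show "AE t in lborel. ennreal (f t) * indicator {a..b} t \<le> ennreal (f t) * indicator A t"
      using AE_lborel_singleton[of a]
    proof eventually_elim
      case (elim t)
      then show ?case using assms(4) by (auto simp: indicator_def)
    qed
  qed
  then have "ennreal (integral {a..b} f) \<le> ennreal C"
    using nn_integral_Icc[OF assms(1,2)] assms(3) by simp
  then show ?thesis using assms(5) by (simp add: ennreal_le_iff)
qed

lemma half_line_split:
  fixes f :: "real \<Rightarrow> real"
  assumes [measurable]: "f \<in> borel_measurable borel" and "set_integrable lborel {s..t} f" "\<And>r. 0 \<le> f r" "s \<le> t"
  shows "(\<integral>\<^sup>+r\<in>{s<..}. ennreal (f r) \<partial>lborel) = ennreal (integral {s..t} f) + (\<integral>\<^sup>+r\<in>{t<..}. ennreal (f r) \<partial>lborel)"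
proof -
  have "(\<integral>\<^sup>+r\<in>{s<..}. ennreal (f r) \<partial>lborel) =
    (\<integral>\<^sup>+r. ennreal (f r) * indicator {s..t} r + ennreal (f r) * indicator {t<..} r \<partial>lborel)"
  proof (rule nn_integral_cong_AE)
    show "AE r in lborel. ennreal (f r) * indicator {s<..} r =
        ennreal (f r) * indicator {s..t} r + ennreal (f r) * indicator {t<..} r"
      using AE_lborel_singleton[of s]
    proof eventually_elim
      case (elim r)
      then show ?case using assms(4) by (auto simp: indicator_def)
    qed
  qed
  also have "\<dots> = (\<integral>\<^sup>+r\<in>{s..t}. ennreal (f r) \<partial>lborel) + (\<integral>\<^sup>+r\<in>{t<..}. ennreal (f r) \<partial>lborel)"
    by (rule nn_integral_add) measurable
  finally show ?thesis using nn_integral_Icc[OF assms(2)] assms(3) by simp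
qed

text \<open>Slowing down or speeding up the path on \<open>[s, \<infinity>)\<close> by a factor does not decrease the action.\<close>
lemma half_line_equipartition:
  fixes V :: "'a::euclidean_space \<Rightarrow> real"
  assumes V: "continuous_on UNIV V" and q: "minimal V c Am Ap q g" and fin: "action V c q < \<infinity>"
  shows "(\<integral>\<^sup>+t\<in>{s<..}. ennreal ((norm (g t))\<^sup>2 / 2) \<partial>lborel) = (\<integral>\<^sup>+t\<in>{s<..}. ennreal (V (q t) - c) \<partial>lborel)"
    and "(\<integral>\<^sup>+t\<in>{s<..}. ennreal ((norm (g t))\<^sup>2 / 2) \<partial>lborel) < \<infinity>"
proof -
  have qd: "has_L2_deriv q g" and qG: "q \<in> Gamma V c Am Ap" using q by (auto simp: minimal_def)
  have [measurable]: "g \<in> borel_measurable borel" using qd by (simp add: has_L2_deriv_def loc_L2_def)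
  have [measurable]: "q \<in> borel_measurable borel" "V \<in> borel_measurable borel"
    using has_L2_deriv_continuous[OF qd] V borel_measurable_continuous_onI by blast+
  have Vc: "0 \<le> V (q t) - c" for t using qG by (simp add: Gamma_iff)
  define K where "K = (\<integral>\<^sup>+t\<in>{s<..}. ennreal ((norm (g t))\<^sup>2 / 2) \<partial>lborel)"
  define U where "U = (\<integral>\<^sup>+t\<in>{s<..}. ennreal (V (q t) - c) \<partial>lborel)"
  have gen: "(\<integral>\<^sup>+t\<in>{s<..}. ennreal (m\<^sup>2 * ((norm (g t))\<^sup>2 / 2) + (V (q t) - c)) \<partial>lborel) = ennreal (m\<^sup>2) * K + U" for m :: real
  proof -
    have "(\<integral>\<^sup>+t\<in>{s<..}. ennreal (m\<^sup>2 * ((norm (g t))\<^sup>2 / 2) + (V (q t) - c)) \<partial>lborel) =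
      (\<integral>\<^sup>+t. ennreal (m\<^sup>2) * (ennreal ((norm (g t))\<^sup>2 / 2) * indicator {s<..} t) + ennreal (V (q t) - c) * indicator {s<..} t \<partial>lborel)"
      using Vc by (intro nn_integral_cong) (auto simp: indicator_def ennreal_plus[symmetric] ennreal_mult[symmetric] simp del: ennreal_plus)
    also have "\<dots> = ennreal (m\<^sup>2) * K + U"
      unfolding K_def U_def by (subst nn_integral_add) (auto simp: nn_integral_cmult)
    finally show ?thesis .
  qed
  have right: "action_on {s<..} V c q g = K + U"
    using gen[of 1] by (simp add: energy_def)
  define L where "L = action_on {..s} V c q g"
  have act: "action V c q = L + (K + U)"
    using action_split[OF qd V, of c s] right by (simp add: L_def)
  have finite: "L < \<infinity>" "K < \<infinity>" "U < \<infinity>" using fin by (auto simp: act)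
  then obtain k u where ku: "K = ennreal k" "U = ennreal u" "k \<ge> 0" "u \<ge> 0"
    by (metis ennreal_cases less_irrefl infinity_ennreal_def)
  \<comment> \<open>Running the tail at speed \<open>m\<close> has action
    \<open>m * k + u / m\<close>, which minimality bounds below by \<open>k + u\<close>; the
    inequality is multiplied by \<open>m\<close>.\<close>
  have main: "m * (k + u) \<le> m\<^sup>2 * k + u" if m: "m > 0" for m :: real
  proof -
    let ?q = "\<lambda>t. q (m * t + (s - m * s))" and ?g = "\<lambda>t. m *\<^sub>R g (m * t + (s - m * s))"
    define p where "p = (\<lambda>t. if t \<le> s then q t else q (m * t + (s - m * s)))"
    have q2: "has_L2_deriv ?q ?g"
      by (rule has_L2_deriv_affine[OF qd m])
    have pG: "p \<in> Gamma V c Am Ap"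
      unfolding Gamma_iff
    proof (intro conjI allI impI)
      show "p \<in> H1_loc" unfolding p_def
        by (rule has_L2_deriv_H1_loc[OF has_L2_deriv_join[OF qd q2]]) simp
      show "c \<le> V (p t)" for t using Vc by (auto simp: p_def)
    next
      fix e T :: real assume e: "e > 0"
      have "\<exists>t\<le>min s T. infdist (q t) Am < e" using qG e unfolding Gamma_iff by blast
      then show "\<exists>t\<le>T. infdist (p t) Am < e" by (auto simp: p_def)
      \<comment> \<open>A late visit of \<open>q\<close> is pulled back through the dilation; the
        bound makes the pulled-back time lie beyond both \<open>T\<close> and the joint
        \<open>s\<close>.\<close>
      have "\<exists>t\<ge>m * max T (s+1) + (s - m * s). infdist (q t) Ap < e" using qG e unfolding Gamma_iff by blast
      then obtain t where t: "t \<ge> m * max T (s+1) + (s - m * s)" "infdist (q t) Ap < e" by blast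
      define r where "r = (t - (s - m * s)) / m"
      have tr: "t = m * r + (s - m * s)" using m by (simp add: r_def)
      have "m * max T (s+1) \<le> m * r" using t(1) by (simp add: tr)
      then have "max T (s+1) \<le> r" using m by simp
      then show "\<exists>t\<ge>T. infdist (p t) Ap < e" using t(2) by (intro exI[of _ r]) (auto simp: p_def tr)
    qed
    define F where "F = (\<lambda>t. m\<^sup>2 * ((norm (g t))\<^sup>2 / 2) + (V (q t) - c))"
    have [measurable]: "F \<in> borel_measurable borel" unfolding F_def by measurable
    have "ennreal m * action_on {s<..} V c ?q ?g
      = ennreal m * (\<integral>\<^sup>+t\<in>{s<..}. ennreal (F (m * (t - s) + s)) \<partial>lborel)"
      by (simp add: energy_def F_def power_mult_distrib algebra_simps)
    also have "\<dots> = ennreal (m\<^sup>2) * K + U"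
      using nn_integral_half_line_affine(1)[of F m s s] m gen[of m] by (simp add: F_def)
    finally have e: "ennreal m * action_on {s<..} V c ?q ?g
      = ennreal (m\<^sup>2) * K + U" .
    have "L + (K + U) \<le> L + action_on {s<..} V c ?q ?g"
    proof -
      have "action V c q \<le> action V c p" using q pG by (simp add: minimal_def)
      then show ?thesis using action_join[OF qd q2 _ V, of s c] unfolding act p_def L_def by simp
    qed
    then have "K + U \<le> action_on {s<..} V c ?q ?g"
      unfolding ennreal_add_left_cancel_le using finite(1) by (elim disjE) simp_all
    then have "ennreal m * (K + U) \<le> ennreal (m\<^sup>2) * K + U"
      unfolding e[symmetric] by (rule mult_left_mono) simp
    then show ?thesis using m ku by (simp add: ennreal_mult[symmetric] ennreal_plus[symmetric] del: ennreal_plus)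
  qed
  \<comment> \<open>The inequality \<open>main\<close> reads
    \<open>0 \<le> (1 - m) * (u - m * k)\<close>. Letting \<open>m\<close> tend to 1 from below
    gives \<open>k \<le> u\<close>, and from above, with \<open>m = 1 / z\<close>, the
    converse.\<close>
  have "k \<le> u"
  proof (rule field_le_mult_one_interval)
    fix z :: real assume z: "0 < z" "z < 1"
    have "(1 - z) * (u - z * k) \<ge> 0" using main[OF z(1)] by (simp add: algebra_simps power2_eq_square)
    then show "z * k \<le> u" using z by (simp add: zero_le_mult_iff)
  qed
  moreover have "u \<le> k"
  proof (rule field_le_mult_one_interval)
    fix z :: real assume z: "0 < z" "z < 1"
    define w where "w = 1 / z"
    have w: "w > 1" "z * w = 1" using z by (auto simp: w_def)
    have "(w - 1) * (w * k - u) \<ge> 0" using main[of w] w(1) by (simp add: algebra_simps power2_eq_square)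
    then have "u \<le> w * k" using w(1) by (simp add: zero_le_mult_iff)
    then have "z * u \<le> z * (w * k)" using z by (intro mult_left_mono) auto
    then show "z * u \<le> k" using w(2) by (simp add: mult.assoc[symmetric])
  qed
  ultimately show "K = U" using ku by simp
  show "K < \<infinity>" by (rule finite)
qed

text \<open>The half-line identities at \<open>s\<close> and at \<open>t\<close> are subtracted,
  which their finiteness allows. Holding on every interval, the result will yield the pointwise
  energy identity once the velocity is continuous.\<close>

lemma minimal_equipartition:
  fixes V :: "'a::euclidean_space \<Rightarrow> real"
  assumes V: "continuous_on UNIV V" and q: "minimal V c Am Ap q g" and fin: "action V c q < \<infinity>" and st: "s \<le> t"
  shows "integral {s..t} (\<lambda>r. (norm (g r))\<^sup>2 / 2) = integral {s..t} (\<lambda>r. V (q r) - c)"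
proof -
  have qd: "has_L2_deriv q g" and qG: "q \<in> Gamma V c Am Ap" using q by (auto simp: minimal_def)
  have [measurable]: "g \<in> borel_measurable borel" using qd by (simp add: has_L2_deriv_def loc_L2_def)
  have [measurable]: "q \<in> borel_measurable borel" "V \<in> borel_measurable borel"
    using has_L2_deriv_continuous[OF qd] V borel_measurable_continuous_onI by blast+
  have Vc: "0 \<le> V (q t) - c" for t using qG by (simp add: Gamma_iff)
  note eq = half_line_equipartition[OF V q fin]
  have "ennreal (integral {s..t} (\<lambda>r. (norm (g r))\<^sup>2 / 2)) + (\<integral>\<^sup>+r\<in>{t<..}. ennreal ((norm (g r))\<^sup>2 / 2) \<partial>lborel)
    = (\<integral>\<^sup>+r\<in>{s<..}. ennreal ((norm (g r))\<^sup>2 / 2) \<partial>lborel)"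
    by (rule half_line_split[symmetric, OF _ kinetic_integrable[OF qd] _ st]) auto
  also have "\<dots> = (\<integral>\<^sup>+r\<in>{s<..}. ennreal (V (q r) - c) \<partial>lborel)" by (rule eq)
  also have "\<dots> = ennreal (integral {s..t} (\<lambda>r. V (q r) - c)) + (\<integral>\<^sup>+r\<in>{t<..}. ennreal (V (q r) - c) \<partial>lborel)"
    by (rule half_line_split[OF _ potential_integrable[OF qd V] Vc st]) measurable
  finally have "ennreal (integral {s..t} (\<lambda>r. (norm (g r))\<^sup>2 / 2)) = ennreal (integral {s..t} (\<lambda>r. V (q r) - c))"
    using eq[of t] unfolding add.commute[of "ennreal _"] eq(1)[of t] ennreal_add_left_cancel
    by (elim disjE) simp_all
  moreover have "0 \<le> integral {s..t} (\<lambda>r. (norm (g r))\<^sup>2 / 2)" "0 \<le> integral {s..t} (\<lambda>r. V (q r) - c)"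
    using Vc set_borel_integral_eq_integral(1)[OF kinetic_integrable[OF qd, of s t]]
      set_borel_integral_eq_integral(1)[OF potential_integrable[OF qd V, of s t c]]
    by (auto intro!: Henstock_Kurzweil_Integration.integral_nonneg)
  ultimately show ?thesis by simp
qed

section \<open>First variation and the Euler-Lagrange equation\<close>

lemma locally_lipschitz_cball:
  fixes f :: "'a::euclidean_space \<Rightarrow> 'b::metric_space"
  assumes "locally_lipschitz f"
  obtains L where "L-lipschitz_on (cball 0 R) f"
proof -
  have "local_lipschitz {0::real} (cball 0 R) (\<lambda>_. f)"
  proof (rule local_lipschitzI)
    fix t :: real and x assume "x \<in> cball (0::'a) R"
    obtain e L where "e > 0" "L-lipschitz_on (ball x e) f"
      using assms unfolding locally_lipschitz_def by blast
    then have "L-lipschitz_on (cball x (e/2) \<inter> cball 0 R) f"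
      by (elim lipschitz_on_subset) auto
    then show "\<exists>u>0. \<exists>L. \<forall>t\<in>cball t u \<inter> {0}. L-lipschitz_on (cball x u \<inter> cball 0 R) f"
      using \<open>e > 0\<close> by (intro exI[of _ "e/2"]) auto
  qed
  from local_lipschitz_compact_implies_lipschitz[OF this] show ?thesis
    using that by auto
qed

text \<open>The mean value theorem along the segment gives the constant \<open>L\<close> in place of
  the sharp \<open>L / 2\<close>; what matters for the first variation is that the error is
  quadratic in \<open>h\<close>.\<close>

lemma lipschitz_gradient_upper_bound:
  fixes V :: "'a::euclidean_space \<Rightarrow> real"
  assumes grad: "\<And>x. GDERIV V x :> gradV x" and lip: "L-lipschitz_on S gradV"
    and S: "convex S" "x \<in> S" "x + h \<in> S"
  shows "V (x + h) \<le> V x + gradV x \<bullet> h + L * (norm h)\<^sup>2"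
proof -
  have d: "((\<lambda>t. V (x + t *\<^sub>R h)) has_real_derivative gradV (x + t *\<^sub>R h) \<bullet> h) (at t)" for t
  proof -
    have "(V has_derivative (\<lambda>k. k \<bullet> gradV (x + t *\<^sub>R h))) (at (x + t *\<^sub>R h))"
      using grad by (simp add: gderiv_def)
    moreover have "((\<lambda>t. x + t *\<^sub>R h) has_derivative (\<lambda>s. s *\<^sub>R h)) (at t)"
      by (auto intro!: derivative_eq_intros)
    ultimately have "((\<lambda>t. V (x + t *\<^sub>R h)) has_derivative (\<lambda>s. (s *\<^sub>R h) \<bullet> gradV (x + t *\<^sub>R h))) (at t)"
      using has_derivative_compose by fastforce
    then show ?thesis unfolding has_field_derivative_def
      by (rule has_derivative_eq_rhs) (auto simp: inner_commute mult.commute)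
  qed
  obtain z where z: "0 < z" "z < 1" "V (x + 1 *\<^sub>R h) - V (x + 0 *\<^sub>R h) = (1 - 0) * (gradV (x + z *\<^sub>R h) \<bullet> h)"
    using MVT2[of 0 1 "\<lambda>t. V (x + t *\<^sub>R h)" "\<lambda>t. gradV (x + t *\<^sub>R h) \<bullet> h"] d by auto
  have "x + z *\<^sub>R h = (1 - z) *\<^sub>R x + z *\<^sub>R (x + h)" by (simp add: algebra_simps)
  then have xz: "x + z *\<^sub>R h \<in> S" using S z(1,2) by (simp add: convexD)
  have L0: "L \<ge> 0" using lip by (rule lipschitz_on_nonneg)
  have "(gradV (x + z *\<^sub>R h) - gradV x) \<bullet> h \<le> norm (gradV (x + z *\<^sub>R h) - gradV x) * norm h"
    by (rule norm_cauchy_schwarz)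
  also have "\<dots> \<le> (L * norm (z *\<^sub>R h)) * norm h"
    using lipschitz_onD[OF lip xz S(2)] by (intro mult_right_mono) (auto simp: dist_norm)
  also have "\<dots> \<le> (L * norm h) * norm h"
    using z L0 by (intro mult_right_mono mult_left_mono) (auto simp: mult_left_le_one_le)
  finally show ?thesis using z(3) by (simp add: inner_diff_left power2_eq_square algebra_simps)
qed

lemma loc_L2_add:
  fixes f g :: "real \<Rightarrow> 'a::euclidean_space"
  assumes "loc_L2 f" "loc_L2 g"
  shows "loc_L2 (\<lambda>t. f t + g t)"
  unfolding loc_L2_def
proof (intro conjI allI)
  have m: "f \<in> borel_measurable borel" "g \<in> borel_measurable borel" using assms by (auto simp: loc_L2_def)
  then show mm: "(\<lambda>t. f t + g t) \<in> borel_measurable lborel" by simp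
  fix a b :: real
  have "set_integrable lborel {a..b} (\<lambda>t. 2 * (norm (f t))\<^sup>2 + 2 * (norm (g t))\<^sup>2)"
    using assms by (intro set_integral_add set_integrable_mult_right) (auto simp: loc_L2_def)
  then show "set_integrable lborel {a..b} (\<lambda>t. (norm (f t + g t))\<^sup>2)"
  proof (rule set_integrable_bound)
    show "set_borel_measurable lborel {a..b} (\<lambda>t. (norm (f t + g t))\<^sup>2)"
      using mm unfolding set_borel_measurable_def by simp
    have "(norm (f t + g t))\<^sup>2 \<le> 2 * (norm (f t))\<^sup>2 + 2 * (norm (g t))\<^sup>2" for t
    proof -
      have "(norm (f t + g t))\<^sup>2 \<le> (norm (f t) + norm (g t))\<^sup>2"
        by (intro power_mono norm_triangle_ineq) simp
      moreover have "0 \<le> (norm (f t) - norm (g t))\<^sup>2" by simp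
      ultimately show ?thesis by (simp add: power2_sum power2_diff)
    qed
    then show "AE t in lborel. t \<in> {a..b} \<longrightarrow> norm ((norm (f t + g t))\<^sup>2) \<le> norm (2 * (norm (f t))\<^sup>2 + 2 * (norm (g t))\<^sup>2)"
      by auto
  qed
qed

lemma loc_L2_scaleR:
  fixes f :: "real \<Rightarrow> 'a::euclidean_space"
  assumes "loc_L2 f"
  shows "loc_L2 (\<lambda>t. k *\<^sub>R f t)"
  unfolding loc_L2_def
proof (intro conjI allI)
  show "(\<lambda>t. k *\<^sub>R f t) \<in> borel_measurable lborel" using assms by (auto simp: loc_L2_def)
  show "set_integrable lborel {a..b} (\<lambda>t. (norm (k *\<^sub>R f t))\<^sup>2)" for a b
    using assms by (auto simp: loc_L2_def power_mult_distrib)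
qed

lemma loc_L2_restrict:
  fixes f :: "real \<Rightarrow> 'a::euclidean_space"
  assumes "loc_L2 f" "A \<in> sets borel"
  shows "loc_L2 (\<lambda>t. indicator A t *\<^sub>R f t)"
  unfolding loc_L2_def
proof (intro conjI allI)
  show m: "(\<lambda>t. indicator A t *\<^sub>R f t) \<in> borel_measurable lborel" using assms by (auto simp: loc_L2_def)
  fix a b :: real
  have "set_integrable lborel {a..b} (\<lambda>t. (norm (f t))\<^sup>2)" using assms by (auto simp: loc_L2_def)
  then show "set_integrable lborel {a..b} (\<lambda>t. (norm (indicator A t *\<^sub>R f t))\<^sup>2)"
  proof (rule set_integrable_bound)
    have [measurable]: "f \<in> borel_measurable borel" "A \<in> sets borel" using assms by (auto simp: loc_L2_def)
    show "set_borel_measurable lborel {a..b} (\<lambda>t. (norm (indicator A t *\<^sub>R f t))\<^sup>2)"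
      unfolding set_borel_measurable_def by measurable
  qed (auto simp: indicator_def intro!: AE_I2)
qed

lemma has_L2_deriv_add_scaleR:
  fixes p q :: "real \<Rightarrow> 'a::euclidean_space"
  assumes "has_L2_deriv q g" "has_L2_deriv p h"
  shows "has_L2_deriv (\<lambda>t. q t + k *\<^sub>R p t) (\<lambda>t. g t + k *\<^sub>R h t)"
  unfolding has_L2_deriv_def
proof (intro conjI allI impI)
  show "loc_L2 (\<lambda>t. g t + k *\<^sub>R h t)"
    using assms by (auto simp: has_L2_deriv_def intro: loc_L2_add loc_L2_scaleR)
  fix a b :: real assume "a \<le> b"
  then have "((\<lambda>t. g t + k *\<^sub>R h t) has_integral (q b - q a) + k *\<^sub>R (p b - p a)) {a..b}"
    using assms by (intro has_integral_add has_integral_cmul) (auto simp: has_L2_deriv_def)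
  then show "((\<lambda>t. g t + k *\<^sub>R h t) has_integral (q b + k *\<^sub>R p b) - (q a + k *\<^sub>R p a)) {a..b}"
    by (simp add: algebra_simps)
qed

lemma inner_loc_L2_integrable:
  fixes f g :: "real \<Rightarrow> 'a::euclidean_space"
  assumes "loc_L2 f" "loc_L2 g"
  shows "set_integrable lborel {a..b} (\<lambda>t. f t \<bullet> g t)"
proof -
  have m: "f \<in> borel_measurable borel" "g \<in> borel_measurable borel" using assms by (auto simp: loc_L2_def)
  have "set_integrable lborel {a..b} (\<lambda>t. (norm (f t))\<^sup>2 + (norm (g t))\<^sup>2)"
    using assms by (intro set_integral_add) (auto simp: loc_L2_def)
  then show ?thesis
  proof (rule set_integrable_bound)
    show "set_borel_measurable lborel {a..b} (\<lambda>t. f t \<bullet> g t)"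
      using m unfolding set_borel_measurable_def by simp
    have "\<bar>f t \<bullet> g t\<bar> \<le> (norm (f t))\<^sup>2 + (norm (g t))\<^sup>2" for t
    proof -
      have "\<bar>f t \<bullet> g t\<bar> \<le> norm (f t) * norm (g t)" by (rule Cauchy_Schwarz_ineq2)
      moreover have "0 \<le> (norm (f t) - norm (g t))\<^sup>2" by simp
      moreover have "0 \<le> norm (f t) * norm (g t)" by simp
      ultimately show ?thesis by (simp add: power2_diff)
    qed
    then show "AE t in lborel. t \<in> {a..b} \<longrightarrow> norm (f t \<bullet> g t) \<le> norm ((norm (f t))\<^sup>2 + (norm (g t))\<^sup>2)"
      by auto
  qed
qed

text \<open>The sum over coordinates of \<open>by_parts_L2\<close> with the scalar factor
  \<open>P t \<bullet> i\<close>. One factor is continuously differentiable, the other has only a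
  square integrable derivative.\<close>

lemma by_parts_inner:
  fixes p P :: "real \<Rightarrow> 'a::euclidean_space"
  assumes p: "has_L2_deriv p h" and P: "\<And>t. (P has_vector_derivative P' t) (at t)" "continuous_on UNIV P'"
    and "a \<le> b"
  shows "((\<lambda>t. P' t \<bullet> p t + P t \<bullet> h t) has_integral (P b \<bullet> p b - P a \<bullet> p a)) {a..b}"
proof -
  have "((\<lambda>t. (((P' t \<bullet> i) *\<^sub>R p t + (P t \<bullet> i) *\<^sub>R h t) \<bullet> i)) has_integral
     (((P b \<bullet> i) *\<^sub>R p b - (P a \<bullet> i) *\<^sub>R p a) \<bullet> i)) {a..b}" for i
  proof (rule has_integral_linear[OF _ bounded_linear_inner_left, unfolded o_def], rule by_parts_L2[OF p])
    show "((\<lambda>t. P t \<bullet> i) has_real_derivative P' t \<bullet> i) (at t)" for t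
      using P(1)[of t] unfolding has_real_derivative_iff_has_vector_derivative
      by (rule bounded_linear.has_vector_derivative[OF bounded_linear_inner_left])
    show "continuous_on UNIV (\<lambda>t. P' t \<bullet> i)" by (intro continuous_intros P)
  qed fact
  then have "((\<lambda>t. \<Sum>i\<in>Basis. (((P' t \<bullet> i) *\<^sub>R p t + (P t \<bullet> i) *\<^sub>R h t) \<bullet> i)) has_integral
     (\<Sum>i\<in>Basis. (((P b \<bullet> i) *\<^sub>R p b - (P a \<bullet> i) *\<^sub>R p a) \<bullet> i))) {a..b}"
    by (intro has_integral_sum) auto
  then show ?thesis
    by (simp add: inner_add_left inner_diff_left sum.distrib sum_subtractf euclidean_inner[of "P' _" "p _"]
        euclidean_inner[of "P _" "h _"] euclidean_inner[of "P _" "p _"])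
qed

text \<open>For small \<open>e\<close> the linear term dominates, and \<open>e\<close> may have the
  sign opposite to \<open>A\<close>. The size \<open>t\<close> is at most
  \<open>\<bar>A\<bar> / (2 * M)\<close>, so the quadratic term spends at most half of the
  gain.\<close>

lemma first_variation_zero:
  fixes A B :: real
  assumes d: "d > 0" and nn: "\<And>e. \<bar>e\<bar> < d \<Longrightarrow> 0 \<le> e * A + e\<^sup>2 * B"
  shows "A = 0"
proof (rule ccontr)
  assume "A \<noteq> 0"
  define M where "M = \<bar>B\<bar> + 1"
  define t where "t = min (d / 2) (\<bar>A\<bar> / (2 * M))"
  have t: "0 < t" "t < d" "t * M \<le> \<bar>A\<bar> / 2"
  proof -
    have M: "M > 0" by (simp add: M_def)
    show "0 < t" "t < d" using d \<open>A \<noteq> 0\<close> M by (auto simp: t_def min_def)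
    have "t * M \<le> \<bar>A\<bar> / (2 * M) * M" using M by (intro mult_right_mono) (auto simp: t_def)
    also have "\<dots> = \<bar>A\<bar> / 2" using M by simp
    finally show "t * M \<le> \<bar>A\<bar> / 2" .
  qed
  have "0 \<le> (- sgn A * t) * A + (- sgn A * t)\<^sup>2 * B"
    using t \<open>A \<noteq> 0\<close> by (intro nn) (auto simp: abs_mult abs_sgn_eq)
  also have "\<dots> = t * (- \<bar>A\<bar> + t * B)"
    using \<open>A \<noteq> 0\<close> by (simp add: power_mult_distrib algebra_simps power2_eq_square abs_sgn sgn_if)
  finally have "0 \<le> - \<bar>A\<bar> + t * B" using t(1) by (simp add: zero_le_mult_iff)
  moreover have "t * B \<le> t * M" using t(1) by (intro mult_left_mono) (auto simp: M_def)
  ultimately show False using t(3) \<open>A \<noteq> 0\<close> by simp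
qed

lemma GDERIV_continuous_on:
  assumes "\<And>x. GDERIV V x :> gradV x"
  shows "continuous_on S V"
  using assms has_derivative_continuous unfolding gderiv_def
  by (blast intro: continuous_at_imp_continuous_on)

lemma integral_zero_continuous:
  fixes f :: "real \<Rightarrow> real"
  assumes f: "continuous_on {a..b} f" and z: "\<And>t. t \<in> {a..b} \<Longrightarrow> integral {a..t} f = 0" and t: "t \<in> {a<..<b}"
  shows "f t = 0"
proof -
  have "((\<lambda>u. integral {a..u} f) has_vector_derivative f t) (at t within {a..b})"
    using f t by (intro integral_has_vector_derivative) auto
  then have 1: "((\<lambda>u. integral {a..u} f) has_vector_derivative f t) (at t)"
    using t by (simp add: at_within_Icc_at)
  have "((\<lambda>u. integral {a..u} f) has_vector_derivative 0) (at t)"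
    by (rule has_vector_derivative_transform_within_open[of "\<lambda>_. 0" 0 t "{a<..<b}"]) (use t z in auto)
  with 1 show ?thesis by (rule vector_derivative_unique_at)
qed

text \<open>The variation whose derivative is \<open>\<psi> = g - (P + k)\<close> on \<open>[a, b]\<close>, where \<open>P\<close> is a primitive of
  \<open>\<nabla>V(q)\<close> and \<open>k\<close> makes the mean vanish; the first variation then equals \<open>\<integral> |\<psi>|\<^sup>2\<close>.\<close>
lemma minimal_euler_lagrange:
  fixes V :: "'a::euclidean_space \<Rightarrow> real"
  assumes grad: "\<And>x. GDERIV V x :> gradV x" and cgrad: "continuous_on UNIV gradV"
    and lip: "locally_lipschitz gradV"
    and q: "minimal V c Am Ap q g" and fin: "action V c q < \<infinity>"
    and ab: "a < b" and above: "\<And>t. t \<in> {a..b} \<Longrightarrow> c < V (q t)"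
  obtains p where "\<And>t. t \<in> {a<..<b} \<Longrightarrow> (q has_vector_derivative p t) (at t)"
    "\<And>t. t \<in> {a<..<b} \<Longrightarrow> (p has_vector_derivative gradV (q t)) (at t)"
    "\<And>t. t \<in> {a<..<b} \<Longrightarrow> (norm (p t))\<^sup>2 / 2 = V (q t) - c"
proof -
  have V: "continuous_on S V" for S by (rule GDERIV_continuous_on[OF grad])
  have qd: "has_L2_deriv q g" and qG: "q \<in> Gamma V c Am Ap" using q by (auto simp: minimal_def)
  have cq: "continuous_on S q" for S by (rule has_L2_deriv_continuous[OF qd])
  have L2g: "loc_L2 g" using qd by (simp add: has_L2_deriv_def)
  define F where "F = (\<lambda>t. gradV (q t))"
  have cF: "continuous_on S F" for S
    unfolding F_def by (intro continuous_on_compose2[OF cgrad cq]) auto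
  define P where "P = prim F"
  have dP: "(P has_vector_derivative F t) (at t)" for t
    unfolding P_def by (rule prim_has_vector_derivative[OF cF])
  have cP: "continuous_on S P" for S
    using dP by (intro continuous_at_imp_continuous_on) (auto intro: has_vector_derivative_continuous)
  have gi: "g integrable_on {s..t}" for s t
    using loc_L2_absolutely_integrable[OF L2g] by (auto simp: absolutely_integrable_on_def)
  have Pi: "P integrable_on {s..t}" for s t by (intro integrable_continuous_interval cP)
  define k where "k = (1 / (b - a)) *\<^sub>R integral {a..b} (\<lambda>t. g t - P t)"
  define \<psi> where "\<psi> = (\<lambda>t. indicator {a..b} t *\<^sub>R (g t + (-1) *\<^sub>R (P t + k)))"
  have L2r: "loc_L2 (\<lambda>t. g t + (-1) *\<^sub>R (P t + k))"
    by (intro loc_L2_add loc_L2_scaleR L2g continuous_loc_L2 cP continuous_intros)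
  have L2psi: "loc_L2 \<psi>" unfolding \<psi>_def by (intro loc_L2_restrict L2r) simp
  define \<phi> where "\<phi> = (\<lambda>t. - prim \<psi> a + 1 *\<^sub>R prim \<psi> t)"
  have "has_L2_deriv \<phi> (\<lambda>t. 0 + 1 *\<^sub>R \<psi> t)"
    unfolding \<phi>_def by (intro has_L2_deriv_add_scaleR has_L2_deriv_const has_L2_deriv_prim L2psi)
  then have phid: "has_L2_deriv \<phi> \<psi>" by simp
  have psi_in: "\<psi> t = g t - P t - k" if "t \<in> {a..b}" for t using that by (simp add: \<psi>_def)
  have psi_out: "\<psi> t = 0" if "t \<notin> {a..b}" for t using that by (simp add: \<psi>_def)
  have pa: "\<phi> a = 0" by (simp add: \<phi>_def)
  have int0: "integral {a..b} \<psi> = 0"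
  proof -
    have "integral {a..b} \<psi> = integral {a..b} (\<lambda>t. (g t - P t) - k)"
      by (rule integral_cong) (simp add: psi_in)
    also have "\<dots> = integral {a..b} (\<lambda>t. g t - P t) - (b - a) *\<^sub>R k"
      using gi Pi ab by (subst Henstock_Kurzweil_Integration.integral_diff) (auto intro!: integrable_diff)
    also have "\<dots> = 0" using ab by (simp add: k_def)
    finally show ?thesis .
  qed
  then have pb: "\<phi> b = 0" using has_L2_deriv_integral[OF phid, of a b] ab pa by simp
  have phi_out: "\<phi> t = 0" if "t \<notin> {a..b}" for t
  proof -
    have z: "integral {u..v} \<psi> = 0" if "v \<le> a \<or> b \<le> u" for u v
      by (intro integral_unique has_integral_spike_finite[of "{a,b}" _ \<psi> "\<lambda>_. 0"])
        (use that psi_out in auto)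
    show ?thesis
    proof (cases "t < a")
      case True
      then show ?thesis using has_L2_deriv_integral[OF phid, of t a] z[of a t] pa by simp
    next
      case False
      then show ?thesis using has_L2_deriv_integral[OF phid, of b t] z[of t b] that pb by simp
    qed
  qed
  have cphi: "continuous_on S \<phi>" for S by (rule has_L2_deriv_continuous[OF phid])
  obtain B where B: "B > 0" "\<And>t. norm (\<phi> t) \<le> B"
  proof -
    have "compact (\<phi> ` {a..b})" by (intro compact_continuous_image cphi) simp
    then obtain B where "B > 0" "\<forall>x\<in>\<phi> ` {a..b}. norm x \<le> B" using compact_imp_bounded bounded_pos by metis
    then show ?thesis using that[of B] phi_out by (metis image_eqI less_imp_le norm_zero)
  qed
  obtain M where M: "\<And>t. t \<in> {a..b} \<Longrightarrow> norm (q t) \<le> M"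
  proof -
    have "compact (q ` {a..b})" by (intro compact_continuous_image cq) simp
    then obtain M where "\<forall>x\<in>q ` {a..b}. norm x \<le> M" using compact_imp_bounded bounded_pos by metis
    then show ?thesis using that[of M] by auto
  qed
  obtain L where L: "L-lipschitz_on (cball 0 (M + 1)) gradV" using locally_lipschitz_cball[OF lip] by blast
  have L0: "L \<ge> 0" using L by (rule lipschitz_on_nonneg)
  \<comment> \<open>By compactness the path stays above the level by a fixed amount on
    \<open>[a, b]\<close>, so that small variations of both signs respect the constraint.\<close>
  obtain \<mu> where mu: "\<mu> > 0" "\<And>t. t \<in> {a..b} \<Longrightarrow> c + \<mu> \<le> V (q t)"
  proof -
    have "continuous_on {a..b} (\<lambda>t. V (q t))" by (intro continuous_on_compose2[OF V cq]) auto
    then obtain x where "x \<in> {a..b}" "\<forall>y\<in>{a..b}. V (q x) \<le> V (q y)"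
      using continuous_attains_inf[of "{a..b}" "\<lambda>t. V (q t)"] ab by auto
    then show ?thesis using above[of x] that[of "V (q x) - c"] by auto
  qed
  have "uniformly_continuous_on (cball 0 (M + 1)) V" by (intro compact_uniformly_continuous V) simp
  then obtain d where d: "d > 0" "\<And>x y. x \<in> cball 0 (M + 1) \<Longrightarrow> y \<in> cball 0 (M + 1) \<Longrightarrow> dist x y < d \<Longrightarrow> dist (V x) (V y) < \<mu>"
    unfolding uniformly_continuous_on_def using mu(1) by metis
  \<comment> \<open>The bound 1 keeps the varied path in the ball of radius \<open>M + 1\<close> on
    which \<open>gradV\<close> has Lipschitz constant \<open>L\<close>; the bound \<open>d\<close>
    keeps \<open>V\<close> within \<open>\<mu>\<close> of its old value.\<close>
  define \<epsilon> where "\<epsilon> = min 1 d / B"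
  have eps: "\<epsilon> > 0" using d B by (simp add: \<epsilon>_def)
  \<comment> \<open>\<open>A\<close> is the first variation in the direction \<open>\<phi>\<close>;
    \<open>Q\<close> bounds the quadratic remainder, so the action changes by at most
    \<open>e * A + e\<^sup>2 * Q\<close>.\<close>
  define A where "A = integral {a..b} (\<lambda>t. g t \<bullet> \<psi> t + F t \<bullet> \<phi> t)"
  define Q where "Q = integral {a..b} (\<lambda>t. (norm (\<psi> t))\<^sup>2 / 2 + L * (norm (\<phi> t))\<^sup>2)"
  have i1: "(\<lambda>t. g t \<bullet> \<psi> t + F t \<bullet> \<phi> t) integrable_on {a..b}"
    using set_borel_integral_eq_integral(1)[OF inner_loc_L2_integrable[OF L2g L2psi]]
    by (intro integrable_add integrable_continuous_interval[of _ _ "\<lambda>t. F t \<bullet> \<phi> t"] continuous_intros cF cphi) auto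
  have i2: "(\<lambda>t. (norm (\<psi> t))\<^sup>2 / 2 + L * (norm (\<phi> t))\<^sup>2) integrable_on {a..b}"
    using set_borel_integral_eq_integral(1)[OF kinetic_integrable[OF phid]]
    by (intro integrable_add integrable_continuous_interval[of _ _ "\<lambda>t. L * (norm (\<phi> t))\<^sup>2"] continuous_intros cphi) auto
  have "0 \<le> e * A + e\<^sup>2 * Q" if e: "\<bar>e\<bar> < \<epsilon>" for e
  proof -
    define qe ge where "qe = (\<lambda>t. q t + e *\<^sub>R \<phi> t)" and "ge = (\<lambda>t. g t + e *\<^sub>R \<psi> t)"
    have qed': "has_L2_deriv qe ge" unfolding qe_def ge_def by (rule has_L2_deriv_add_scaleR[OF qd phid])
    have eB: "norm (e *\<^sub>R \<phi> t) < min 1 d" for t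
    proof -
      have "norm (e *\<^sub>R \<phi> t) \<le> \<bar>e\<bar> * B" using B by (simp add: mult_left_mono)
      also have "\<dots> < \<epsilon> * B" using e B by simp
      finally show ?thesis using B by (simp add: \<epsilon>_def)
    qed
    have mem: "q t \<in> cball 0 (M + 1)" "qe t \<in> cball 0 (M + 1)" if "t \<in> {a..b}" for t
      using M[OF that] eB[of t] norm_triangle_ineq[of "q t" "e *\<^sub>R \<phi> t"] by (auto simp: qe_def)
    have out: "qe t = q t" "ge t = g t" if "t \<notin> {a..b}" for t
      using phi_out psi_out that by (auto simp: qe_def ge_def)
    have Vqe: "c \<le> V (qe t)" for t
    proof (cases "t \<in> {a..b}")
      case True
      have "dist (V (q t)) (V (qe t)) < \<mu>"
        using eB[of t] by (intro d(2) mem True) (simp add: qe_def dist_norm)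
      then show ?thesis using mu(2)[OF True] by (simp add: dist_real_def)
    next
      case False
      then show ?thesis using out qG by (simp add: Gamma_iff)
    qed
    have "qe \<in> Gamma V c Am Ap"
      unfolding Gamma_iff
    proof (intro conjI allI impI)
      show "qe \<in> H1_loc" by (rule has_L2_deriv_H1_loc[OF qed'])
    next
      fix r T :: real assume r: "r > 0"
      have "\<exists>t\<le>min T (a - 1). infdist (q t) Am < r" using qG r unfolding Gamma_iff by blast
      then obtain t where "t \<le> min T (a - 1)" "infdist (q t) Am < r" by blast
      then show "\<exists>t\<le>T. infdist (qe t) Am < r" using out by (intro exI[of _ t]) auto
      have "\<exists>t\<ge>max T (b + 1). infdist (q t) Ap < r" using qG r unfolding Gamma_iff by blast
      then obtain t where "t \<ge> max T (b + 1)" "infdist (q t) Ap < r" by blast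
      then show "\<exists>t\<ge>T. infdist (qe t) Ap < r" using out by (intro exI[of _ t]) auto
    qed (rule Vqe)
    then have le: "action V c q \<le> action V c qe" using q by (simp add: minimal_def)
    have meas: "energy V c q g \<in> borel_measurable borel" "energy V c qe ge \<in> borel_measurable borel"
      using energy_measurable[OF qd V] energy_measurable[OF qed' V] by auto
    define O' where "O' = action_on (-{a..b}) V c q g"
    have split: "action V c r = action_on {a..b} V c r h + action_on (-{a..b}) V c r h"
      if [measurable]: "energy V c r h \<in> borel_measurable borel" and "has_L2_deriv r h" for r h
    proof -
      have "action V c r = (\<integral>\<^sup>+t. ennreal (energy V c r h t) * indicator {a..b} t + ennreal (energy V c r h t) * indicator (-{a..b}) t \<partial>lborel)"
        unfolding action_eq[OF that(2)] by (rule nn_integral_cong) (auto simp: indicator_def)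
      also have "\<dots> = action_on {a..b} V c r h + action_on (-{a..b}) V c r h"
        by (rule nn_integral_add) measurable
      finally show ?thesis .
    qed
    have "action_on (-{a..b}) V c qe ge = O'"
      unfolding O'_def by (rule nn_integral_cong) (use out in \<open>auto simp: indicator_def energy_def\<close>)
    then have sq: "action V c qe = O' + action_on {a..b} V c qe ge"
      "action V c q = O' + action_on {a..b} V c q g"
      using split[OF meas(2) qed'] split[OF meas(1) qd] by (simp_all add: O'_def add.commute)
    have "O' < \<infinity>" using fin sq by auto
    with le have le2: "action_on {a..b} V c q g \<le> action_on {a..b} V c qe ge"
      unfolding sq ennreal_add_left_cancel_le by (elim disjE) simp_all
    have nn: "0 \<le> energy V c q g t" "0 \<le> energy V c qe ge t" for t
      using qG Vqe[of t] by (auto simp: energy_def Gamma_iff)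
    have ei: "energy V c q g integrable_on {a..b}" "energy V c qe ge integrable_on {a..b}"
      using set_borel_integral_eq_integral(1)[OF energy_integrable[OF qd V]]
        set_borel_integral_eq_integral(1)[OF energy_integrable[OF qed' V]] by auto
    have "ennreal (integral {a..b} (energy V c q g)) \<le> ennreal (integral {a..b} (energy V c qe ge))"
      using le2 nn by (simp add: nn_integral_Icc energy_integrable[OF qd V] energy_integrable[OF qed' V])
    moreover have "0 \<le> integral {a..b} (energy V c qe ge)" using nn by (intro Henstock_Kurzweil_Integration.integral_nonneg ei) auto
    ultimately have "integral {a..b} (energy V c q g) \<le> integral {a..b} (energy V c qe ge)"
      by (simp add: ennreal_le_iff)
    also have "\<dots> \<le> integral {a..b} (\<lambda>t. energy V c q g t + (e * (g t \<bullet> \<psi> t + F t \<bullet> \<phi> t) + e\<^sup>2 * ((norm (\<psi> t))\<^sup>2 / 2 + L * (norm (\<phi> t))\<^sup>2)))"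
    proof (rule integral_le)
      show "(\<lambda>t. energy V c q g t + (e * (g t \<bullet> \<psi> t + F t \<bullet> \<phi> t) + e\<^sup>2 * ((norm (\<psi> t))\<^sup>2 / 2 + L * (norm (\<phi> t))\<^sup>2))) integrable_on {a..b}"
        by (intro integrable_add integrable_on_mult_right ei i1 i2)
      fix t assume t: "t \<in> {a..b}"
      have "V (q t + e *\<^sub>R \<phi> t) \<le> V (q t) + gradV (q t) \<bullet> (e *\<^sub>R \<phi> t) + L * (norm (e *\<^sub>R \<phi> t))\<^sup>2"
        using mem[OF t] by (intro lipschitz_gradient_upper_bound[OF grad L]) (auto simp: qe_def)
      moreover have "(norm (ge t))\<^sup>2 = (norm (g t))\<^sup>2 + 2 * e * (g t \<bullet> \<psi> t) + e\<^sup>2 * (norm (\<psi> t))\<^sup>2"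
        unfolding ge_def power2_norm_eq_inner by (simp add: inner_add inner_commute algebra_simps power2_eq_square)
      ultimately show "energy V c qe ge t \<le> energy V c q g t + (e * (g t \<bullet> \<psi> t + F t \<bullet> \<phi> t) + e\<^sup>2 * ((norm (\<psi> t))\<^sup>2 / 2 + L * (norm (\<phi> t))\<^sup>2))"
        by (simp add: energy_def qe_def F_def power_mult_distrib add_divide_distrib algebra_simps)
    qed (rule ei)
    also have "\<dots> = integral {a..b} (energy V c q g) + (e * A + e\<^sup>2 * Q)"
      unfolding A_def Q_def
      by (intro integral_unique has_integral_add has_integral_mult_right integrable_integral ei i1 i2)
    finally show ?thesis by simp
  qed
  then have A0: "A = 0" by (rule first_variation_zero[OF eps])
  \<comment> \<open>Integrating by parts replaces \<open>F t \<bullet> \<phi> t\<close> by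
    \<open>- P t \<bullet> \<psi> t\<close>, as \<open>\<phi>\<close> vanishes at both ends. Since
    \<open>\<psi>\<close> has mean zero the constant \<open>k\<close> can be subtracted as well,
    leaving the product of \<open>\<psi>\<close> with itself.\<close>
  have A_eq: "integral {a..b} (\<lambda>t. (norm (\<psi> t))\<^sup>2) = A"
  proof -
    have "((\<lambda>t. F t \<bullet> \<phi> t + P t \<bullet> \<psi> t) has_integral 0) {a..b}"
      using by_parts_inner[OF phid dP cF, of a b] ab pa pb by simp
    moreover have "((\<lambda>t. \<psi> t \<bullet> k) has_integral 0) {a..b}"
    proof -
      have "(\<psi> has_integral \<phi> b - \<phi> a) {a..b}" using phid ab by (simp add: has_L2_deriv_def)
      then show ?thesis using has_integral_linear[OF _ bounded_linear_inner_left, of \<psi> 0 "{a..b}" k] pa pb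
        by (simp add: o_def)
    qed
    moreover have "((\<lambda>t. g t \<bullet> \<psi> t + F t \<bullet> \<phi> t) has_integral A) {a..b}"
      using i1 by (simp add: A_def has_integral_iff)
    ultimately have "((\<lambda>t. (g t \<bullet> \<psi> t + F t \<bullet> \<phi> t) - (F t \<bullet> \<phi> t + P t \<bullet> \<psi> t) - \<psi> t \<bullet> k) has_integral A - 0 - 0) {a..b}"
      by (intro has_integral_diff)
    moreover have "(g t \<bullet> \<psi> t + F t \<bullet> \<phi> t) - (F t \<bullet> \<phi> t + P t \<bullet> \<psi> t) - \<psi> t \<bullet> k = (norm (\<psi> t))\<^sup>2" if "t \<in> {a..b}" for t
      using psi_in[OF that] by (simp add: power2_norm_eq_inner inner_diff inner_commute)
    ultimately have "((\<lambda>t. (norm (\<psi> t))\<^sup>2) has_integral A - 0 - 0) {a..b}"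
      by (rule has_integral_eq[rotated])
    then show ?thesis by (simp add: integral_unique)
  qed
  have AEpsi: "AE t in lborel. \<psi> t = 0"
  proof -
    have si: "set_integrable lborel {a..b} (\<lambda>t. (norm (\<psi> t))\<^sup>2)" using L2psi by (simp add: loc_L2_def)
    have *: "(LBINT t. (norm (\<psi> t))\<^sup>2) = 0" "integrable lborel (\<lambda>t. (norm (\<psi> t))\<^sup>2)"
      using integral_lborel_support[OF si] psi_out A_eq A0 by auto
    then have "AE t in lborel. (norm (\<psi> t))\<^sup>2 = 0" using integral_nonneg_eq_0_iff_AE[OF *(2)] by simp
    then show ?thesis by simp
  qed
  have phi0: "\<phi> t = 0" if "t \<in> {a..b}" for t
  proof -
    have "(\<psi> has_integral \<phi> t - \<phi> a) {a..t}" using phid that by (auto simp: has_L2_deriv_def)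
    moreover have "((\<lambda>_. 0) has_integral \<phi> t - \<phi> a) {a..t} \<longleftrightarrow> (\<psi> has_integral \<phi> t - \<phi> a) {a..t}"
      using AEpsi by (intro has_integral_AE) auto
    ultimately show ?thesis using pa by simp
  qed
  \<comment> \<open>The continuous representative of \<open>g\<close> on \<open>[a, b]\<close>:
    there \<open>\<psi>\<close> is the difference of the two and vanishes almost everywhere.\<close>
  define p where "p = (\<lambda>t. P t + k)"
  have cp: "continuous_on S p" for S unfolding p_def by (intro continuous_intros cP)
  have qp: "q t = q a + (prim p t - prim p a)" if "t \<in> {a..b}" for t
  proof -
    have "(\<psi> has_integral \<phi> t - \<phi> a) {a..t}" using phid that by (auto simp: has_L2_deriv_def)
    then have "(\<psi> has_integral 0) {a..t}" using phi0[OF that] pa by simp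
    moreover have "(p has_integral prim p t - prim p a) {a..t}"
      using that by (intro has_integral_prim integrable_continuous_interval cp) auto
    ultimately have "((\<lambda>r. \<psi> r + p r) has_integral 0 + (prim p t - prim p a)) {a..t}" by (rule has_integral_add)
    then have "(g has_integral 0 + (prim p t - prim p a)) {a..t}"
      by (rule has_integral_eq[rotated]) (use that psi_in in \<open>auto simp: p_def\<close>)
    moreover have "(g has_integral q t - q a) {a..t}" using qd that by (auto simp: has_L2_deriv_def)
    ultimately have "0 + (prim p t - prim p a) = q t - q a" by (rule has_integral_unique)
    then show ?thesis by simp
  qed
  \<comment> \<open>The equation alone would leave the energy as an unknown constant. Equipartition
    on every \<open>[a, t]\<close> determines it, since a continuous function with all these
    integrals zero vanishes.\<close>
  have energy0: "(norm (p t))\<^sup>2 / 2 - (V (q t) - c) = 0" if t: "t \<in> {a<..<b}" for t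
  proof (rule integral_zero_continuous[OF _ _ t])
    show c1: "continuous_on {a..b} (\<lambda>t. (norm (p t))\<^sup>2 / 2 - (V (q t) - c))"
      by (intro continuous_intros cp continuous_on_compose2[OF V cq]) auto
    fix t assume t: "t \<in> {a..b}"
    have "((\<lambda>r. (norm (g r))\<^sup>2 / 2) has_integral integral {a..t} (\<lambda>r. V (q r) - c)) {a..t}"
      using minimal_equipartition[OF V q fin, of a t] t
        set_borel_integral_eq_integral(1)[OF kinetic_integrable[OF qd]] by (auto simp: has_integral_iff)
    moreover have "((\<lambda>r. (norm (g r))\<^sup>2 / 2) has_integral integral {a..t} (\<lambda>r. V (q r) - c)) {a..t}
       \<longleftrightarrow> ((\<lambda>r. (norm (p r))\<^sup>2 / 2) has_integral integral {a..t} (\<lambda>r. V (q r) - c)) {a..t}"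
    proof (rule has_integral_AE)
      show "AE r\<in>{a..t} in lborel. (norm (g r))\<^sup>2 / 2 = (norm (p r))\<^sup>2 / 2"
        using AEpsi
      proof eventually_elim
        case (elim r)
        then show ?case using psi_in[of r] t by (auto simp: p_def)
      qed
    qed
    moreover have "((\<lambda>r. V (q r) - c) has_integral integral {a..t} (\<lambda>r. V (q r) - c)) {a..t}"
      using set_borel_integral_eq_integral(1)[OF potential_integrable[OF qd V]] by (auto simp: has_integral_iff)
    ultimately have "((\<lambda>r. (norm (p r))\<^sup>2 / 2 - (V (q r) - c)) has_integral
        integral {a..t} (\<lambda>r. V (q r) - c) - integral {a..t} (\<lambda>r. V (q r) - c)) {a..t}"
      by (intro has_integral_diff) blast+
    then show "integral {a..t} (\<lambda>t. (norm (p t))\<^sup>2 / 2 - (V (q t) - c)) = 0" by (simp add: integral_unique)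
  qed
  show ?thesis
  proof (rule that[of p])
    fix t assume t: "t \<in> {a<..<b}"
    have "((\<lambda>u. prim p u + (q a - prim p a)) has_vector_derivative p t) (at t)"
      unfolding has_vector_derivative_add_const by (rule prim_has_vector_derivative[OF cp])
    then show "(q has_vector_derivative p t) (at t)"
    proof (rule has_vector_derivative_transform_within_open[of _ _ _ "{a<..<b}"])
      show "prim p u + (q a - prim p a) = q u" if "u \<in> {a<..<b}" for u using qp[of u] that by simp
    qed (use t in auto)
    show "(p has_vector_derivative gradV (q t)) (at t)"
      unfolding p_def has_vector_derivative_add_const using dP[of t] by (simp add: F_def)
    show "(norm (p t))\<^sup>2 / 2 = V (q t) - c" using energy0[OF t] by simp
  qed
qed

section \<open>Unfolding by reflection\<close>

text \<open>The mean value inequality is applied to \<open>f s - (s - e) *\<^sub>R L\<close> on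
  segments ending at \<open>e\<close>. At a reflection point this is used twice: for the path, whose
  velocity tends to 0, and then for the velocity, whose derivative tends to
  \<open>gradV\<close>.\<close>

lemma has_vector_derivative_punctured_limit:
  fixes f :: "real \<Rightarrow> 'a::real_inner"
  assumes c: "isCont f e" and r: "r > 0"
    and d: "\<And>s. 0 < \<bar>s - e\<bar> \<Longrightarrow> \<bar>s - e\<bar> < r \<Longrightarrow> (f has_vector_derivative v s) (at s)"
    and lim: "(v \<longlongrightarrow> L) (at e)"
  shows "(f has_vector_derivative L) (at e)"
  unfolding has_vector_derivative_def has_derivative_at_alt
proof (intro conjI allI impI)
  show "bounded_linear (\<lambda>x. x *\<^sub>R L)" by (rule bounded_linear_scaleR_left)
  fix \<eta> :: real assume "\<eta> > 0"
  then obtain \<delta> where del: "\<delta> > 0" "\<And>s. s \<noteq> e \<Longrightarrow> dist s e < \<delta> \<Longrightarrow> dist (v s) L < \<eta>"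
    using lim unfolding tendsto_iff eventually_at by force
  define F where "F = (\<lambda>s. f s - (s - e) *\<^sub>R L)"
  have dF: "(F has_vector_derivative v s - L) (at s)" if "0 < \<bar>s - e\<bar>" "\<bar>s - e\<bar> < r" for s
    unfolding F_def using d[OF that] by (auto intro!: derivative_eq_intros)
  have cF: "isCont F s" if "\<bar>s - e\<bar> < r" for s
  proof (cases "s = e")
    case True
    then show ?thesis unfolding F_def using c by (intro continuous_intros) auto
  next
    case False
    then show ?thesis using dF[of s] that has_vector_derivative_continuous by auto
  qed
  have seg: "norm (F b - F a) \<le> \<eta> * (b - a)" if "a < b" "a = e \<or> b = e" "b - a < min r \<delta>" for a b
  proof -
    have "\<exists>x\<in>{a<..<b}. norm (F b - F a) \<le> norm ((\<lambda>h. h *\<^sub>R (v x - L)) (b - a))"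
    proof (rule mvt_general[of a b F "\<lambda>x h. h *\<^sub>R (v x - L)"])
      show "continuous_on {a..b} F"
        by (rule continuous_at_imp_continuous_on) (use cF that in \<open>auto simp: min_def split: if_splits\<close>)
      show "(F has_derivative (\<lambda>h. h *\<^sub>R (v x - L))) (at x)" if "a < x" "x < b" for x
        using dF[of x] that \<open>a = e \<or> b = e\<close> \<open>b - a < min r \<delta>\<close> by (auto simp: has_vector_derivative_def)
    qed fact
    then obtain x where x: "x \<in> {a<..<b}" "norm (F b - F a) \<le> norm ((b - a) *\<^sub>R (v x - L))" by auto
    have "norm (v x - L) \<le> \<eta>"
      using del(2)[of x] x(1) that by (auto simp: dist_norm dist_real_def)
    then have "(b - a) * norm (v x - L) \<le> (b - a) * \<eta>" using that(1) by (intro mult_left_mono) auto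
    moreover have "norm (F b - F a) \<le> (b - a) * norm (v x - L)" using x(2) that(1) by simp
    ultimately show ?thesis by (metis order_trans mult.commute)
  qed
  show "\<exists>d>0. \<forall>y. norm (y - e) < d \<longrightarrow> norm (f y - f e - (y - e) *\<^sub>R L) \<le> \<eta> * norm (y - e)"
  proof (intro exI[of _ "min r \<delta>"] conjI allI impI)
    show "0 < min r \<delta>" using r del by simp
    fix y assume y: "norm (y - e) < min r \<delta>"
    have eq: "f y - f e - (y - e) *\<^sub>R L = F y - F e" by (simp add: F_def)
    consider "y = e" | "e < y" | "y < e" by linarith
    then show "norm (f y - f e - (y - e) *\<^sub>R L) \<le> \<eta> * norm (y - e)"
    proof cases
      case 1 then show ?thesis by simp
    next
      case 2 then show ?thesis using seg[of e y] y unfolding eq by auto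
    next
      case 3 then show ?thesis using seg[of y e] y unfolding eq by (auto simp: norm_minus_commute)
    qed
  qed
qed

text \<open>\<open>u\<close> agrees with \<open>q\<close> on \<open>I\<close> and is determined elsewhere by the reflections about the points of \<open>E\<close>.\<close>
definition unfolds :: "real set \<Rightarrow> real set \<Rightarrow> (real \<Rightarrow> 'a) \<Rightarrow> (real \<Rightarrow> 'a) \<Rightarrow> bool" where
  "unfolds I E q u \<longleftrightarrow> (\<forall>t\<in>I. u t = q t) \<and> I \<subseteq> interior I \<union> E \<and>
     (\<forall>e\<in>E. e \<in> I \<and> (\<forall>t. u (2 * e - t) = u t) \<and>
       (\<exists>r>0. \<forall>s. 0 < \<bar>s - e\<bar> \<longrightarrow> \<bar>s - e\<bar> < r \<longrightarrow> s \<in> interior I \<or> 2 * e - s \<in> interior I)) \<and>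
     (\<forall>S. I \<subseteq> S \<longrightarrow> (\<forall>e\<in>E. \<forall>t\<in>S. 2 * e - t \<in> S) \<longrightarrow> S = UNIV)"

text \<open>The last clause of \<open>unfolds\<close> applied to \<open>Collect P\<close>: the
  reflections carry \<open>I\<close> over the whole line.\<close>

lemma unfolds_induct:
  assumes "unfolds I E q u" "\<And>t. t \<in> I \<Longrightarrow> P t" "\<And>e t. e \<in> E \<Longrightarrow> P t \<Longrightarrow> P (2 * e - t)"
  shows "P t"
proof -
  have "Collect P = UNIV"
    using assms unfolding unfolds_def by (metis (mono_tags) mem_Collect_eq subsetI)
  then show ?thesis by auto
qed

lemma has_vector_derivative_reflect:
  assumes "(f has_vector_derivative d) (at (k - t))"
  shows "((\<lambda>s. f (k - s)) has_vector_derivative - d) (at t)"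
proof -
  have "((\<lambda>s. k - s) has_vector_derivative - 1) (at t)"
    by (auto intro!: derivative_eq_intros)
  from vector_diff_chain_at[OF this, of f d] assms show ?thesis by (simp add: o_def)
qed

text \<open>Equation and energy identity hold inside \<open>I\<close> and are invariant under
  reflections. At a reflection point the energy identity forces the speed to tend to 0, so an even
  reflection creates no corner. The argument runs twice, first for the derivative of
  \<open>u\<close> and then for that of the velocity, which must be defined on the whole line before
  it can be differentiated.\<close>

lemma unfolded_solution:
  fixes q u :: "real \<Rightarrow> 'a::euclidean_space" and V :: "'a \<Rightarrow> real"
  assumes un: "unfolds I E q u" and cq: "continuous_on UNIV q"
    and V: "continuous_on UNIV V" and cgrad: "continuous_on UNIV gradV"
    and loc: "\<And>t. t \<in> interior I \<Longrightarrow> \<exists>r>0. \<exists>p. \<forall>s\<in>ball t r. (q has_vector_derivative p s) (at s) \<and>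
        (p has_vector_derivative gradV (q s)) (at s) \<and> (norm (p s))\<^sup>2 / 2 = V (q s) - c"
    and E: "\<And>e. e \<in> E \<Longrightarrow> V (q e) = c"
  obtains v where "\<And>t. (u has_vector_derivative v t) (at t)"
    "\<And>t. (v has_vector_derivative gradV (u t)) (at t)"
    "\<And>t. (norm (v t))\<^sup>2 / 2 = V (u t) - c"
proof -
  have uq: "u t = q t" if "t \<in> I" for t using un that by (simp add: unfolds_def)
  have refl: "u (2 * e - t) = u t" if "e \<in> E" for e t using un that by (simp add: unfolds_def)
  have EI: "e \<in> I" if "e \<in> E" for e using un that by (simp add: unfolds_def)
  have near: "\<exists>r>0. \<forall>s. 0 < \<bar>s - e\<bar> \<longrightarrow> \<bar>s - e\<bar> < r \<longrightarrow> s \<in> interior I \<or> 2 * e - s \<in> interior I" if "e \<in> E" for e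
    using un that by (simp add: unfolds_def)
  have split: "t \<in> interior I \<or> t \<in> E" if "t \<in> I" for t using un that by (auto simp: unfolds_def)
  have locu: "\<exists>r>0. \<exists>p. \<forall>s\<in>ball t r. (u has_vector_derivative p s) (at s) \<and>
        (p has_vector_derivative gradV (u s)) (at s) \<and> (norm (p s))\<^sup>2 / 2 = V (u s) - c" if t: "t \<in> interior I" for t
  proof -
    obtain r p where rp: "r > 0" "\<And>s. s \<in> ball t r \<Longrightarrow> (q has_vector_derivative p s) (at s) \<and>
        (p has_vector_derivative gradV (q s)) (at s) \<and> (norm (p s))\<^sup>2 / 2 = V (q s) - c"
      using loc[OF t] by blast
    obtain r' where r': "r' > 0" "ball t r' \<subseteq> I" using t mem_interior by blast
    show ?thesis
    proof (intro exI[of _ "min r r'"] exI[of _ p] conjI ballI)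
      show "min r r' > 0" using rp r' by simp
      fix s assume s: "s \<in> ball t (min r r')"
      have sub: "y \<in> I" if "y \<in> ball t (min r r')" for y using that r'(2) by (auto simp: subset_iff)
      have sI: "s \<in> I" and sr: "s \<in> ball t r" using s sub by auto
      show "(u has_vector_derivative p s) (at s)"
        by (rule has_vector_derivative_transform_within_open[of q _ _ "ball t (min r r')"])
          (use rp(2)[OF sr] s uq sub in \<open>auto simp del: mem_ball\<close>)
      show "(p has_vector_derivative gradV (u s)) (at s)" "(norm (p s))\<^sup>2 / 2 = V (u s) - c"
        using rp(2)[OF sr] uq[OF sI] by auto
    qed
  qed
  have cu: "isCont u e" if e: "e \<in> E" for e
    unfolding continuous_at_eps_delta
  proof (intro allI impI)
    fix \<eta> :: real assume "\<eta> > 0"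
    have "isCont q e" using cq by (simp add: continuous_on_eq_continuous_at)
    then obtain d where d: "d > 0" "\<And>s. dist s e < d \<Longrightarrow> dist (q s) (q e) < \<eta>"
      unfolding continuous_at_eps_delta using \<open>\<eta> > 0\<close> by blast
    obtain r where r: "r > 0" "\<And>s. 0 < \<bar>s - e\<bar> \<Longrightarrow> \<bar>s - e\<bar> < r \<Longrightarrow> s \<in> interior I \<or> 2 * e - s \<in> interior I"
      using near[OF e] by blast
    show "\<exists>d>0. \<forall>s. dist s e < d \<longrightarrow> dist (u s) (u e) < \<eta>"
    proof (intro exI[of _ "min d r"] conjI allI impI)
      show "min d r > 0" using d r by simp
      fix s assume s: "dist s e < min d r"
      show "dist (u s) (u e) < \<eta>"
      proof (cases "s = e")
        case False
        then consider "s \<in> I" | "2 * e - s \<in> I" using r(2)[of s] s interior_subset by (auto simp: dist_real_def)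
        then show ?thesis
        proof cases
          case 1
          then show ?thesis using d(2)[of s] s uq EI[OF e] by simp
        next
          case 2
          then have "u s = q (2 * e - s)" using uq refl[OF e, of s] by metis
          then show ?thesis using d(2)[of "2 * e - s"] s uq EI[OF e] by (simp add: dist_real_def abs_minus_commute)
        qed
      qed (use \<open>\<eta> > 0\<close> in simp)
    qed
  qed
  have S1r: "\<exists>p. (u has_vector_derivative p) (at (2 * e - t)) \<and> (norm p)\<^sup>2 / 2 = V (u (2 * e - t)) - c"
    if e: "e \<in> E" and ex: "\<exists>p. (u has_vector_derivative p) (at t) \<and> (norm p)\<^sup>2 / 2 = V (u t) - c" for e t
  proof -
    obtain p where p: "(u has_vector_derivative p) (at t)" "(norm p)\<^sup>2 / 2 = V (u t) - c" using ex by blast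
    have "((\<lambda>s. u (2 * e - s)) has_vector_derivative - p) (at (2 * e - t))"
      by (rule has_vector_derivative_reflect) (use p in simp)
    then show ?thesis using p refl[OF e] by (intro exI[of _ "- p"]) (simp add: refl[OF e])
  qed
  have S1i: "\<exists>p. (u has_vector_derivative p) (at t) \<and> (norm p)\<^sup>2 / 2 = V (u t) - c" if "t \<in> interior I" for t
    using locu[OF that] centre_in_ball by blast
  \<comment> \<open>Near \<open>e\<close> the speed equals \<open>sqrt (2 * (V (u s) - c))\<close>,
    which is continuous with value 0 at \<open>e\<close>.\<close>
  have vlim: "(v \<longlongrightarrow> 0) (at e)" if e: "e \<in> E" and "r > 0" and
     r: "\<And>s. 0 < \<bar>s - e\<bar> \<Longrightarrow> \<bar>s - e\<bar> < r \<Longrightarrow> (norm (v s))\<^sup>2 / 2 = V (u s) - c" for e r v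
  proof -
    have "isCont (\<lambda>s. V (u s)) e"
      by (rule isCont_o2[OF cu[OF e]]) (use V in \<open>simp add: continuous_on_eq_continuous_at\<close>)
    then have "((\<lambda>s. V (u s)) \<longlongrightarrow> c) (at e)" using E[OF e] uq[OF EI[OF e]] by (simp add: isCont_def)
    then have "((\<lambda>s. sqrt (2 * (V (u s) - c))) \<longlongrightarrow> sqrt (2 * (c - c))) (at e)" by (intro tendsto_intros)
    then have "((\<lambda>s. sqrt (2 * (V (u s) - c))) \<longlongrightarrow> 0) (at e)" by simp
    then have "((\<lambda>s. norm (v s)) \<longlongrightarrow> 0) (at e)"
    proof (rule Lim_transform_eventually)
      show "\<forall>\<^sub>F s in at e. sqrt (2 * (V (u s) - c)) = norm (v s)"
        unfolding eventually_at
      proof (intro exI[of _ r] conjI ballI impI)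
        fix s assume "s \<noteq> e \<and> dist s e < r"
        then have "2 * (V (u s) - c) = (norm (v s))\<^sup>2" using r[of s] by (simp add: dist_real_def)
        then show "sqrt (2 * (V (u s) - c)) = norm (v s)" by simp
      qed fact
    qed
    then show ?thesis by (rule tendsto_norm_zero_cancel)
  qed
  have all1: "\<exists>p. (u has_vector_derivative p) (at t) \<and> (norm p)\<^sup>2 / 2 = V (u t) - c" for t
  proof (rule unfolds_induct[OF un, where P = "\<lambda>t. \<exists>p. (u has_vector_derivative p) (at t) \<and> (norm p)\<^sup>2 / 2 = V (u t) - c"])
    fix t assume tI: "t \<in> I"
    show "\<exists>p. (u has_vector_derivative p) (at t) \<and> (norm p)\<^sup>2 / 2 = V (u t) - c"
    proof (cases "t \<in> interior I")
      case True then show ?thesis by (rule S1i)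
    next
      case False
      then have e: "t \<in> E" using split[OF tI] by simp
      obtain r where r: "r > 0" "\<And>s. 0 < \<bar>s - t\<bar> \<Longrightarrow> \<bar>s - t\<bar> < r \<Longrightarrow> s \<in> interior I \<or> 2 * t - s \<in> interior I"
        using near[OF e] by blast
      have "\<exists>p. (u has_vector_derivative p) (at s) \<and> (norm p)\<^sup>2 / 2 = V (u s) - c" if "0 < \<bar>s - t\<bar>" "\<bar>s - t\<bar> < r" for s
        using r(2)[OF that] S1i[of s] S1r[OF e S1i, of "2 * t - s"] by auto
      then obtain v where v: "\<And>s. 0 < \<bar>s - t\<bar> \<Longrightarrow> \<bar>s - t\<bar> < r \<Longrightarrow> (u has_vector_derivative v s) (at s) \<and> (norm (v s))\<^sup>2 / 2 = V (u s) - c"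
        by metis
      have "(u has_vector_derivative 0) (at t)"
        by (rule has_vector_derivative_punctured_limit[OF cu[OF e] r(1), of v])
          (use v vlim[OF e r(1), of v] in auto)
      then show ?thesis using E[OF e] uq[OF tI] by (intro exI[of _ 0]) simp
    qed
  qed (rule S1r; assumption)
  \<comment> \<open>Now \<open>u\<close> has a derivative everywhere; uniqueness of derivatives
    makes it odd under each reflection and equal to the local velocities.\<close>
  define v where "v = (\<lambda>t. vector_derivative u (at t))"
  have v: "(u has_vector_derivative v t) (at t)" "(norm (v t))\<^sup>2 / 2 = V (u t) - c" for t
    using all1[of t] vector_derivative_at unfolding v_def by metis+
  have v_refl: "v (2 * e - t) = - v t" if "e \<in> E" for e t
  proof -
    have "((\<lambda>s. u (2 * e - s)) has_vector_derivative - v t) (at (2 * e - t))"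
      by (rule has_vector_derivative_reflect) (use v in simp)
    then show ?thesis using v(1)[of "2 * e - t"] vector_derivative_unique_at by (simp add: refl[OF that])
  qed
  have S2r: "(v has_vector_derivative gradV (u (2 * e - t))) (at (2 * e - t))"
    if e: "e \<in> E" and "(v has_vector_derivative gradV (u t)) (at t)" for e t
  proof -
    have "((\<lambda>s. v (2 * e - s)) has_vector_derivative - gradV (u t)) (at (2 * e - t))"
      by (rule has_vector_derivative_reflect) (use that in simp)
    then have "((\<lambda>s. - v s) has_vector_derivative - gradV (u t)) (at (2 * e - t))" by (simp add: v_refl[OF e])
    from has_vector_derivative_minus[OF this] show ?thesis by (simp add: refl[OF e])
  qed
  have S2i: "(v has_vector_derivative gradV (u t)) (at t)" if tI: "t \<in> interior I" for t
  proof -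
    obtain r p where rp: "r > 0" "\<And>s. s \<in> ball t r \<Longrightarrow> (u has_vector_derivative p s) (at s)"
      "(p has_vector_derivative gradV (u t)) (at t)"
    proof -
      obtain r p where rp: "r > 0" "\<forall>s\<in>ball t r. (u has_vector_derivative p s) (at s) \<and>
        (p has_vector_derivative gradV (u s)) (at s) \<and> (norm (p s))\<^sup>2 / 2 = V (u s) - c"
        using locu[OF tI] by blast
      moreover have "t \<in> ball t r" using rp(1) by simp
      ultimately show thesis by (intro that[of r p]) blast+
    qed
    have "p s = v s" if "s \<in> ball t r" for s using rp(2)[OF that] v(1) vector_derivative_unique_at by blast
    then show ?thesis
      using has_vector_derivative_transform_within_open[OF rp(3), of "ball t r" v] rp(1) by auto
  qed
  have "(v has_vector_derivative gradV (u t)) (at t)" for t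
  proof (rule unfolds_induct[OF un, where P = "\<lambda>t. (v has_vector_derivative gradV (u t)) (at t)"])
    fix t assume tI: "t \<in> I"
    show "(v has_vector_derivative gradV (u t)) (at t)"
    proof (cases "t \<in> interior I")
      case True then show ?thesis by (rule S2i)
    next
      case False
      then have e: "t \<in> E" using split[OF tI] by simp
      obtain r where r: "r > 0" "\<And>s. 0 < \<bar>s - t\<bar> \<Longrightarrow> \<bar>s - t\<bar> < r \<Longrightarrow> s \<in> interior I \<or> 2 * t - s \<in> interior I"
        using near[OF e] by blast
      have v0: "v t = 0" using v(2)[of t] E[OF e] uq[OF tI] by simp
      have cv: "isCont v t" unfolding isCont_def v0 by (rule vlim[OF e r(1)]) (rule v)
      have "isCont (\<lambda>s. gradV (u s)) t"
        by (rule isCont_o2[OF cu[OF e]]) (use cgrad in \<open>simp add: continuous_on_eq_continuous_at\<close>)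
      then have lim: "((\<lambda>s. gradV (u s)) \<longlongrightarrow> gradV (u t)) (at t)" by (simp add: isCont_def)
      show ?thesis
      proof (rule has_vector_derivative_punctured_limit[OF cv r(1) _ lim])
        fix s assume "0 < \<bar>s - t\<bar>" "\<bar>s - t\<bar> < r"
        from r(2)[OF this] show "(v has_vector_derivative gradV (u s)) (at s)"
          using S2i[of s] S2r[OF e S2i, of "2 * t - s"] by auto
      qed
    qed
  qed (rule S2r; assumption)
  then show ?thesis using that v by blast
qed

lemma unfolds_UNIV: "unfolds UNIV {} q q"
  by (auto simp: unfolds_def)

lemma unfolds_atMost:
  assumes "\<And>t. t \<le> w \<Longrightarrow> u t = q t" "\<And>t. u (2 * w - t) = u t"
  shows "unfolds {..w} {w} q u"
  unfolding unfolds_def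
proof (intro conjI ballI allI impI)
  fix S assume S: "{..w} \<subseteq> S" "\<forall>e\<in>{w}. \<forall>t\<in>S. 2 * e - t \<in> S"
  have "t \<in> S" for t
  proof (cases "t \<le> w")
    case False
    then have "2 * w - t \<in> S" using S(1) by auto
    then have "2 * w - (2 * w - t) \<in> S" using S(2) by blast
    then show ?thesis by simp
  qed (use S in auto)
  then show "S = UNIV" by auto
qed (use assms in \<open>auto intro!: exI[of _ 1]\<close>)

lemma unfolds_atLeast:
  assumes "\<And>t. a \<le> t \<Longrightarrow> u t = q t" "\<And>t. u (2 * a - t) = u t"
  shows "unfolds {a..} {a} q u"
  unfolding unfolds_def
proof (intro conjI ballI allI impI)
  fix S assume S: "{a..} \<subseteq> S" "\<forall>e\<in>{a}. \<forall>t\<in>S. 2 * e - t \<in> S"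
  have "t \<in> S" for t
  proof (cases "t \<ge> a")
    case False
    then have "2 * a - t \<in> S" using S(1) by auto
    then have "2 * a - (2 * a - t) \<in> S" using S(2) by blast
    then show ?thesis by simp
  qed (use S in auto)
  then show "S = UNIV" by auto
qed (use assms in \<open>auto intro!: exI[of _ 1]\<close>)

text \<open>The reflections about \<open>a\<close> and \<open>w\<close> compose to the translations
  by \<open>2 * (w - a)\<close> in both directions, so a set closed under both reflections is
  invariant under these translations.\<close>

lemma unfolds_atLeastAtMost:
  assumes "a < w" "\<And>t. t \<in> {a..w} \<Longrightarrow> u t = q t" "\<And>t. u (2 * w - t) = u t"
    and per: "\<And>t. u (t + 2 * (w - a)) = u t"
  shows "unfolds {a..w} {a, w} q u"
  unfolding unfolds_def
proof (intro conjI ballI allI impI)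
  fix S assume S: "{a..w} \<subseteq> S" "\<forall>e\<in>{a, w}. \<forall>t\<in>S. 2 * e - t \<in> S"
  define L where "L = 2 * (w - a)"
  have L: "L > 0" using assms(1) by (simp add: L_def)
  have S2: "2 * a - t \<in> S" "2 * w - t \<in> S" if "t \<in> S" for t using S(2) that by auto
  have up: "t + L \<in> S" if "t \<in> S" for t using S2(2)[OF S2(1)[OF that]] by (simp add: L_def algebra_simps)
  have down: "t - L \<in> S" if "t \<in> S" for t using S2(1)[OF S2(2)[OF that]] by (simp add: L_def algebra_simps)
  have upn: "t + real n * L \<in> S" if "t \<in> S" for t n
  proof (induction n)
    case (Suc n)
    have eq: "t + real (Suc n) * L = (t + real n * L) + L" by (simp add: distrib_right)
    show ?case unfolding eq by (rule up[OF Suc])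
  qed (use that in simp)
  have downn: "t - real n * L \<in> S" if "t \<in> S" for t n
  proof (induction n)
    case (Suc n)
    have eq: "t - real (Suc n) * L = (t - real n * L) - L" by (simp add: distrib_right)
    show ?case unfolding eq by (rule down[OF Suc])
  qed (use that in simp)
  \<comment> \<open>This interval has length \<open>L\<close> and is a fundamental domain for the
    translations; any other time is reduced to it with the floor function.\<close>
  have base: "t \<in> S" if "2 * a - w \<le> t" "t \<le> w" for t
  proof (cases "t \<ge> a")
    case False
    then have "2 * a - t \<in> S" using S(1) that by auto
    from S2(1)[OF this] show ?thesis by simp
  qed (use S(1) that in auto)
  have "t \<in> S" for t
  proof -
    define k where "k = \<lfloor>(t - (2 * a - w)) / L\<rfloor>"
    define t0 where "t0 = t - of_int k * L"
    have "of_int k \<le> (t - (2 * a - w)) / L" "(t - (2 * a - w)) / L < of_int k + 1"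
      unfolding k_def by (rule of_int_floor_le, rule real_of_int_floor_add_one_gt)
    then have k: "of_int k * L \<le> t - (2 * a - w)" "t - (2 * a - w) < (of_int k + 1) * L"
      by (simp_all only: pos_le_divide_eq[OF L] pos_divide_less_eq[OF L])
    have "t - (2 * a - w) < of_int k * L + L" using k(2) by (simp add: distrib_right)
    then have "t0 - (2 * a - w) < L" by (simp add: t0_def)
    then have "t0 \<le> w" by (simp add: L_def)
    moreover have "2 * a - w \<le> t0" using k(1) by (simp add: t0_def)
    ultimately have "t0 \<in> S" by (intro base)
    note t0 = this
    show ?thesis
    proof (cases "k \<ge> 0")
      case True
      then have eq: "t = t0 + real (nat k) * L" by (simp add: t0_def)
      show ?thesis unfolding eq by (rule upn[OF t0])
    next
      case False
      then have eq: "t = t0 - real (nat (- k)) * L" by (simp add: t0_def)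
      show ?thesis unfolding eq by (rule downn[OF t0])
    qed
  qed
  then show "S = UNIV" by auto
next
  fix e assume e: "e \<in> {a, w}"
  show "e \<in> {a..w}" using e assms(1) by auto
  fix t
  \<comment> \<open>Symmetry about \<open>a\<close> is not among the given laws; it is the symmetry
    about \<open>w\<close> shifted by one period.\<close>
  have "u (2 * a - t) = u (2 * a - t + 2 * (w - a))" using per by metis
  also have "\<dots> = u (2 * w - t)" by (simp add: algebra_simps)
  finally show "u (2 * e - t) = u t" using e assms(3) by auto
next
  fix e assume e: "e \<in> {a, w}"
  show "\<exists>r>0. \<forall>s. 0 < \<bar>s - e\<bar> \<longrightarrow> \<bar>s - e\<bar> < r \<longrightarrow> s \<in> interior {a..w} \<or> 2 * e - s \<in> interior {a..w}"
    using assms(1) e by (intro exI[of _ "w - a"]) auto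
qed (use assms in auto)

section \<open>Uniform estimates\<close>

locale double_well =
  fixes V :: "'a::euclidean_space \<Rightarrow> real" and gradV :: "'a \<Rightarrow> 'a" and am ap :: 'a
    and nu0 :: ereal and cdw :: real and Vm Vp :: "real \<Rightarrow> 'a set"
  assumes grad: "\<And>x. GDERIV V x :> gradV x"
    and gradV_cont: "continuous_on UNIV gradV" and gradV_lip: "locally_lipschitz gradV"
    and V_am: "V am = 0" and V_ap: "V ap = 0" and V_pos: "\<And>x. x \<notin> {am, ap} \<Longrightarrow> V x > 0"
    and V_inf: "Liminf at_infinity (\<lambda>x. ereal (V x)) = nu0"
    and dec: "double_well_decomposition V am ap nu0 cdw Vm Vp"
begin

abbreviation minimizer :: "real \<Rightarrow> (real \<Rightarrow> 'a) \<Rightarrow> (real \<Rightarrow> 'a) \<Rightarrow> bool" where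
  "minimizer c q g \<equiv> 0 < c \<and> c < cdw \<and> minimal V c (Vm c) (Vp c) q g"

lemma V_cont: "continuous_on S V"
  by (rule GDERIV_continuous_on[OF grad])

lemma decomposition:
  assumes "0 \<le> c" "c < cdw"
  shows "sublevel V c = Vm c \<union> Vp c \<and> Vm c \<inter> Vp c = {} \<and> compact (Vm c) \<and> compact (Vp c) \<and>
    am \<in> Vm c \<and> Vm c \<subseteq> ball am (dist am ap / 4) \<and> ap \<in> Vp c \<and> Vp c \<subseteq> ball ap (dist am ap / 4)"
  by (rule dec[unfolded double_well_decomposition_def, THEN conjunct2, THEN conjunct2, THEN spec, THEN mp])
    (use assms in simp)

lemma wells:
  assumes "0 < c" "c < cdw"
  shows "V x \<le> c \<longleftrightarrow> x \<in> Vm c \<or> x \<in> Vp c" "Vm c \<inter> Vp c = {}" "compact (Vm c)" "compact (Vp c)"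
    "am \<in> Vm c" "ap \<in> Vp c"
    "x \<in> Vm c \<Longrightarrow> dist x am < dist am ap / 4" "x \<in> Vp c \<Longrightarrow> dist x ap < dist am ap / 4"
proof -
  note * = decomposition[OF less_imp_le[OF assms(1)] assms(2)]
  note ** = *[THEN conjunct2, THEN conjunct2]
  show "Vm c \<inter> Vp c = {}" by (rule *[THEN conjunct2, THEN conjunct1])
  show "compact (Vm c)" "compact (Vp c)" "am \<in> Vm c"
    by (rule **[THEN conjunct1], rule **[THEN conjunct2, THEN conjunct1],
      rule **[THEN conjunct2, THEN conjunct2, THEN conjunct1])
  have ***: "Vm c \<subseteq> ball am (dist am ap / 4)" "ap \<in> Vp c" "Vp c \<subseteq> ball ap (dist am ap / 4)"
    by (simp_all only: **)
  then show "ap \<in> Vp c" by simp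
  have "V x \<le> c \<longleftrightarrow> x \<in> sublevel V c" by (simp add: sublevel_def)
  then show "V x \<le> c \<longleftrightarrow> x \<in> Vm c \<or> x \<in> Vp c" unfolding *[THEN conjunct1] by simp
  show "x \<in> Vm c \<Longrightarrow> dist x am < dist am ap / 4" "x \<in> Vp c \<Longrightarrow> dist x ap < dist am ap / 4"
    using subsetD[OF ***(1)] subsetD[OF ***(3)] by (simp_all add: dist_commute[of x])
qed

lemma V_gt_off_wells: "0 < c \<Longrightarrow> c < cdw \<Longrightarrow> x \<notin> Vm c \<Longrightarrow> x \<notin> Vp c \<Longrightarrow> c < V x"
  using wells(1)[of c x] by (simp add: not_le[symmetric])

lemma minimizer_V: "minimizer c q g \<Longrightarrow> c \<le> V (q t)"
proof -
  assume "minimizer c q g"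
  then have "q \<in> Gamma V c (Vm c) (Vp c)" unfolding minimal_def by blast
  then show "c \<le> V (q t)" unfolding Gamma_iff by blast
qed

lemma dist_segment_le: fixes x z a :: "'b::real_normed_vector" shows "z \<in> closed_segment x a \<Longrightarrow> dist z a \<le> dist x a"
  using segment_bound(2)[of z x a] norm_minus_commute[of x a] unfolding dist_norm by linarith

lemma am_neq_ap: "am \<noteq> ap"
proof -
  have "cdw > 0" using dec by (simp add: double_well_decomposition_def)
  then have "0 < cdw / 2" "cdw / 2 < cdw" by auto
  note w = wells(2)[OF this] wells(5)[OF this] wells(6)[OF this]
  show ?thesis
  proof
    assume "am = ap"
    then have "am \<in> Vm (cdw / 2) \<inter> Vp (cdw / 2)" using w(2,3) by simp
    then show False unfolding w(1) by simp
  qed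
qed

text \<open>The component around \<open>am\<close> has radius less than a quarter of
  \<open>dist am ap\<close>. The segment stays within three quarters of that distance from
  \<open>ap\<close>, so it cannot meet the wrong component and must stop in
  \<open>Vp c\<close>.\<close>

lemma ray_to_ap:
  assumes c: "0 < c" "c < cdw" and x: "c \<le> V x" "dist x ap < 3 / 4 * dist am ap"
    and B: "\<And>z. z \<in> closed_segment x ap \<Longrightarrow> V z \<le> B"
  obtains l l' where "has_L2_deriv l l'" "l 0 = x" "\<And>t. 0 \<le> t \<Longrightarrow> c \<le> V (l t)" "\<And>t. 1 \<le> t \<Longrightarrow> l t \<in> Vp c"
    "action_on {0..} V c l l' \<le> ennreal ((dist x ap)\<^sup>2 / 2 + B)"
proof -
  have K: "z \<in> Vp c" if z: "z \<in> closed_segment x ap" "V z \<le> c" for z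
  proof -
    have "z \<notin> Vm c"
    proof
      assume "z \<in> Vm c"
      then have "dist z am < dist am ap / 4" by (rule wells(7)[OF c])
      then show False using dist_segment_le[OF z(1)] x(2) dist_triangle2[of am ap z] by (simp add: dist_commute)
    qed
    then show "z \<in> Vp c" using wells(1)[OF c] z by blast
  qed
  have "0 \<le> c" "V ap \<le> c" using c V_ap by auto
  then show ?thesis by (rule ray_to_well[OF V_cont _ _ x(1) K B]) (assumption | (rule that; assumption))+
qed

text \<open>The hypotheses are symmetric in the wells, so \<open>ray_to_am\<close> and
  \<open>near_ap\<close> follow from their counterparts by exchanging the wells.\<close>

lemma mirror: "double_well V gradV ap am nu0 cdw Vp Vm"
proof
  show "x \<notin> {ap, am} \<Longrightarrow> 0 < V x" for x using V_pos[of x] by blast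
  have "sublevel V c = Vp c \<union> Vm c \<and> Vp c \<inter> Vm c = {} \<and> compact (Vp c) \<and> compact (Vm c) \<and>
      ap \<in> Vp c \<and> Vp c \<subseteq> ball ap (dist ap am / 4) \<and> am \<in> Vm c \<and> Vm c \<subseteq> ball am (dist ap am / 4)"
    if "0 \<le> c \<and> c < cdw" for c
    using decomposition[of c] that unfolding Un_commute[of "Vp c"] Int_commute[of "Vp c"] dist_commute[of ap am]
    by satx
  moreover have "0 < cdw" "ereal cdw < nu0" using dec by (auto simp: double_well_decomposition_def)
  ultimately show "double_well_decomposition V ap am nu0 cdw Vp Vm"
    unfolding double_well_decomposition_def by blast
qed (fact grad gradV_cont gradV_lip V_am V_ap V_inf)+

lemma ray_to_am:
  assumes c: "0 < c" "c < cdw" and x: "c \<le> V x" "dist x am < 3 / 4 * dist am ap"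
    and B: "\<And>z. z \<in> closed_segment x am \<Longrightarrow> V z \<le> B"
  obtains l l' where "has_L2_deriv l l'" "l 0 = x" "\<And>t. 0 \<le> t \<Longrightarrow> c \<le> V (l t)" "\<And>t. 1 \<le> t \<Longrightarrow> l t \<in> Vm c"
    "action_on {0..} V c l l' \<le> ennreal ((dist x am)\<^sup>2 / 2 + B)"
proof -
  have "dist x am < 3 / 4 * dist ap am" using x(2) by (simp add: dist_commute[of ap])
  then show ?thesis
    by (rule double_well.ray_to_ap[OF mirror c x(1) _ B]) (assumption | (rule that; assumption))+
qed

lemma action_bound:
  "\<exists>C\<ge>0. \<forall>c q g. minimizer c q g \<longrightarrow> action V c q \<le> ennreal C"
proof -
  \<comment> \<open>The midpoint lies at half the distance of the wells from each of them: outside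
    both components, so that its potential exceeds \<open>c\<close>, and inside the radius within
    which rays are available. Neither it nor the bound \<open>B\<close> along the segments depends
    on \<open>c\<close>.\<close>
  define x where "x = midpoint am ap"
  have d: "dist x am = dist am ap / 2" "dist x ap = dist am ap / 2"
    by (simp_all add: x_def dist_midpoint)
  note ne = am_neq_ap
  have "compact (V ` (closed_segment x am \<union> closed_segment x ap))"
    by (intro compact_continuous_image V_cont compact_Un compact_segment)
  then obtain B where B: "B > 0" "\<And>z. z \<in> closed_segment x am \<union> closed_segment x ap \<Longrightarrow> V z \<le> B"
  proof -
    assume K: "compact (V ` (closed_segment x am \<union> closed_segment x ap))"
    obtain B where B: "B > 0" "\<forall>y\<in>V ` (closed_segment x am \<union> closed_segment x ap). norm y \<le> B"
      using compact_imp_bounded[OF K] unfolding bounded_pos by blast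
    have "V z \<le> B" if "z \<in> closed_segment x am \<union> closed_segment x ap" for z
    proof -
      have "norm (V z) \<le> B" using B(2) that by blast
      then show ?thesis by simp
    qed
    then show thesis using that[of B] B(1) by blast
  qed
  define C where "C = (dist am ap / 2)\<^sup>2 / 2 + B"
  have C0: "0 \<le> C" using B by (simp add: C_def)
  show ?thesis
  proof (intro exI[of _ "C + C"] conjI allI impI)
    fix c q g assume m: "minimizer c q g"
    then have c: "0 < c" "c < cdw" by auto
    have Vx: "c \<le> V x"
      using V_gt_off_wells[OF c, of x] wells(7,8)[OF c, of x] d by force
    obtain l l' where l: "has_L2_deriv l l'" "l 0 = x" "\<And>t. 0 \<le> t \<Longrightarrow> c \<le> V (l t)" "\<And>t. 1 \<le> t \<Longrightarrow> l t \<in> Vm c"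
      "action_on {0..} V c l l' \<le> ennreal ((dist x am)\<^sup>2 / 2 + B)"
      using ray_to_am[OF c Vx, of B] d B ne by auto
    obtain r r' where r: "has_L2_deriv r r'" "r 0 = x" "\<And>t. 0 \<le> t \<Longrightarrow> c \<le> V (r t)" "\<And>t. 1 \<le> t \<Longrightarrow> r t \<in> Vp c"
      "action_on {0..} V c r r' \<le> ennreal ((dist x ap)\<^sup>2 / 2 + B)"
      using ray_to_ap[OF c Vx, of B] d B ne by auto
    have inf: "\<exists>t\<ge>T. infdist (r t) (Vp c) < e" if "e > 0" for e T
      using r(4)[of "max 1 T"] that by (intro exI[of _ "max 1 T"]) auto
    have l0: "l 0 = r 0" using l r by simp
    note comp = join_left_competitor[OF V_cont r(1), of 0 c "Vp c" l l' "Vm c", OF r(3) inf l(1) l0 l(3,4)]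
    have "action V c q \<le> action V c (\<lambda>t. if t \<le> 0 then l (0 - t) else r t)"
      using m comp(1) by (simp add: minimal_def)
    also have "\<dots> = action_on {0..} V c l l' + action_on {0<..} V c r r'"
      by (rule comp(2))
    also have "\<dots> \<le> action_on {0..} V c l l' + action_on {0..} V c r r'"
      by (intro add_left_mono nn_integral_mono) (auto simp: indicator_def)
    also have "\<dots> \<le> ennreal C + ennreal C"
      using add_mono[OF l(5) r(5)] unfolding d C_def .
    also have "\<dots> = ennreal (C + C)" using C0 by (simp add: ennreal_plus[symmetric] del: ennreal_plus)
    finally show "action V c q \<le> ennreal (C + C)" .
  qed (use C0 in simp)
qed

text \<open>A path close to a well could end with a short ray, so the actual tail of a minimizer is
  no more expensive. It is essential that \<open>\<delta>\<close> serves all levels \<open>c\<close>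
  at once.\<close>

lemma tail_small:
  assumes "\<eta> > 0"
  obtains \<delta> where "\<delta> > 0"
    "\<And>c q g s. minimizer c q g \<Longrightarrow> dist (q s) ap < \<delta> \<Longrightarrow> action_on {s<..} V c q g \<le> ennreal \<eta>"
    "\<And>c q g s. minimizer c q g \<Longrightarrow> dist (q s) am < \<delta> \<Longrightarrow> action_on {..s} V c q g \<le> ennreal \<eta>"
proof -
  obtain C where C: "0 \<le> C" "\<And>c q g. minimizer c q g \<Longrightarrow> action V c q \<le> ennreal C" using action_bound by blast
  have fin: "action V c q < \<infinity>" if "minimizer c q g" for c q g using C(2)[OF that] by (simp add: le_less_trans)
  have near: "\<exists>d>0. \<forall>z. dist z a < d \<longrightarrow> V z \<le> \<eta> / 2" if "V a = 0" for a
  proof -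
    have "isCont V a" using V_cont[of UNIV] by (simp add: continuous_on_eq_continuous_at)
    then obtain d where "d > 0" "\<And>z. dist z a < d \<Longrightarrow> dist (V z) (V a) < \<eta> / 2"
      unfolding continuous_at_eps_delta using assms by (metis half_gt_zero)
    then show ?thesis using that by (intro exI[of _ d]) (force simp: dist_real_def)
  qed
  obtain dp where dp: "dp > 0" "\<And>z. dist z ap < dp \<Longrightarrow> V z \<le> \<eta> / 2" using near[OF V_ap] by blast
  obtain dm where dm: "dm > 0" "\<And>z. dist z am < dm \<Longrightarrow> V z \<le> \<eta> / 2" using near[OF V_am] by blast
  note ne = am_neq_ap
  \<comment> \<open>\<open>dp\<close> and \<open>dm\<close> keep \<open>V\<close> below
    \<open>\<eta> / 2\<close> along the ray, the third entry makes the ray lemmas applicable, and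
    the last two give \<open>\<delta> * \<delta> \<le> \<eta>\<close>, so that the kinetic part is
    at most \<open>\<eta> / 2\<close> too.\<close>
  define \<delta> where "\<delta> = Min {dp, dm, 3 / 4 * dist am ap, 1, \<eta>}"
  have de: "\<delta> \<le> dp" "\<delta> \<le> dm" "\<delta> \<le> 3 / 4 * dist am ap" "\<delta> \<le> 1" "\<delta> \<le> \<eta>" by (simp_all add: \<delta>_def)
  have sq: "x\<^sup>2 / 2 + \<eta> / 2 \<le> \<eta>" if "0 \<le> x" "x < \<delta>" for x
  proof -
    have "x * x \<le> 1 * \<eta>" using that de by (intro mult_mono) auto
    then show ?thesis by (simp add: power2_eq_square)
  qed
  show ?thesis
  proof (rule that[of \<delta>])
    show "\<delta> > 0" using dp dm ne assms by (simp add: \<delta>_def)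
    fix c q g s
    assume m: "minimizer c q g" and near: "dist (q s) ap < \<delta>"
    have B: "V z \<le> \<eta> / 2" if "z \<in> closed_segment (q s) ap" for z
      using dp(2)[of z] dist_segment_le[OF that] near de by simp
    obtain r r' where r: "has_L2_deriv r r'" "r 0 = q s" "\<And>t. 0 \<le> t \<Longrightarrow> c \<le> V (r t)" "\<And>t. 1 \<le> t \<Longrightarrow> r t \<in> Vp c"
      "action_on {0..} V c r r' \<le> ennreal ((dist (q s) ap)\<^sup>2 / 2 + \<eta> / 2)"
      by (rule ray_to_ap[of c "q s" "\<eta> / 2"]) (use m minimizer_V[OF m, of s] near de B in auto)
    have "action_on {s<..} V c q g \<le> action_on {0..} V c r r'"
      by (rule minimal_right_tail[OF V_cont _ fin[OF m] r(1-4)]) (use m in auto)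
    also have "\<dots> \<le> ennreal \<eta>" using r(5) sq[OF _ near] by (auto elim!: order_trans intro!: ennreal_leI)
    finally show "action_on {s<..} V c q g \<le> ennreal \<eta>" .
  next
    fix c q g s
    assume m: "minimizer c q g" and near: "dist (q s) am < \<delta>"
    have B: "V z \<le> \<eta> / 2" if "z \<in> closed_segment (q s) am" for z
      using dm(2)[of z] dist_segment_le[OF that] near de by simp
    obtain r r' where r: "has_L2_deriv r r'" "r 0 = q s" "\<And>t. 0 \<le> t \<Longrightarrow> c \<le> V (r t)" "\<And>t. 1 \<le> t \<Longrightarrow> r t \<in> Vm c"
      "action_on {0..} V c r r' \<le> ennreal ((dist (q s) am)\<^sup>2 / 2 + \<eta> / 2)"
      by (rule ray_to_am[of c "q s" "\<eta> / 2"]) (use m minimizer_V[OF m, of s] near de B in auto)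
    have "action_on {..s} V c q g \<le> action_on {0..} V c r r'"
      by (rule minimal_left_tail[OF V_cont _ fin[OF m] r(1-4)]) (use m in auto)
    also have "\<dots> \<le> ennreal \<eta>" using r(5) sq[OF _ near] by (auto elim!: order_trans intro!: ennreal_leI)
    finally show "action_on {..s} V c q g \<le> ennreal \<eta>" .
  qed
qed

text \<open>The nearest point of \<open>Vm c\<close> is itself within a quarter of
  \<open>dist am ap\<close> from \<open>am\<close>, and the two quarters add up to less than one
  half.\<close>

lemma near_am:
  assumes c: "0 < c" "c < cdw" and l: "infdist x (Vm c) < dist am ap / 4"
  shows "dist x am < dist am ap / 2 \<and> dist x am < dist x ap"
proof -
  obtain y where y: "y \<in> Vm c" "infdist x (Vm c) = dist x y"
    by (rule infdist_attains_inf[of "Vm c" x]) (use wells(3)[OF c] wells(5)[OF c] compact_imp_closed in auto)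
  have "dist y am < dist am ap / 4" by (rule wells(7)[OF c y(1)])
  then have "dist x am < dist am ap / 2" using l y dist_triangle[of x am y] by simp
  then show ?thesis using dist_triangle[of am ap x] by (simp add: dist_commute)
qed

lemma near_ap:
  assumes "0 < c" "c < cdw" "infdist x (Vp c) < dist am ap / 4"
  shows "dist x ap < dist am ap / 2 \<and> dist x ap < dist x am"
  using double_well.near_am[OF mirror assms(1,2), of x] assms(3) unfolding dist_commute[of ap am] by blast

end

section \<open>From minimizers to global solutions\<close>

lemma Sup_ereal_closed_mem:
  fixes q :: "real \<Rightarrow> 'a::metric_space"
  assumes "continuous_on UNIV q" "closed K" "Sup {ereal t |t. q t \<in> K} = ereal a"
  shows "q a \<in> K" "\<And>t. q t \<in> K \<Longrightarrow> t \<le> a"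
proof -
  show le: "\<And>t. q t \<in> K \<Longrightarrow> t \<le> a"
  proof -
    fix t assume "q t \<in> K"
    then have "ereal t \<le> Sup {ereal t |t. q t \<in> K}" by (intro Sup_upper) auto
    then show "t \<le> a" using assms(3) by simp
  qed
  have cl: "closed {t. q t \<in> K}"
    using continuous_closed_vimage[OF assms(2), of q] assms(1) by (simp add: vimage_def continuous_on_eq_continuous_at)
  have "a \<in> closure {t. q t \<in> K}"
    unfolding closure_approachable
  proof (intro allI impI)
    fix e :: real assume "e > 0"
    then have "ereal (a - e) < Sup {ereal t |t. q t \<in> K}" using assms(3) by simp
    then obtain t where "q t \<in> K" "a - e < t" unfolding less_Sup_iff by auto
    then show "\<exists>y\<in>{t. q t \<in> K}. dist y a < e" using le[of t] by (intro bexI[of _ t]) (auto simp: dist_real_def)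
  qed
  then show "q a \<in> K" using cl by simp
qed

text \<open>\<open>P\<close> stands for coming after \<open>alpha\<close>; the third conclusion will
  show that \<open>omega\<close> does not precede \<open>alpha\<close>.\<close>

lemma Inf_ereal_closed_mem:
  fixes q :: "real \<Rightarrow> 'a::metric_space"
  assumes "continuous_on UNIV q" "closed K" "Inf {ereal t |t. P t \<and> q t \<in> K} = ereal w"
  shows "q w \<in> K" "\<And>t. P t \<Longrightarrow> q t \<in> K \<Longrightarrow> w \<le> t" "\<And>e. e > 0 \<Longrightarrow> \<exists>t<w+e. P t"
proof -
  show le: "\<And>t. P t \<Longrightarrow> q t \<in> K \<Longrightarrow> w \<le> t"
  proof -
    fix t assume "P t" "q t \<in> K"
    then have "Inf {ereal t |t. P t \<and> q t \<in> K} \<le> ereal t" by (intro Inf_lower) auto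
    then show "w \<le> t" using assms(3) by simp
  qed
  have ex: "\<exists>t<w+e. P t \<and> q t \<in> K" if "e > 0" for e
  proof -
    have "Inf {ereal t |t. P t \<and> q t \<in> K} < ereal (w + e)" using assms(3) that by simp
    then show ?thesis unfolding Inf_less_iff by auto
  qed
  then show "\<And>e. e > 0 \<Longrightarrow> \<exists>t<w+e. P t" by blast
  have cl: "closed {t. q t \<in> K}"
    using continuous_closed_vimage[OF assms(2), of q] assms(1) by (simp add: vimage_def continuous_on_eq_continuous_at)
  have "w \<in> closure {t. q t \<in> K}"
    unfolding closure_approachable
  proof (intro allI impI)
    fix e :: real assume "e > 0"
    then obtain t where "t < w + e" "P t" "q t \<in> K" using ex by blast
    then show "\<exists>y\<in>{t. q t \<in> K}. dist y w < e" using le[of t] by (intro bexI[of _ t]) (auto simp: dist_real_def)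
  qed
  then show "q w \<in> K" using cl by simp
qed

context double_well
begin

text \<open>Away from a ball the potential exceeds \<open>cdw\<close> by a fixed amount, so that there the action
  controls the length of the path.\<close>
lemma minimizers_uniformly_bounded:
  "\<exists>R. \<forall>c q g t. minimizer c q g \<longrightarrow> norm (q t) \<le> R"
proof -
  obtain C where C: "0 \<le> C" "\<And>c q g. minimizer c q g \<Longrightarrow> action V c q \<le> ennreal C" using action_bound by blast
  have "ereal cdw < nu0" using dec by (simp add: double_well_decomposition_def)
  then obtain \<nu> where nu: "cdw < \<nu>" "ereal \<nu> < nu0" using ereal_dense2 by force
  have "eventually (\<lambda>x. ereal \<nu> < ereal (V x)) at_infinity" using nu(2) V_inf by (intro less_LiminfD) simp
  then obtain R1 where R1: "\<And>x. norm x \<ge> R1 \<Longrightarrow> \<nu> < V x" unfolding eventually_at_infinity by auto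
  \<comment> \<open>Beyond \<open>R1\<close> the potential exceeds \<open>\<nu>\<close>; the second
    entry ensures that a path near the well around \<open>am\<close>, as every minimizer is at early
    times, lies in the ball of radius \<open>R0\<close>.\<close>
  define R0 where "R0 = max R1 (norm am + dist am ap)"
  have R0: "\<nu> < V x" if "norm x \<ge> R0" for x using R1 that by (simp add: R0_def)
  define \<mu> where "\<mu> = \<nu> - cdw"
  have mu: "\<mu> > 0" using nu by (simp add: \<mu>_def)
  \<comment> \<open>Outside the ball \<open>V - c\<close> is at least \<open>\<mu>\<close>. Then
    \<open>norm (g r) \<le> (norm (g r))\<^sup>2 / 2 + 1 / 2\<close> is bounded by \<open>M\<close>
    times the Lagrangian, because \<open>M \<ge> 1\<close> and
    \<open>M * \<mu> \<ge> 1 / 2\<close>.\<close>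
  define M where "M = 1 + 1 / (2 * \<mu>)"
  have M: "M \<ge> 1" "M * \<mu> \<ge> 1 / 2" using mu by (auto simp: M_def distrib_right)
  show ?thesis
  proof (intro exI[of _ "R0 + M * C"] allI impI)
    fix c q g t assume m: "minimizer c q g"
    then have c: "0 < c" "c < cdw" and qd: "has_L2_deriv q g" by (auto simp: minimal_def)
    have qG: "q \<in> Gamma V c (Vm c) (Vp c)" using m unfolding minimal_def by blast
    have cq: "continuous_on S q" for S by (rule has_L2_deriv_continuous[OF qd])
    show "norm (q t) \<le> R0 + M * C"
    proof (cases "norm (q t) \<le> R0")
      case True
      then show ?thesis using M C by (smt (verit) mult_nonneg_nonneg)
    next
      case False
      have "dist am ap / 4 > 0" using am_neq_ap by simp
      then obtain s where s: "s \<le> t" "infdist (q s) (Vm c) < dist am ap / 4" using qG unfolding Gamma_iff by blast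
      have "dist (q s) am < dist am ap" using near_am[OF c s(2)] zero_le_dist[of am ap] by linarith
      then have sR: "norm (q s) \<le> R0"
        using norm_triangle_ineq2[of "q s" am] by (simp add: R0_def dist_norm)
      \<comment> \<open>The last time in \<open>S\<close> is the last exit from the ball before
        \<open>t\<close>; from then on the lower bound on the potential holds, and the action bounds
        the distance travelled.\<close>
      define S where "S = {r \<in> {s..t}. norm (q r) \<in> {..R0}}"
      have "closed S" unfolding S_def
        using continuous_closed_preimage[of "{s..t}" "\<lambda>r. norm (q r)" "{..R0}"]
        by (simp add: vimage_def Int_def continuous_on_norm cq)
      moreover have "bounded S" by (rule bounded_subset[of "{s..t}"]) (auto simp: S_def)
      ultimately have "compact S" by (simp add: compact_eq_bounded_closed)
      moreover have "S \<noteq> {}" using s sR by (auto simp: S_def)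
      ultimately obtain s0 where s0: "s0 \<in> S" "\<And>r. r \<in> S \<Longrightarrow> r \<le> s0" using compact_attains_sup[of S] by blast
      have s0': "s \<le> s0" "s0 \<le> t" "norm (q s0) \<le> R0" using s0(1) by (auto simp: S_def)
      obtain r where r: "s0 \<le> r" "r \<le> t" "norm (q r) = R0"
        using IVT'[of "\<lambda>r. norm (q r)" s0 R0 t] s0' False by (auto intro: continuous_on_norm cq)
      have "r \<le> s0" using r s0' by (intro s0(2)) (simp add: S_def)
      then have eq: "norm (q s0) = R0" using r by simp
      have out: "norm (q r) \<ge> R0" if "r \<in> {s0..t}" for r
      proof (rule ccontr)
        assume "\<not> norm (q r) \<ge> R0"
        then have "r \<in> S" using that s0' by (auto simp: S_def)
        then show False using s0(2)[of r] that \<open>\<not> norm (q r) \<ge> R0\<close> eq by auto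
      qed
      have gi: "g integrable_on {s0..t}"
        using loc_L2_absolutely_integrable[of g s0 t] qd by (simp add: has_L2_deriv_def absolutely_integrable_on_def)
      have ei: "energy V c q g integrable_on {s0..t}"
        using set_borel_integral_eq_integral(1)[OF energy_integrable[OF qd V_cont]] .
      have "norm (integral {s0..t} g) \<le> integral {s0..t} (\<lambda>r. M * energy V c q g r)"
      proof (rule integral_norm_bound_integral[OF gi])
        show "(\<lambda>r. M * energy V c q g r) integrable_on {s0..t}" by (rule integrable_on_mult_right[OF ei])
        fix r assume "r \<in> {s0..t}"
        then have "V (q r) - c \<ge> \<mu>" using R0[OF out] c by (force simp: \<mu>_def)
        then have "M * (V (q r) - c) \<ge> M * \<mu>" using M by (intro mult_left_mono) auto
        moreover have "M * ((norm (g r))\<^sup>2 / 2) \<ge> 1 * ((norm (g r))\<^sup>2 / 2)" using M by (intro mult_right_mono) auto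
        moreover have "norm (g r) \<le> (norm (g r))\<^sup>2 / 2 + 1 / 2"
        proof -
          have "0 \<le> (norm (g r) - 1)\<^sup>2" by simp
          then show ?thesis by (simp add: power2_diff)
        qed
        ultimately show "norm (g r) \<le> M * energy V c q g r"
          using M(2) by (simp add: energy_def distrib_left)
      qed
      also have "\<dots> = M * integral {s0..t} (energy V c q g)" by simp
      also have "\<dots> \<le> M * C"
      proof (rule mult_left_mono)
        show "integral {s0..t} (energy V c q g) \<le> C"
        proof (rule integral_le_half_line[where A = UNIV])
          show "set_integrable lborel {s0..t} (energy V c q g)" by (rule energy_integrable[OF qd V_cont])
          show "0 \<le> energy V c q g r" for r using minimizer_V[OF m, of r] by (simp add: energy_def)
          show "action_on UNIV V c q g \<le> ennreal C"
            using C(2)[OF m] unfolding action_eq[OF qd] by simp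
        qed (use C in auto)
      qed (use M in simp)
      finally have "norm (q t - q s0) \<le> M * C" using has_L2_deriv_integral[OF qd s0'(2)] by simp
      then show ?thesis using eq norm_triangle_ineq2[of "q t" "q s0"] by linarith
    qed
  qed
qed

text \<open>The retained piece lies between \<open>alpha\<close> and \<open>omega\<close>, where
  \<open>q\<close> avoids both components, so the potential exceeds \<open>c\<close> in its
  interior. A finite end lies on a component, where the constraint forces equality. The last two
  conclusions provide times on both sides of the set of points equidistant from the wells.\<close>

lemma generated_unfolds:
  assumes m: "minimizer c q g" and gen: "generated_by (Vm c) (Vp c) q u"
  obtains I E where "unfolds I E q u" "closed I" "is_interval I"
    "\<And>t. t \<in> interior I \<Longrightarrow> c < V (q t)" "\<And>e. e \<in> E \<Longrightarrow> V (q e) = c"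
    "\<exists>s\<in>I. dist (q s) am < dist (q s) ap" "\<exists>t\<in>I. dist (q t) ap < dist (q t) am"
proof -
  have c: "0 < c" "c < cdw" and qd: "has_L2_deriv q g" using m by (auto simp: minimal_def)
  have qG: "q \<in> Gamma V c (Vm c) (Vp c)" using m unfolding minimal_def by blast
  have cq: "continuous_on UNIV q" by (rule has_L2_deriv_continuous[OF qd])
  have cl: "closed (Vm c)" "closed (Vp c)" using wells(3)[OF c] wells(4)[OF c] compact_imp_closed by auto
  have eqc: "V (q t) = c" if "q t \<in> Vm c \<or> q t \<in> Vp c" for t
    using wells(1)[OF c, of "q t"] that minimizer_V[OF m, of t] by simp
  have gt: "c < V (q t)" if "q t \<notin> Vm c" "q t \<notin> Vp c" for t using V_gt_off_wells[OF c that] .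
  have d4: "dist am ap / 4 > 0" using am_neq_ap by simp
  have left: "\<exists>s\<le>T. dist (q s) am < dist (q s) ap" for T
  proof -
    obtain s where "s \<le> T" "infdist (q s) (Vm c) < dist am ap / 4" using qG d4 unfolding Gamma_iff by blast
    then show ?thesis using near_am[OF c] by blast
  qed
  have right: "\<exists>s\<ge>T. dist (q s) ap < dist (q s) am" for T
  proof -
    obtain s where "s \<ge> T" "infdist (q s) (Vp c) < dist am ap / 4" using qG d4 unfolding Gamma_iff by blast
    then show ?thesis using near_ap[OF c] by blast
  qed
  have inm: "dist (q t) am < dist (q t) ap" if "q t \<in> Vm c" for t using near_am[OF c, of "q t"] that d4 by simp
  have inp: "dist (q t) ap < dist (q t) am" if "q t \<in> Vp c" for t using near_ap[OF c, of "q t"] that d4 by simp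
  have alpha_inf: "q t \<notin> Vm c" if "alpha (Vm c) q = -\<infinity>" for t
  proof
    assume "q t \<in> Vm c"
    then have "ereal t \<le> alpha (Vm c) q" unfolding alpha_def by (intro Sup_upper) auto
    then show False using that by simp
  qed
  have alpha_fin: "q a \<in> Vm c" "\<And>t. a < t \<Longrightarrow> q t \<notin> Vm c" if "alpha (Vm c) q = ereal a" for a
    using Sup_ereal_closed_mem[OF cq cl(1), of a] that unfolding alpha_def by force+
  have omega_inf: "q t \<notin> Vp c" if "omega (Vm c) (Vp c) q = \<infinity>" "alpha (Vm c) q < ereal t" for t
  proof
    assume "q t \<in> Vp c"
    then have "omega (Vm c) (Vp c) q \<le> ereal t" unfolding omega_def using that(2) by (intro Inf_lower) auto
    then show False using that by simp
  qed
  have omega_fin: "q w \<in> Vp c" "\<And>t. alpha (Vm c) q < ereal t \<Longrightarrow> t < w \<Longrightarrow> q t \<notin> Vp c"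
     "\<And>e. e > 0 \<Longrightarrow> \<exists>t<w+e. alpha (Vm c) q < ereal t"
    if "omega (Vm c) (Vp c) q = ereal w" for w
    using Inf_ereal_closed_mem[OF cq cl(2), of "\<lambda>t. alpha (Vm c) q < ereal t" w] that unfolding omega_def by force+
  consider (1) "alpha (Vm c) q = -\<infinity>" "omega (Vm c) (Vp c) q = \<infinity>" "u = q"
    | (2) w where "alpha (Vm c) q = -\<infinity>" "omega (Vm c) (Vp c) q = ereal w"
        "\<forall>t\<le>w. u t = q t" "\<forall>t. u (2 * w - t) = u t"
    | (3) a where "alpha (Vm c) q = ereal a" "omega (Vm c) (Vp c) q = \<infinity>"
        "\<forall>t\<ge>a. u t = q t" "\<forall>t. u (2 * a - t) = u t"
    | (4) a w where "alpha (Vm c) q = ereal a" "omega (Vm c) (Vp c) q = ereal w"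
        "\<forall>t\<in>{a..w}. u t = q t" "\<forall>t. u (2 * w - t) = u t" "\<forall>t. u (t + 2 * (w - a)) = u t"
    using gen unfolding generated_by_def by blast
  then show ?thesis
  proof cases
    case 1
    show ?thesis
    proof (rule that[of UNIV "{}"])
      show "unfolds UNIV {} q u" unfolding 1(3) by (rule unfolds_UNIV)
      show "c < V (q t)" for t by (intro gt alpha_inf omega_inf) (use 1 in auto)
    qed (use left right in auto)
  next
    case 2
    note w = omega_fin[OF 2(2)]
    show ?thesis
    proof (rule that[of "{..w}" "{w}"])
      show "unfolds {..w} {w} q u" by (rule unfolds_atMost) (use 2 in auto)
      show "c < V (q t)" if "t \<in> interior {..w}" for t
        by (intro gt alpha_inf w(2)) (use 2(1) that in auto)
      show "V (q e) = c" if "e \<in> {w}" for e using that eqc w(1) by auto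
      show "\<exists>s\<in>{..w}. dist (q s) am < dist (q s) ap" using left[of w] by auto
      show "\<exists>t\<in>{..w}. dist (q t) ap < dist (q t) am" using inp[OF w(1)] by auto
    qed (auto simp: is_interval_1)
  next
    case 3
    note a = alpha_fin[OF 3(1)]
    show ?thesis
    proof (rule that[of "{a..}" "{a}"])
      show "unfolds {a..} {a} q u" by (rule unfolds_atLeast) (use 3 in auto)
      show "c < V (q t)" if "t \<in> interior {a..}" for t
        by (intro gt a(2) omega_inf) (use 3 that in auto)
      show "V (q e) = c" if "e \<in> {a}" for e using that eqc a(1) by auto
      show "\<exists>s\<in>{a..}. dist (q s) am < dist (q s) ap" using inm[OF a(1)] by auto
      show "\<exists>t\<in>{a..}. dist (q t) ap < dist (q t) am" using right[of a] by auto
    qed (auto simp: is_interval_1)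
  next
    case 4
    note a = alpha_fin[OF 4(1)]
    note w = omega_fin[OF 4(2)]
    \<comment> \<open>\<open>w\<close> is an infimum of times after \<open>a\<close>; equality is
      excluded because the two components are disjoint.\<close>
    have "a \<le> w"
    proof (rule field_le_epsilon)
      fix e :: real assume "e > 0"
      from w(3)[OF this] obtain t where "t < w + e" "a < t" using 4(1) by auto
      then show "a \<le> w + e" by simp
    qed
    moreover have "a \<noteq> w" using a(1) w(1) wells(2)[OF c] by auto
    ultimately have aw: "a < w" by simp
    show ?thesis
    proof (rule that[of "{a..w}" "{a, w}"])
      show "unfolds {a..w} {a, w} q u" by (rule unfolds_atLeastAtMost[OF aw]) (use 4 in auto)
      show "c < V (q t)" if "t \<in> interior {a..w}" for t
        by (intro gt a(2) w(2)) (use 4(1) that in auto)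
      show "V (q e) = c" if "e \<in> {a, w}" for e using that eqc a(1) w(1) by auto
      show "\<exists>s\<in>{a..w}. dist (q s) am < dist (q s) ap" using inm[OF a(1)] aw by auto
      show "\<exists>t\<in>{a..w}. dist (q t) ap < dist (q t) am" using inp[OF w(1)] aw by auto
    qed (auto simp: is_interval_1)
  qed
qed

text \<open>The last conclusion is the only way back from the extension \<open>u\<close> to the
  minimizer \<open>q\<close>, and hence to comparison with competitors.\<close>

lemma minimization_solution_properties:
  assumes c: "0 < c" "c < cdw" and sol: "minimization_solution V c (Vm c) (Vp c) u"
    and R: "\<And>c q g t. minimizer c q g \<Longrightarrow> norm (q t) \<le> R"
  obtains v q g \<tau> where "minimizer c q g" "\<And>t. norm (u t) \<le> R"
    "\<And>t. (u has_vector_derivative v t) (at t)" "\<And>t. (v has_vector_derivative gradV (u t)) (at t)"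
    "\<And>t. (norm (v t))\<^sup>2 / 2 = V (u t) - c" "dist (u \<tau>) am = dist (u \<tau>) ap"
    "\<And>T. (\<forall>t\<in>{\<tau>-T..\<tau>+T}. c < V (u t)) \<longrightarrow> (\<forall>t\<in>{\<tau>-T..\<tau>+T}. u t = q t)"
proof -
  obtain r q where q: "q \<in> minimizers V c (Vm c) (Vp c) r" "generated_by (Vm c) (Vp c) q u"
    using sol unfolding minimization_solution_def by blast
  define g where "g = weak_deriv q"
  have m: "minimizer c q g" using c minimizers_minimal[OF q(1)] by (simp add: g_def)
  have qd: "has_L2_deriv q g" using m by (simp add: minimal_def)
  have cq: "continuous_on S q" for S by (rule has_L2_deriv_continuous[OF qd])
  obtain C where C: "\<And>c q g. minimizer c q g \<Longrightarrow> action V c q \<le> ennreal C" using action_bound by blast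
  have fin: "action V c q < \<infinity>" using C[OF m] by (simp add: le_less_trans)
  have mm: "minimal V c (Vm c) (Vp c) q g" using m by simp
  obtain I E where IE: "unfolds I E q u" "closed I" "is_interval I"
    "\<And>t. t \<in> interior I \<Longrightarrow> c < V (q t)" "\<And>e. e \<in> E \<Longrightarrow> V (q e) = c"
    "\<exists>s\<in>I. dist (q s) am < dist (q s) ap" "\<exists>t\<in>I. dist (q t) ap < dist (q t) am"
    by (rule generated_unfolds[OF m q(2)]) (rule that; assumption)
  have uq: "u t = q t" if "t \<in> I" for t using IE(1) that by (simp add: unfolds_def)
  have loc: "\<exists>r>0. \<exists>p. \<forall>s\<in>ball t r. (q has_vector_derivative p s) (at s) \<and>
        (p has_vector_derivative gradV (q s)) (at s) \<and> (norm (p s))\<^sup>2 / 2 = V (q s) - c" if t: "t \<in> interior I" for t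
  proof -
    obtain r where r: "r > 0" "cball t r \<subseteq> interior I"
      using t open_contains_cball[of "interior I"] by auto
    have ab: "t - r < t + r" using r by simp
    have "c < V (q s)" if "s \<in> {t - r..t + r}" for s
      using IE(4)[of s] r(2) that by (auto simp: dist_real_def subset_iff abs_le_iff)
    then obtain p where p: "\<And>s. s \<in> {t-r<..<t+r} \<Longrightarrow> (q has_vector_derivative p s) (at s)"
      "\<And>s. s \<in> {t-r<..<t+r} \<Longrightarrow> (p has_vector_derivative gradV (q s)) (at s)"
      "\<And>s. s \<in> {t-r<..<t+r} \<Longrightarrow> (norm (p s))\<^sup>2 / 2 = V (q s) - c"
      using minimal_euler_lagrange[OF grad gradV_cont gradV_lip mm fin ab] by blast
    have ball: "ball t r = {t-r<..<t+r}" by (rule ball_eq_greaterThanLessThan)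
    show ?thesis
      by (rule exI[of _ r], rule conjI[OF r(1)], rule exI[of _ p]) (use p ball in blast)
  qed
  obtain v where v: "\<And>t. (u has_vector_derivative v t) (at t)"
    "\<And>t. (v has_vector_derivative gradV (u t)) (at t)" "\<And>t. (norm (v t))\<^sup>2 / 2 = V (u t) - c"
    by (rule unfolded_solution[OF IE(1) cq V_cont gradV_cont loc IE(5)]) (assumption | (rule that; assumption))+
  have uR: "norm (u t) \<le> R" for t
  proof (rule unfolds_induct[OF IE(1), where P = "\<lambda>t. norm (u t) \<le> R"])
    show "norm (u t) \<le> R" if "t \<in> I" for t using uq[OF that] R[OF m, of t] by simp
    show "norm (u (2 * e - t)) \<le> R" if "e \<in> E" "norm (u t) \<le> R" for e t
      using IE(1) that by (simp add: unfolds_def)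
  qed
  \<comment> \<open>An intermediate value for the difference of the two distances, taken within
    \<open>I\<close>: the window argument starts from a time at which \<open>u\<close> and
    \<open>q\<close> agree.\<close>
  obtain \<tau> where tau: "\<tau> \<in> I" "dist (q \<tau>) am = dist (q \<tau>) ap"
  proof -
    have "connected I" using IE(3) by (simp add: is_interval_connected)
    define f where "f = (\<lambda>t. dist (q t) am - dist (q t) ap)"
    have con: "connected (f ` I)"
      unfolding f_def by (intro connected_continuous_image continuous_intros cq) fact
    obtain s where s: "s \<in> I" "dist (q s) am < dist (q s) ap" using IE(6) by blast
    obtain t where t: "t \<in> I" "dist (q t) ap < dist (q t) am" using IE(7) by blast
    have "0 \<in> f ` I"
      by (rule connectedD_interval[OF con imageI[OF s(1)] imageI[OF t(1)]])
        (use s(2) t(2) in \<open>simp_all add: f_def\<close>)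
    then obtain x where "x \<in> I" "f x = 0" by auto
    then show ?thesis using that[of x] by (simp add: f_def)
  qed
  \<comment> \<open>Reflection points have potential exactly \<open>c\<close>, so the window
    contains none of them. Within it \<open>I\<close> is then both open and closed, and as the
    window is connected and contains \<open>\<tau>\<close>, it lies in \<open>I\<close>.\<close>
  have window: "\<forall>t\<in>{\<tau>-T..\<tau>+T}. u t = q t" if gt: "\<And>t. t \<in> {\<tau>-T..\<tau>+T} \<Longrightarrow> c < V (u t)" for T
  proof (cases "T < 0")
    case False
    let ?J = "{\<tau>-T..\<tau>+T}"
    have sub: "I \<inter> ?J \<subseteq> interior I"
    proof
      fix t assume t: "t \<in> I \<inter> ?J"
      then have "t \<notin> E" using IE(5)[of t] gt[of t] uq[of t] by auto
      then show "t \<in> interior I" using IE(1) t by (auto simp: unfolds_def)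
    qed
    have "interior I \<inter> ?J = {} \<or> (- I) \<inter> ?J = {}"
    proof (rule connectedD[of ?J "interior I" "- I"])
      show "?J \<subseteq> interior I \<union> - I" using sub by blast
    qed (use IE(2) interior_subset in auto)
    moreover have "\<tau> \<in> interior I \<inter> ?J" using sub tau False by auto
    ultimately have "?J \<subseteq> I" by blast
    then show ?thesis using uq by blast
  qed simp
  have "dist (u \<tau>) am = dist (u \<tau>) ap" using tau uq by simp
  moreover have "(\<forall>t\<in>{\<tau>-T..\<tau>+T}. c < V (u t)) \<longrightarrow> (\<forall>t\<in>{\<tau>-T..\<tau>+T}. u t = q t)" for T
    using window[of T] by blast
  ultimately show ?thesis using that[of q g v \<tau>] m uR v by blast
qed

end

section \<open>Newton flows\<close>

definition newton_flow :: "('a::real_normed_vector \<Rightarrow> 'a) \<Rightarrow> (real \<Rightarrow> 'a) \<Rightarrow> (real \<Rightarrow> 'a) \<Rightarrow> bool" where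
  "newton_flow G u v \<longleftrightarrow> (\<forall>t. (u has_vector_derivative v t) (at t)) \<and> (\<forall>t. (v has_vector_derivative G (u t)) (at t))"

lemma newton_flow_shift:
  assumes "newton_flow G u v"
  shows "newton_flow G (\<lambda>t. u (t + k)) (\<lambda>t. v (t + k))"
proof -
  have *: "((\<lambda>t. f (t + k)) has_vector_derivative f' (t + k)) (at t)"
    if "\<And>t. (f has_vector_derivative f' t) (at t)" for f f' :: "real \<Rightarrow> 'a" and t
  proof -
    have "((\<lambda>t. t + k) has_vector_derivative 1) (at t)" by (auto intro!: derivative_eq_intros)
    from vector_diff_chain_at[OF this that] show ?thesis by (simp add: o_def)
  qed
  show ?thesis using assms *[of u v] *[of v "\<lambda>t. G (u t)"] by (simp add: newton_flow_def)
qed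

lemma newton_flow_reflect:
  assumes "newton_flow G u v"
  shows "newton_flow G (\<lambda>t. u (- t)) (\<lambda>t. - v (- t))"
proof -
  have "((\<lambda>t. f (- t)) has_vector_derivative - f' (- t)) (at t)"
    if "\<And>t. (f has_vector_derivative f' t) (at t)" for f f' :: "real \<Rightarrow> 'a" and t
  proof -
    have "((\<lambda>t. - t) has_vector_derivative - 1) (at t)" by (auto intro!: derivative_eq_intros)
    from vector_diff_chain_at[OF this that] show ?thesis by (simp add: o_def)
  qed
  from this[of u v] has_vector_derivative_minus[OF this[of v "\<lambda>t. G (u t)"]] assms
  show ?thesis by (simp add: newton_flow_def)
qed

lemma newton_flow_continuous:
  assumes "newton_flow G u v"
  shows "continuous_on S u" "continuous_on S v"
  using assms unfolding newton_flow_def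
  by (meson continuous_at_imp_continuous_on has_vector_derivative_continuous)+

lemma newton_flow_vderiv:
  assumes "newton_flow G u v"
  shows "vderiv u = v" "vderiv v = (\<lambda>t. G (u t))"
  using assms by (auto simp: newton_flow_def vderiv_def fun_eq_iff vector_derivative_at)

lemma newton_flow_C2:
  assumes "newton_flow G u v" "continuous_on UNIV G"
  shows "C2 u"
proof -
  have "continuous_on UNIV (\<lambda>t. G (u t))"
    by (rule continuous_on_compose2[OF assms(2) newton_flow_continuous(1)[OF assms(1)]]) simp
  moreover have "u differentiable (at t)" "v differentiable (at t)" for t
    using assms(1) by (auto simp: newton_flow_def intro: differentiableI_vector)
  ultimately show ?thesis unfolding C2_def newton_flow_vderiv[OF assms(1)] by simp
qed

text \<open>\<open>E\<close> is the squared distance in phase space. Cauchy-Schwarz and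
  \<open>2 * (a * b) \<le> a\<^sup>2 + b\<^sup>2\<close> bound its derivative by
  \<open>(1 + L) * E\<close>, so \<open>E\<close> times the decaying exponential is
  nonincreasing.\<close>

lemma newton_flow_gronwall_right:
  fixes u :: "real \<Rightarrow> 'a::real_inner"
  assumes uv: "newton_flow G u v" and xy: "newton_flow G x y"
    and lip: "L-lipschitz_on S G" and S: "\<And>t. u t \<in> S" "\<And>t. x t \<in> S" and t: "0 \<le> t"
  shows "(norm (u t - x t))\<^sup>2 + (norm (v t - y t))\<^sup>2 \<le>
      ((norm (u 0 - x 0))\<^sup>2 + (norm (v 0 - y 0))\<^sup>2) * exp ((1 + L) * t)"
proof -
  have L: "0 \<le> L" using lip by (rule lipschitz_on_nonneg)
  define E where "E = (\<lambda>t. (u t - x t) \<bullet> (u t - x t) + (v t - y t) \<bullet> (v t - y t))"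
  define E' where "E' = (\<lambda>t. 2 * ((v t - y t) \<bullet> (u t - x t)) + 2 * ((G (u t) - G (x t)) \<bullet> (v t - y t)))"
  have dE: "(E has_real_derivative E' s) (at s)" for s
  proof -
    have 1: "((\<lambda>t. u t - x t) has_derivative (\<lambda>h. h *\<^sub>R (v s - y s))) (at s)"
      "((\<lambda>t. v t - y t) has_derivative (\<lambda>h. h *\<^sub>R (G (u s) - G (x s)))) (at s)"
      using uv xy by (auto simp: newton_flow_def has_vector_derivative_def scaleR_diff_right intro!: has_derivative_diff)
    have "(E has_derivative (\<lambda>h. ((u s - x s) \<bullet> (h *\<^sub>R (v s - y s)) + (h *\<^sub>R (v s - y s)) \<bullet> (u s - x s)) +
       ((v s - y s) \<bullet> (h *\<^sub>R (G (u s) - G (x s))) + (h *\<^sub>R (G (u s) - G (x s))) \<bullet> (v s - y s)))) (at s)"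
      unfolding E_def by (intro has_derivative_add has_derivative_inner 1)
    then show ?thesis unfolding has_field_derivative_def
      by (rule has_derivative_eq_rhs) (simp add: E'_def fun_eq_iff inner_commute algebra_simps)
  qed
  have E'le: "E' s \<le> (1 + L) * E s" for s
  proof -
    define a b where "a = norm (u s - x s)" and "b = norm (v s - y s)"
    have "(v s - y s) \<bullet> (u s - x s) \<le> b * a" unfolding a_def b_def by (rule norm_cauchy_schwarz)
    moreover have "(G (u s) - G (x s)) \<bullet> (v s - y s) \<le> (L * a) * b"
    proof -
      have "(G (u s) - G (x s)) \<bullet> (v s - y s) \<le> norm (G (u s) - G (x s)) * b"
        unfolding b_def by (rule norm_cauchy_schwarz)
      also have "\<dots> \<le> (L * a) * b"
        using lipschitz_onD[OF lip S(1) S(2), of s s] by (intro mult_right_mono) (auto simp: a_def b_def dist_norm)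
      finally show ?thesis .
    qed
    ultimately have "E' s \<le> (1 + L) * (2 * (a * b))" by (simp add: E'_def algebra_simps)
    also have "\<dots> \<le> (1 + L) * (a\<^sup>2 + b\<^sup>2)"
    proof (rule mult_left_mono)
      have "0 \<le> (a - b)\<^sup>2" by simp
      then show "2 * (a * b) \<le> a\<^sup>2 + b\<^sup>2" by (simp add: power2_diff)
    qed (use L in simp)
    finally show ?thesis by (simp add: E_def a_def b_def power2_norm_eq_inner)
  qed
  have "E t * exp (- (1 + L) * t) \<le> E 0 * exp (- (1 + L) * 0)"
  proof (rule DERIV_nonpos_imp_nonincreasing[OF t])
    fix s assume "0 \<le> s" "s \<le> t"
    have "((\<lambda>s. E s * exp (- (1 + L) * s)) has_real_derivative
      (E' s * exp (- (1 + L) * s) + E s * (exp (- (1 + L) * s) * (- (1 + L))))) (at s)"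
      using dE by (auto intro!: derivative_eq_intros)
    moreover have "E' s * exp (- (1 + L) * s) + E s * (exp (- (1 + L) * s) * (- (1 + L))) =
        (E' s - (1 + L) * E s) * exp (- (1 + L) * s)" by (simp add: algebra_simps)
    moreover have "\<dots> \<le> 0" using E'le[of s] by (intro mult_nonpos_nonneg) auto
    ultimately show "\<exists>y. ((\<lambda>s. E s * exp (- (1 + L) * s)) has_real_derivative y) (at s) \<and> y \<le> 0" by metis
  qed
  then have "E t * exp (- (1 + L) * t) * exp ((1 + L) * t) \<le> E 0 * exp ((1 + L) * t)"
    by (intro mult_right_mono) auto
  moreover have "exp (- (1 + L) * t) * exp ((1 + L) * t) = 1"
    by (simp add: mult_exp_exp algebra_simps)
  ultimately have "E t \<le> E 0 * exp ((1 + L) * t)" by (simp only: mult.assoc mult_1_right)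
  then show ?thesis by (simp add: E_def power2_norm_eq_inner)
qed

text \<open>Time reversal maps flows to flows and covers negative times.\<close>

lemma newton_flow_gronwall:
  fixes u :: "real \<Rightarrow> 'a::real_inner"
  assumes uv: "newton_flow G u v" and xy: "newton_flow G x y"
    and lip: "L-lipschitz_on S G" and S: "\<And>t. u t \<in> S" "\<And>t. x t \<in> S"
  shows "(norm (u t - x t))\<^sup>2 + (norm (v t - y t))\<^sup>2 \<le>
      ((norm (u 0 - x 0))\<^sup>2 + (norm (v 0 - y 0))\<^sup>2) * exp ((1 + L) * \<bar>t\<bar>)"
proof (cases "0 \<le> t")
  case True
  then show ?thesis using newton_flow_gronwall_right[OF assms] by simp
next
  case False
  then show ?thesis
    using newton_flow_gronwall_right[OF newton_flow_reflect[OF uv] newton_flow_reflect[OF xy] lip, of "- t"] S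
    by (simp add: norm_minus_commute[of "v _" "y _"])
qed

lemma has_vector_derivative_uniform_limit:
  fixes f :: "nat \<Rightarrow> real \<Rightarrow> 'a::banach"
  assumes d: "\<And>n t. (f n has_vector_derivative f' n t) (at t)"
    and p: "\<And>t. (\<lambda>n. f n t) \<longlonglongrightarrow> g t"
    and u: "\<And>T. uniform_limit {-T..T} f' g' sequentially"
  shows "(g has_vector_derivative g' t) (at t)"
proof -
  define T where "T = \<bar>t\<bar> + 1"
  have tT: "t \<in> {-T<..<T}" by (auto simp: T_def)
  have "\<exists>h. \<forall>x\<in>{-T..T}. (\<lambda>n. f n x) \<longlonglongrightarrow> h x \<and> (h has_derivative (\<lambda>s. s *\<^sub>R g' x)) (at x within {-T..T})"
  proof (rule has_derivative_sequence[where f' = "\<lambda>n x s. s *\<^sub>R f' n x"])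
    show "(f n has_derivative (\<lambda>s. s *\<^sub>R f' n x)) (at x within {-T..T})" for n x
      using d[of n x] by (auto simp: has_vector_derivative_def intro: has_derivative_at_withinI)
    fix e :: real assume "e > 0"
    then have "\<forall>\<^sub>F n in sequentially. \<forall>x\<in>{-T..T}. dist (f' n x) (g' x) < e"
      using u unfolding uniform_limit_iff by blast
    then show "\<forall>\<^sub>F n in sequentially. \<forall>x\<in>{-T..T}. \<forall>h. norm (h *\<^sub>R f' n x - h *\<^sub>R g' x) \<le> e * norm h"
    proof eventually_elim
      case (elim n)
      have "norm (h *\<^sub>R f' n x - h *\<^sub>R g' x) \<le> e * norm h" if "x \<in> {-T..T}" for x h
      proof -
        have "norm (f' n x - g' x) \<le> e" using elim that by (auto simp: dist_norm intro: less_imp_le)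
        then have "\<bar>h\<bar> * norm (f' n x - g' x) \<le> \<bar>h\<bar> * e" by (intro mult_left_mono) auto
        then show ?thesis by (simp add: scaleR_diff_right[symmetric] mult.commute)
      qed
      then show ?case by blast
    qed
  next
    show "t \<in> {-T..T}" using tT by auto
  qed (use p in auto)
  then obtain h where h0: "\<forall>x\<in>{-T..T}. (\<lambda>n. f n x) \<longlonglongrightarrow> h x \<and> (h has_derivative (\<lambda>s. s *\<^sub>R g' x)) (at x within {-T..T})"
    by blast
  then have h: "\<And>x. x \<in> {-T..T} \<Longrightarrow> (\<lambda>n. f n x) \<longlonglongrightarrow> h x"
    "\<And>x. x \<in> {-T..T} \<Longrightarrow> (h has_vector_derivative g' x) (at x within {-T..T})"
    unfolding has_vector_derivative_def by blast+
  have hg: "g x = h x" if "x \<in> {-T..T}" for x using LIMSEQ_unique[OF h(1)[OF that] p] by simp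
  have t': "t \<in> {-T..T}" using tT by auto
  have "(g has_vector_derivative g' t) (at t within {-T..T})"
    by (rule has_vector_derivative_transform[OF t' hg h(2)[OF t']])
  then show ?thesis using tT by (simp add: at_within_Icc_at)
qed

lemma uniform_limit_compose_lipschitz:
  fixes G :: "'a::metric_space \<Rightarrow> 'b::metric_space"
  assumes lip: "L-lipschitz_on S G" and fg: "uniform_limit X f g F"
    and S: "\<And>n t. t \<in> X \<Longrightarrow> f n t \<in> S" "\<And>t. t \<in> X \<Longrightarrow> g t \<in> S"
  shows "uniform_limit X (\<lambda>n t. G (f n t)) (\<lambda>t. G (g t)) F"
proof (rule uniform_limitI)
  fix e :: real assume e: "e > 0"
  have L0: "0 \<le> L" using lip by (rule lipschitz_on_nonneg)
  \<comment> \<open>Dividing by \<open>L + 1\<close> covers the case \<open>L = 0\<close>.\<close>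
  have "e / (L + 1) > 0" using e L0 by simp
  then have "\<forall>\<^sub>F n in F. \<forall>t\<in>X. dist (f n t) (g t) < e / (L + 1)"
    using fg unfolding uniform_limit_iff by blast
  then show "\<forall>\<^sub>F n in F. \<forall>t\<in>X. dist (G (f n t)) (G (g t)) < e"
  proof eventually_elim
    case (elim n)
    show ?case
    proof
      fix t assume t: "t \<in> X"
      then have "dist (f n t) (g t) * (L + 1) < e" using elim L0 by (simp add: pos_less_divide_eq)
      moreover have "dist (G (f n t)) (G (g t)) \<le> L * dist (f n t) (g t)"
        by (rule lipschitz_onD[OF lip S(1)[OF t] S(2)[OF t]])
      ultimately show "dist (G (f n t)) (G (g t)) < e"
        using zero_le_dist[of "f n t" "g t"]
        unfolding distrib_left mult_1_right mult.commute[of _ L] by linarith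
    qed
  qed
qed

text \<open>By Gronwall's inequality, convergence of the initial data suffices.\<close>
lemma newton_flow_compactness:
  fixes u v :: "nat \<Rightarrow> real \<Rightarrow> 'a::euclidean_space"
  assumes flow: "\<And>n. newton_flow G (u n) (v n)"
    and lip: "L-lipschitz_on (cball 0 R) G" and bu: "\<And>n t. norm (u n t) \<le> R" and bv: "\<And>n. norm (v n 0) \<le> B"
  obtains r :: "nat \<Rightarrow> nat" and u0 v0 where "strict_mono r" "newton_flow G u0 v0" "\<And>t. norm (u0 t) \<le> R"
    "\<And>T. uniform_limit {-T..T} (\<lambda>n. u (r n)) u0 sequentially"
    "\<And>T. uniform_limit {-T..T} (\<lambda>n. v (r n)) v0 sequentially"
proof -
  have "compact (cball (0::'a) R \<times> cball (0::'a) B)" by (intro compact_Times compact_cball)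
  moreover have "\<And>n. (u n 0, v n 0) \<in> cball 0 R \<times> cball 0 B" using bu bv by simp
  ultimately obtain l r where lr: "strict_mono (r::nat \<Rightarrow> nat)" "((\<lambda>n. (u n 0, v n 0)) \<circ> r) \<longlonglongrightarrow> l"
    unfolding compact_def by meson
  have c0: "Cauchy (\<lambda>n. u (r n) 0)" "Cauchy (\<lambda>n. v (r n) 0)"
    using tendsto_fst[OF lr(2)] tendsto_snd[OF lr(2)] by (auto simp: o_def intro!: LIMSEQ_imp_Cauchy)
  have S: "u n t \<in> cball 0 R" for n t using bu by simp
  have cau: "uniformly_Cauchy_on {-T..T} (\<lambda>n. u (r n))" "uniformly_Cauchy_on {-T..T} (\<lambda>n. v (r n))" for T
  proof -
    have main: "\<exists>M. \<forall>t\<in>{-T..T}. \<forall>m\<ge>M. \<forall>n\<ge>M. dist (u (r m) t) (u (r n) t) < e \<and> dist (v (r m) t) (v (r n) t) < e"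
      if e: "e > 0" for e
    proof -
      define K where "K = exp ((1 + L) * \<bar>T\<bar>)"
      have K: "K > 0" by (simp add: K_def)
      \<comment> \<open>Solves \<open>2 * d\<^sup>2 * K = e\<^sup>2\<close>: initial errors below
        \<open>d\<close> in position and velocity stay below \<open>e\<close> on
        \<open>[-T, T]\<close>.\<close>
      define d where "d = e / sqrt (2 * K)"
      have d: "d > 0" "2 * d\<^sup>2 * K = e\<^sup>2"
        using e K by (auto simp: d_def power_divide)
      obtain M1 where M1: "\<And>m n. m \<ge> M1 \<Longrightarrow> n \<ge> M1 \<Longrightarrow> dist (u (r m) 0) (u (r n) 0) < d"
        using c0(1) d(1) unfolding Cauchy_def by blast
      obtain M2 where M2: "\<And>m n. m \<ge> M2 \<Longrightarrow> n \<ge> M2 \<Longrightarrow> dist (v (r m) 0) (v (r n) 0) < d"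
        using c0(2) d(1) unfolding Cauchy_def by blast
      show ?thesis
      proof (intro exI[of _ "max M1 M2"] ballI allI impI)
        fix t m n assume t: "t \<in> {-T..T}" and mn: "m \<ge> max M1 M2" "n \<ge> max M1 M2"
        have L0: "0 \<le> L" using lip by (rule lipschitz_on_nonneg)
        have "(norm (u (r m) 0 - u (r n) 0))\<^sup>2 < d\<^sup>2"
          using M1[of m n] mn by (intro power_strict_mono) (auto simp: dist_norm)
        moreover have "(norm (v (r m) 0 - v (r n) 0))\<^sup>2 < d\<^sup>2"
          using M2[of m n] mn by (intro power_strict_mono) (auto simp: dist_norm)
        ultimately have "(norm (u (r m) 0 - u (r n) 0))\<^sup>2 + (norm (v (r m) 0 - v (r n) 0))\<^sup>2 < 2 * d\<^sup>2" by simp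
        moreover have "exp ((1 + L) * \<bar>t\<bar>) \<le> K" unfolding K_def using t L0 by (auto intro!: mult_left_mono)
        ultimately have "((norm (u (r m) 0 - u (r n) 0))\<^sup>2 + (norm (v (r m) 0 - v (r n) 0))\<^sup>2) * exp ((1 + L) * \<bar>t\<bar>) < 2 * d\<^sup>2 * K"
          using K by (intro mult_less_le_imp_less) auto
        then have b: "(norm (u (r m) t - u (r n) t))\<^sup>2 + (norm (v (r m) t - v (r n) t))\<^sup>2 < e\<^sup>2"
          using newton_flow_gronwall[OF flow[of "r m"] flow[of "r n"] lip S S, of t] d(2) by simp
        have "(norm (u (r m) t - u (r n) t))\<^sup>2 < e\<^sup>2" "(norm (v (r m) t - v (r n) t))\<^sup>2 < e\<^sup>2"
          using b by (smt (verit) zero_le_power2)+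
        then show "dist (u (r m) t) (u (r n) t) < e \<and> dist (v (r m) t) (v (r n) t) < e"
          using e power_less_imp_less_base[of _ 2 e] by (simp add: dist_norm)
      qed
    qed
    show "uniformly_Cauchy_on {-T..T} (\<lambda>n. u (r n))" "uniformly_Cauchy_on {-T..T} (\<lambda>n. v (r n))"
      using main by (intro uniformly_Cauchy_onI; meson)+
  qed
  define u0 v0 where "u0 = (\<lambda>t. lim (\<lambda>n. u (r n) t))" and "v0 = (\<lambda>t. lim (\<lambda>n. v (r n) t))"
  have ul: "uniform_limit {-T..T} (\<lambda>n. u (r n)) u0 sequentially" "uniform_limit {-T..T} (\<lambda>n. v (r n)) v0 sequentially" for T
    using Cauchy_uniformly_convergent[OF cau(1)] Cauchy_uniformly_convergent[OF cau(2)]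
    by (simp_all add: uniformly_convergent_uniform_limit_iff u0_def v0_def)
  have tt: "t \<in> {- \<bar>t\<bar>..\<bar>t\<bar>}" for t :: real by auto
  have pw: "(\<lambda>n. u (r n) t) \<longlonglongrightarrow> u0 t" "(\<lambda>n. v (r n) t) \<longlonglongrightarrow> v0 t" for t
    by (rule tendsto_uniform_limitI[OF ul(1) tt], rule tendsto_uniform_limitI[OF ul(2) tt])
  have bu0: "norm (u0 t) \<le> R" for t
    by (rule Lim_norm_ubound[OF _ pw(1)]) (use bu in auto)
  have uG: "uniform_limit {-T..T} (\<lambda>n t. G (u (r n) t)) (\<lambda>t. G (u0 t)) sequentially" for T
    by (rule uniform_limit_compose_lipschitz[OF lip ul(1)]) (use bu bu0 in auto)
  have "newton_flow G u0 v0"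
    unfolding newton_flow_def
  proof (intro conjI allI)
    show "(u0 has_vector_derivative v0 t) (at t)" for t
      by (rule has_vector_derivative_uniform_limit[OF _ pw(1) ul(2)]) (use flow in \<open>auto simp: newton_flow_def\<close>)
    show "(v0 has_vector_derivative G (u0 t)) (at t)" for t
      by (rule has_vector_derivative_uniform_limit[OF _ pw(2) uG]) (use flow in \<open>auto simp: newton_flow_def\<close>)
  qed
  then show ?thesis using that[of r u0 v0] lr(1) bu0 ul by blast
qed

text \<open>If \<open>f t \<ge> e\<close>, the Lipschitz bound keeps \<open>f\<close> above
  \<open>e / 2\<close> for a time \<open>h = e / (2 * M)\<close>, so each such \<open>t\<close> adds
  at least \<open>h * (e / 2)\<close> to the integral. The integral is nondecreasing and bounded, so
  beyond a time where it is that close to its supremum no such \<open>t\<close> exists.\<close>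

lemma integrable_lipschitz_tendsto_zero:
  fixes f :: "real \<Rightarrow> real"
  assumes nn: "\<And>t. 0 \<le> f t" and lip: "\<And>s t. \<bar>f s - f t\<bar> \<le> M * \<bar>s - t\<bar>" and M: "M > 0"
    and bd: "\<And>T. 0 \<le> T \<Longrightarrow> integral {0..T} f \<le> C"
  shows "(f \<longlongrightarrow> 0) at_top"
proof (rule ccontr)
  assume "\<not> (f \<longlongrightarrow> 0) at_top"
  then obtain e where e: "e > 0" "\<not> eventually (\<lambda>t. dist (f t) 0 < e) at_top" unfolding tendsto_iff by blast
  have ex: "\<exists>t\<ge>T. f t \<ge> e" for T
    using e(2) nn unfolding eventually_at_top_linorder by (force simp: not_less)
  have cf: "continuous_on S f" for S
  proof (rule lipschitz_on_continuous_on[of M])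
    show "M-lipschitz_on S f" using lip M by (intro lipschitz_onI) (auto simp: dist_real_def)
  qed
  have fi: "f integrable_on {a..b}" for a b by (intro integrable_continuous_interval cf)
  define h where "h = e / (2 * M)"
  have h: "h > 0" using e M by (simp add: h_def)
  define F where "F = (\<lambda>T. integral {0..T} f)"
  have bdd: "bdd_above (F ` {0..})" unfolding F_def using bd by (intro bdd_aboveI2) auto
  have ne: "F ` {0..} \<noteq> {}" by auto
  have "Sup (F ` {0..}) - h * (e / 2) < Sup (F ` {0..})" using h e by simp
  then obtain T where T: "T \<ge> 0" "F T > Sup (F ` {0..}) - h * (e / 2)"
    using less_cSup_iff[OF ne bdd] by auto
  obtain t where t: "t \<ge> T" "f t \<ge> e" using ex by blast
  have "integral {t..t+h} (\<lambda>_. e / 2) \<le> integral {t..t+h} f"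
  proof (rule integral_le)
    fix s assume s: "s \<in> {t..t+h}"
    have "f t - f s \<le> M * \<bar>t - s\<bar>" using lip[of t s] by linarith
    also have "\<dots> \<le> M * h" using s M by (intro mult_left_mono) auto
    also have "\<dots> = e / 2" using M by (simp add: h_def)
    finally show "e / 2 \<le> f s" using t(2) by simp
  qed (use fi in auto)
  then have 1: "h * (e / 2) \<le> integral {t..t+h} f" using h by simp
  have 2: "F (t + h) = F t + integral {t..t+h} f" "F t = F T + integral {T..t} f"
    using Henstock_Kurzweil_Integration.integral_combine[of 0 t "t+h" f]
      Henstock_Kurzweil_Integration.integral_combine[of 0 T t f] T(1) t(1) h fi unfolding F_def by auto
  have 3: "0 \<le> integral {T..t} f" using nn fi by (intro Henstock_Kurzweil_Integration.integral_nonneg) auto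
  have "F (t + h) \<le> Sup (F ` {0..})" using T t h by (intro cSup_upper bdd) auto
  then show False using 1 2 3 T(2) by linarith
qed

section \<open>The heteroclinic limit\<close>

context double_well
begin

section \<open>Passage to the limit\<close>

lemma gradV_well:
  assumes "V a = 0"
  shows "gradV a = 0"
proof -
  have nn: "0 \<le> V y" for y using V_pos[of y] V_am V_ap by (cases "y \<in> {am, ap}") auto
  have "(V has_derivative (\<lambda>h. h \<bullet> gradV a)) (at a)" using grad by (simp add: gderiv_def)
  then have "(\<lambda>h. h \<bullet> gradV a) = (\<lambda>h. 0)"
    by (rule differential_zero_maxmin[of a UNIV V, rotated 2]) (use nn assms in auto)
  then have "gradV a \<bullet> gradV a = 0" by metis
  then show ?thesis by simp
qed

lemma heteroclinic_limit:
  fixes c :: "nat \<Rightarrow> real" and q :: "nat \<Rightarrow> real \<Rightarrow> 'a"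
  assumes c: "\<And>n. 0 < c n \<and> c n < cdw" "c \<longlonglongrightarrow> 0"
    and sol: "\<And>n. minimization_solution V (c n) (Vm (c n)) (Vp (c n)) (q n)"
  shows "\<exists>(r :: nat \<Rightarrow> nat) (\<tau> :: nat \<Rightarrow> real) q0.
           strict_mono r \<and> converges_C2_loc (\<lambda>k t. q (r k) (t - \<tau> k)) q0 \<and> solves_newton gradV q0 \<and>
           (q0 \<longlongrightarrow> am) at_bot \<and> (q0 \<longlongrightarrow> ap) at_top \<and>
           (vderiv q0 \<longlongrightarrow> 0) at_bot \<and> (vderiv q0 \<longlongrightarrow> 0) at_top"
proof -
  have Vnn: "0 \<le> V y" for y using V_pos[of y] V_am V_ap by (cases "y \<in> {am, ap}") auto
  obtain R where R: "\<And>c q g t. minimizer c q g \<Longrightarrow> norm (q t) \<le> R" using minimizers_uniformly_bounded by blast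
  obtain C where C: "0 \<le> C" "\<And>c q g. minimizer c q g \<Longrightarrow> action V c q \<le> ennreal C" using action_bound by blast
  have "\<exists>v p g \<tau>. minimizer (c n) p g \<and> (\<forall>t. norm (q n t) \<le> R) \<and> newton_flow gradV (q n) v \<and>
    (\<forall>t. (norm (v t))\<^sup>2 / 2 = V (q n t) - c n) \<and> dist (q n \<tau>) am = dist (q n \<tau>) ap \<and>
    (\<forall>T. (\<forall>t\<in>{\<tau>-T..\<tau>+T}. c n < V (q n t)) \<longrightarrow> (\<forall>t\<in>{\<tau>-T..\<tau>+T}. q n t = p t))" for n
  proof -
    have cn: "0 < c n" "c n < cdw" using c(1)[of n] by auto
    obtain v p g \<tau> where *: "minimizer (c n) p g" "\<And>t. norm (q n t) \<le> R"
      "\<And>t. (q n has_vector_derivative v t) (at t)" "\<And>t. (v has_vector_derivative gradV (q n t)) (at t)"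
      "\<And>t. (norm (v t))\<^sup>2 / 2 = V (q n t) - c n" "dist (q n \<tau>) am = dist (q n \<tau>) ap"
      "\<And>T. (\<forall>t\<in>{\<tau>-T..\<tau>+T}. c n < V (q n t)) \<longrightarrow> (\<forall>t\<in>{\<tau>-T..\<tau>+T}. q n t = p t)"
      by (rule minimization_solution_properties[OF cn sol[of n], where R = R]) (rule R, assumption | (rule that; assumption))+
    have "newton_flow gradV (q n) v" using *(3,4) by (simp add: newton_flow_def)
    then show ?thesis using *(1,2,5,6,7) by (intro exI[of _ v] exI[of _ p] exI[of _ g] exI[of _ \<tau>]) blast
  qed
  then obtain v p g \<tau> where P: "\<And>n. minimizer (c n) (p n) (g n)" "\<And>n t. norm (q n t) \<le> R"
     "\<And>n. newton_flow gradV (q n) (v n)" "\<And>n t. (norm (v n t))\<^sup>2 / 2 = V (q n t) - c n"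
     "\<And>n. dist (q n (\<tau> n)) am = dist (q n (\<tau> n)) ap"
     "\<And>n T. (\<forall>t\<in>{\<tau> n - T..\<tau> n + T}. c n < V (q n t)) \<longrightarrow> (\<forall>t\<in>{\<tau> n - T..\<tau> n + T}. q n t = p n t)"
    by metis
  obtain L where L: "L-lipschitz_on (cball 0 R) gradV" using locally_lipschitz_cball[OF gradV_lip] by blast
  obtain B where B: "B > 0" "\<And>y. norm y \<le> R \<Longrightarrow> V y \<le> B"
  proof -
    have "compact (V ` cball 0 R)" by (intro compact_continuous_image V_cont compact_cball)
    from compact_imp_bounded[OF this] obtain B where B: "B > 0" "\<forall>y\<in>V ` cball 0 R. norm y \<le> B"
      unfolding bounded_pos by blast
    have "V y \<le> B" if "norm y \<le> R" for y
    proof -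
      have "norm (V y) \<le> B" using B(2) that by simp
      then show ?thesis by simp
    qed
    then show thesis using that[of B] B(1) by blast
  qed
  have v_le: "norm w \<le> sqrt (2 * B)" if "(norm w)\<^sup>2 / 2 \<le> B" for w :: 'a
    using that by (intro real_le_rsqrt) simp
  define u w where "u = (\<lambda>n t. q n (t + \<tau> n))" and "w = (\<lambda>n t. v n (t + \<tau> n))"
  have flow: "newton_flow gradV (u n) (w n)" for n
    unfolding u_def w_def by (rule newton_flow_shift[OF P(3)])
  have uR: "norm (u n t) \<le> R" for n t unfolding u_def by (rule P(2))
  have wB: "norm (w n 0) \<le> sqrt (2 * B)" for n
  proof (rule v_le)
    have "(norm (w n 0))\<^sup>2 / 2 = V (u n 0) - c n" unfolding u_def w_def by (rule P(4))
    then show "(norm (w n 0))\<^sup>2 / 2 \<le> B" using B(2)[OF uR[of n 0]] c(1)[of n] by linarith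
  qed
  obtain r :: "nat \<Rightarrow> nat" and u0 v0 where r: "strict_mono r" and flow0: "newton_flow gradV u0 v0"
    and u0R: "\<And>t. norm (u0 t) \<le> R"
    and ul: "\<And>T. uniform_limit {-T..T} (\<lambda>n. u (r n)) u0 sequentially"
    and vl: "\<And>T. uniform_limit {-T..T} (\<lambda>n. w (r n)) v0 sequentially"
    by (rule newton_flow_compactness[OF flow L uR wB]) (rule that; assumption)
  have tt: "t \<in> {- \<bar>t\<bar>..\<bar>t\<bar>}" for t :: real by auto
  have pw: "(\<lambda>n. u (r n) t) \<longlonglongrightarrow> u0 t" "(\<lambda>n. w (r n) t) \<longlonglongrightarrow> v0 t" for t
    by (rule tendsto_uniform_limitI[OF ul tt], rule tendsto_uniform_limitI[OF vl tt])
  have c0: "(\<lambda>n. c (r n)) \<longlonglongrightarrow> 0" using LIMSEQ_subseq_LIMSEQ[OF c(2) r] by (simp add: o_def)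
  have cu0: "continuous_on S u0" for S by (rule newton_flow_continuous(1)[OF flow0])
  have cVu0: "continuous_on S (\<lambda>t. V (u0 t))" for S by (intro continuous_on_compose2[OF V_cont cu0]) auto
  have Vpw: "(\<lambda>n. V (u (r n) t)) \<longlonglongrightarrow> V (u0 t)" for t
    using continuous_on_tendsto_compose[OF V_cont[of UNIV] pw(1)] by simp
  have energy0: "(norm (v0 t))\<^sup>2 / 2 = V (u0 t)" for t
  proof (rule LIMSEQ_unique)
    show "(\<lambda>n. (norm (w (r n) t))\<^sup>2 / 2) \<longlonglongrightarrow> (norm (v0 t))\<^sup>2 / 2" by (intro tendsto_intros pw) simp
    have "(\<lambda>n. V (u (r n) t) - c (r n)) \<longlonglongrightarrow> V (u0 t) - 0" by (intro tendsto_diff Vpw c0)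
    moreover have "(norm (w (r n) t))\<^sup>2 / 2 = V (u (r n) t) - c (r n)" for n unfolding u_def w_def by (rule P(4))
    ultimately show "(\<lambda>n. (norm (w (r n) t))\<^sup>2 / 2) \<longlonglongrightarrow> V (u0 t)" by (simp only: diff_zero)
  qed
  have mid: "dist (u0 0) am = dist (u0 0) ap"
  proof (rule LIMSEQ_unique)
    show "(\<lambda>n. dist (u (r n) 0) am) \<longlonglongrightarrow> dist (u0 0) am" by (intro tendsto_intros pw)
    have "(\<lambda>n. dist (u (r n) 0) ap) \<longlonglongrightarrow> dist (u0 0) ap" by (intro tendsto_intros pw)
    moreover have "dist (u (r n) 0) am = dist (u (r n) 0) ap" for n unfolding u_def by (simp add: P(5))
    ultimately show "(\<lambda>n. dist (u (r n) 0) am) \<longlonglongrightarrow> dist (u0 0) ap" by simp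
  qed
  \<comment> \<open>At a zero of \<open>V\<close> the velocity vanishes too, so by Gronwall's
    inequality the limit would coincide with the equilibrium at that well, also at time 0, where it
    is equidistant from two different wells.\<close>
  have Vu0: "0 < V (u0 t)" for t
  proof (rule ccontr)
    assume "\<not> 0 < V (u0 t)"
    then have ut: "u0 t \<in> {am, ap}" and z: "V (u0 t) = 0" using V_pos[of "u0 t"] Vnn[of "u0 t"] by force+
    have v0: "v0 t = 0" using energy0[of t] z by simp
    have const: "newton_flow gradV (\<lambda>s. u0 t) (\<lambda>s. 0)"
      unfolding newton_flow_def using gradV_well[OF z] by simp
    have "(norm (u0 (- t + t) - u0 t))\<^sup>2 + (norm (v0 (- t + t) - 0))\<^sup>2 \<le>
      ((norm (u0 (0 + t) - u0 t))\<^sup>2 + (norm (v0 (0 + t) - 0))\<^sup>2) * exp ((1 + L) * \<bar>- t\<bar>)"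
      by (rule newton_flow_gronwall[OF newton_flow_shift[OF flow0] const L]) (use u0R in auto)
    then have "(norm (u0 0 - u0 t))\<^sup>2 + (norm (v0 0))\<^sup>2 \<le> 0" using v0 by simp
    then have "(norm (u0 0 - u0 t))\<^sup>2 = 0" using zero_le_power2[of "norm (u0 0 - u0 t)"] zero_le_power2[of "norm (v0 0)"] by linarith
    then have "u0 0 = u0 t" by simp
    then show False using ut mid am_neq_ap by auto
  qed
  have ucV: "uniformly_continuous_on (cball 0 R) V" by (intro compact_uniformly_continuous V_cont compact_cball)
  have Vul: "uniform_limit {-T..T} (\<lambda>n t. V (u (r n) t) - c (r n)) (\<lambda>t. V (u0 t)) sequentially" for T
  proof (rule uniform_limitI)
    fix e :: real assume e: "e > 0"
    then obtain d where d: "d > 0" "\<And>x y. x \<in> cball 0 R \<Longrightarrow> y \<in> cball 0 R \<Longrightarrow> dist x y < d \<Longrightarrow> dist (V x) (V y) < e / 2"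
      using ucV unfolding uniformly_continuous_on_def by (metis half_gt_zero)
    have "\<forall>\<^sub>F n in sequentially. \<forall>t\<in>{-T..T}. dist (u (r n) t) (u0 t) < d"
      using ul[of T] d(1) unfolding uniform_limit_iff by blast
    moreover have "\<forall>\<^sub>F n in sequentially. dist (c (r n)) 0 < e / 2"
      using c0 e unfolding tendsto_iff by (meson half_gt_zero)
    ultimately show "\<forall>\<^sub>F n in sequentially. \<forall>t\<in>{-T..T}. dist (V (u (r n) t) - c (r n)) (V (u0 t)) < e"
    proof eventually_elim
      case (elim n)
      show ?case
      proof
        fix t assume "t \<in> {-T..T}"
        then have "dist (V (u (r n) t)) (V (u0 t)) < e / 2" using elim uR u0R by (intro d(2)) auto
        then show "dist (V (u (r n) t) - c (r n)) (V (u0 t)) < e"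
          using elim(2) unfolding dist_real_def by linarith
      qed
    qed
  qed
  \<comment> \<open>The minimum of \<open>V (u0 t)\<close> on \<open>[-T, T]\<close> is positive and
    serves as tolerance in the uniform convergence. The solutions are then strictly above the level
    on the window, so the last property in \<open>P\<close> applies.\<close>
  have window: "\<forall>\<^sub>F n in sequentially. \<forall>t\<in>{-T..T}. u (r n) t = p (r n) (t + \<tau> (r n))" if T0: "T \<ge> 0" for T
  proof -
    obtain x where x: "x \<in> {-T..T}" "\<forall>y\<in>{-T..T}. V (u0 x) \<le> V (u0 y)"
      using continuous_attains_inf[OF _ _ cVu0, of "{-T..T}"] T0 by auto
    have "\<forall>\<^sub>F n in sequentially. \<forall>t\<in>{-T..T}. dist (V (u (r n) t) - c (r n)) (V (u0 t)) < V (u0 x)"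
      using Vul[of T] Vu0[of x] unfolding uniform_limit_iff by blast
    then show ?thesis
    proof eventually_elim
      case (elim n)
      have gt: "c (r n) < V (u (r n) t)" if "t \<in> {-T..T}" for t
        using elim[rule_format, OF that] x(2)[rule_format, OF that] unfolding dist_real_def by linarith
      have "\<forall>t\<in>{\<tau> (r n) - T..\<tau> (r n) + T}. c (r n) < V (q (r n) t)"
      proof
        fix t assume "t \<in> {\<tau> (r n) - T..\<tau> (r n) + T}"
        then show "c (r n) < V (q (r n) t)" using gt[of "t - \<tau> (r n)"] by (simp add: u_def)
      qed
      then have "\<forall>t\<in>{\<tau> (r n) - T..\<tau> (r n) + T}. q (r n) t = p (r n) t" using P(6) by blast
      then show ?case by (auto simp: u_def)
    qed
  qed
  \<comment> \<open>Carries a bound on the action of the minimizers over to the potential integral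
    of the limit: kinetic energy is dropped, and uniform convergence permits the passage to the
    limit. The set \<open>A\<close> may depend on the index and may miss the left end point, so open
    half-lines qualify.\<close>
  have int_le: "integral {a..b} (\<lambda>t. V (u0 t)) \<le> X"
    if ab: "a \<le> b" and X: "0 \<le> X"
      and tail: "\<forall>\<^sub>F n in sequentially. \<exists>A. action_on A V (c (r n)) (p (r n)) (g (r n)) \<le> ennreal X \<and>
          {a + \<tau> (r n)..b + \<tau> (r n)} \<subseteq> insert (a + \<tau> (r n)) A" for a b X
  proof -
    define T where "T = max \<bar>a\<bar> \<bar>b\<bar>"
    have T: "T \<ge> 0" "{a..b} \<subseteq> {-T..T}" by (auto simp: T_def)
    have cont: "continuous_on {a..b} (\<lambda>t. V (u (r n) t) - c (r n))" for n
      by (intro continuous_intros continuous_on_compose2[OF V_cont newton_flow_continuous(1)[OF flow]]) auto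
    obtain I J where IJ: "\<And>n. ((\<lambda>t. V (u (r n) t) - c (r n)) has_integral I n) {a..b}"
      "((\<lambda>t. V (u0 t)) has_integral J) {a..b}" "I \<longlonglongrightarrow> J"
      using uniform_limit_integral[OF uniform_limit_on_subset[OF Vul T(2)] cont] by (metis sequentially_bot)
    have "\<forall>\<^sub>F n in sequentially. I n \<le> X"
      using tail window[OF T(1)]
    proof eventually_elim
      case (elim n)
      let ?c = "c (r n)" and ?p = "p (r n)" and ?g = "g (r n)" and ?s = "\<tau> (r n)"
      have m: "minimizer ?c ?p ?g" by (rule P(1))
      have pd: "has_L2_deriv ?p ?g" using m by (simp add: minimal_def)
      have nn: "0 \<le> energy V ?c ?p ?g t" "V (?p t) - ?c \<le> energy V ?c ?p ?g t" for t
        using minimizer_V[OF m, of t] by (auto simp: energy_def)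
      obtain A where A: "action_on A V ?c ?p ?g \<le> ennreal X"
        "{a + ?s..b + ?s} \<subseteq> insert (a + ?s) A" using elim(1) by blast
      have "I n = integral {a..b} (\<lambda>t. V (u (r n) t) - ?c)" by (rule integral_unique[OF IJ(1), symmetric])
      also have "\<dots> = integral {a..b} (\<lambda>t. V (?p (t + ?s)) - ?c)"
        by (rule integral_cong) (use elim(2) T(2) in auto)
      also have "\<dots> = integral {a + ?s..b + ?s} (\<lambda>t. V (?p t) - ?c)"
        using integral_shift_real_ivl[of "a + ?s" ?s "b + ?s" "\<lambda>t. V (?p t) - ?c"] by simp
      also have "\<dots> \<le> integral {a + ?s..b + ?s} (energy V ?c ?p ?g)"
        by (rule integral_le[OF set_borel_integral_eq_integral(1)[OF potential_integrable[OF pd V_cont]]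
            set_borel_integral_eq_integral(1)[OF energy_integrable[OF pd V_cont]]]) (rule nn(2))
      also have "\<dots> \<le> X"
        by (rule integral_le_half_line[OF energy_integrable[OF pd V_cont] nn(1) A X])
      finally show ?case .
    qed
    then have "J \<le> X" using IJ(3) by (intro tendsto_upperbound) auto
    then show ?thesis using IJ(2) by (simp add: integral_unique)
  qed
  have total: "integral {a..b} (\<lambda>t. V (u0 t)) \<le> C" if "a \<le> b" for a b
  proof (rule int_le[OF that C(1)], rule always_eventually, rule allI)
    fix n
    have m: "minimizer (c (r n)) (p (r n)) (g (r n))" by (rule P(1))
    then have pd: "has_L2_deriv (p (r n)) (g (r n))" by (simp add: minimal_def)
    have "action_on UNIV V (c (r n)) (p (r n)) (g (r n)) \<le> ennreal C"
      using C(2)[OF m] unfolding action_eq[OF pd] by simp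
    then show "\<exists>A. action_on A V (c (r n)) (p (r n)) (g (r n)) \<le> ennreal C \<and>
          {a + \<tau> (r n)..b + \<tau> (r n)} \<subseteq> insert (a + \<tau> (r n)) A" by (intro exI[of _ UNIV]) simp
  qed
  have posint: "0 < integral {a..b} (\<lambda>t. V (u0 t))" if "a < b" for a b
  proof -
    have "0 \<le> integral {a..b} (\<lambda>t. V (u0 t))"
      using Vnn by (intro Henstock_Kurzweil_Integration.integral_nonneg integrable_continuous_interval cVu0) auto
    moreover have "integral {a..b} (\<lambda>t. V (u0 t)) \<noteq> 0"
      using integral_eq_0_iff[OF cVu0 that] Vnn Vu0[of a] that by force
    ultimately show ?thesis by simp
  qed
  have near_eventually: "\<forall>\<^sub>F n in sequentially. dist (p (r n) (t + \<tau> (r n))) a < d" if "dist (u0 t) a < d" for t a d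
  proof -
    have "(\<lambda>n. dist (u (r n) t) a) \<longlonglongrightarrow> dist (u0 t) a" by (intro tendsto_intros pw)
    then have "\<forall>\<^sub>F n in sequentially. dist (u (r n) t) a < d" using that by (rule order_tendstoD)
    moreover have "\<forall>\<^sub>F n in sequentially. \<forall>s\<in>{-\<bar>t\<bar>..\<bar>t\<bar>}. u (r n) s = p (r n) (s + \<tau> (r n))" by (rule window) simp
    ultimately show ?thesis
    proof eventually_elim
      case (elim n)
      then show ?case using tt[of t] by auto
    qed
  qed
  obtain \<delta> where d: "\<delta> > 0" "\<And>t. 1 \<le> t \<Longrightarrow> \<delta> \<le> dist (u0 t) am" "\<And>t. t \<le> -1 \<Longrightarrow> \<delta> \<le> dist (u0 t) ap"
  proof -
    \<comment> \<open>Strictly below both unit-interval integrals of the potential along the limit,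
      so that a tail of action at most \<open>\<eta>\<close> cannot contain the corresponding unit
      interval.\<close>
    define \<eta> where "\<eta> = min (integral {0..1} (\<lambda>t. V (u0 t))) (integral {-1..0} (\<lambda>t. V (u0 t))) / 2"
    have eta: "\<eta> > 0" "\<eta> < integral {0..1} (\<lambda>t. V (u0 t))" "\<eta> < integral {-1..0} (\<lambda>t. V (u0 t))"
      using posint[of 0 1] posint[of "-1" 0] by (auto simp: \<eta>_def min_def)
    obtain \<delta> where de: "\<delta> > 0"
      "\<And>c q g s. minimizer c q g \<Longrightarrow> dist (q s) ap < \<delta> \<Longrightarrow> action_on {s<..} V c q g \<le> ennreal \<eta>"
      "\<And>c q g s. minimizer c q g \<Longrightarrow> dist (q s) am < \<delta> \<Longrightarrow> action_on {..s} V c q g \<le> ennreal \<eta>"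
      using tail_small[OF eta(1)] by blast
    show thesis
    proof (rule that[OF de(1)])
      fix t :: real assume t: "1 \<le> t"
      show "\<delta> \<le> dist (u0 t) am"
      proof (rule ccontr)
        assume "\<not> \<delta> \<le> dist (u0 t) am"
        then have "\<forall>\<^sub>F n in sequentially. dist (p (r n) (t + \<tau> (r n))) am < \<delta>" by (intro near_eventually) simp
        \<comment> \<open>Being near \<open>am\<close> at time \<open>t\<close> makes the entire
          past of the minimizers cost at most \<open>\<eta>\<close>, and this past contains
          \<open>[0, 1]\<close> because \<open>1 \<le> t\<close>.\<close>
        then have "integral {0..1} (\<lambda>t. V (u0 t)) \<le> \<eta>"
        proof (intro int_le, simp, use eta in simp, elim eventually_mono)
          fix n assume "dist (p (r n) (t + \<tau> (r n))) am < \<delta>"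
          from de(3)[OF P(1) this] t show "\<exists>A. action_on A V (c (r n)) (p (r n)) (g (r n)) \<le> ennreal \<eta> \<and>
            {0 + \<tau> (r n)..1 + \<tau> (r n)} \<subseteq> insert (0 + \<tau> (r n)) A" by (intro exI[of _ "{..t + \<tau> (r n)}"]) auto
        qed
        then show False using eta by simp
      qed
    next
      fix t :: real assume t: "t \<le> -1"
      show "\<delta> \<le> dist (u0 t) ap"
      proof (rule ccontr)
        assume "\<not> \<delta> \<le> dist (u0 t) ap"
        then have "\<forall>\<^sub>F n in sequentially. dist (p (r n) (t + \<tau> (r n))) ap < \<delta>" by (intro near_eventually) simp
        then have "integral {-1..0} (\<lambda>t. V (u0 t)) \<le> \<eta>"
        proof (intro int_le, simp, use eta in simp, elim eventually_mono)
          fix n assume "dist (p (r n) (t + \<tau> (r n))) ap < \<delta>"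
          from de(2)[OF P(1) this] t show "\<exists>A. action_on A V (c (r n)) (p (r n)) (g (r n)) \<le> ennreal \<eta> \<and>
            {-1 + \<tau> (r n)..0 + \<tau> (r n)} \<subseteq> insert (-1 + \<tau> (r n)) A" by (intro exI[of _ "{t + \<tau> (r n)<..}"]) auto
        qed
        then show False using eta by simp
      qed
    qed
  qed
  obtain M where M: "M > 0" "\<And>s t. \<bar>V (u0 s) - V (u0 t)\<bar> \<le> M * \<bar>s - t\<bar>"
  proof -
    have "compact (gradV ` cball 0 R)"
      by (intro compact_continuous_image compact_cball continuous_on_subset[OF gradV_cont]) auto
    from compact_imp_bounded[OF this] obtain D where D: "D > 0" "\<forall>y\<in>gradV ` cball 0 R. norm y \<le> D"
      unfolding bounded_pos by blast
    \<comment> \<open>The energy identity bounds the speed by \<open>sqrt (2 * B)\<close>, and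
      \<open>D\<close> bounds the gradient on the ball containing the limit.\<close>
    define M where "M = sqrt (2 * B) * D"
    have der: "((\<lambda>t. V (u0 t)) has_derivative (\<lambda>h. (h *\<^sub>R v0 t) \<bullet> gradV (u0 t))) (at t)" for t
    proof (rule has_derivative_compose[where g = V])
      show "(u0 has_derivative (\<lambda>h. h *\<^sub>R v0 t)) (at t)"
        using flow0 by (simp add: newton_flow_def has_vector_derivative_def)
      show "(V has_derivative (\<lambda>h. h \<bullet> gradV (u0 t))) (at (u0 t))" using grad by (simp add: gderiv_def)
    qed
    have on: "onorm (\<lambda>h. (h *\<^sub>R v0 t) \<bullet> gradV (u0 t)) \<le> M" for t
    proof (rule onorm_le)
      fix h :: real
      have "norm (v0 t) \<le> sqrt (2 * B)" by (rule v_le) (use energy0[of t] B(2)[OF u0R] in simp)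
      moreover have "norm (gradV (u0 t)) \<le> D" using D(2) u0R by simp
      ultimately have "norm (v0 t) * norm (gradV (u0 t)) \<le> M" unfolding M_def using B(1) by (intro mult_mono) auto
      moreover have "\<bar>v0 t \<bullet> gradV (u0 t)\<bar> \<le> norm (v0 t) * norm (gradV (u0 t))" by (rule Cauchy_Schwarz_ineq2)
      ultimately have "\<bar>h\<bar> * \<bar>v0 t \<bullet> gradV (u0 t)\<bar> \<le> \<bar>h\<bar> * M" by (intro mult_left_mono) auto
      then show "norm ((h *\<^sub>R v0 t) \<bullet> gradV (u0 t)) \<le> M * norm h" by (simp add: abs_mult mult.commute)
    qed
    have "norm (V (u0 s) - V (u0 t)) \<le> M * norm (s - t)" for s t
      by (rule differentiable_bound[of UNIV "\<lambda>t. V (u0 t)"]) (use der on in auto)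
    moreover have "M > 0" using B(1) D(1) by (simp add: M_def)
    ultimately show thesis using that[of M] by simp
  qed
  have V_top: "((\<lambda>t. V (u0 t)) \<longlongrightarrow> 0) at_top"
    by (rule integrable_lipschitz_tendsto_zero[OF Vnn M(2,1) total])
  have V_bot: "((\<lambda>t. V (u0 t)) \<longlongrightarrow> 0) at_bot"
  proof -
    have "((\<lambda>t. V (u0 (- t))) \<longlongrightarrow> 0) at_top"
    proof (rule integrable_lipschitz_tendsto_zero[OF Vnn _ M(1)])
      show "\<bar>V (u0 (- s)) - V (u0 (- t))\<bar> \<le> M * \<bar>s - t\<bar>" for s t
        using M(2)[of "- s" "- t"] by (simp add: abs_minus_commute)
      show "integral {0..T} (\<lambda>t. V (u0 (- t))) \<le> C" if "0 \<le> T" for T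
        using Henstock_Kurzweil_Integration.integral_reflect_real[of 0 "- T" "\<lambda>t. V (u0 t)"] total[of "- T" 0] that by simp
    qed
    then show ?thesis by (simp add: filterlim_at_bot_mirror)
  qed
  \<comment> \<open>Away from both wells the potential has a positive minimum on the compact set
    \<open>K\<close>, so its decay drives the path out of \<open>K\<close>. As the path keeps the
    distance \<open>\<delta>\<close> from \<open>b\<close>, only the neighbourhood of
    \<open>a\<close> remains.\<close>
  have to_well: "(u0 \<longlongrightarrow> a) F"
    if V0: "((\<lambda>t. V (u0 t)) \<longlongrightarrow> 0) F" and ab: "{am, ap} = {a, b}" and far: "\<forall>\<^sub>F t in F. \<delta> \<le> dist (u0 t) b" for F a b
    unfolding tendsto_iff
  proof (intro allI impI)
    fix e :: real assume e: "e > 0"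
    define K where "K = cball 0 R - ball b \<delta> - ball a e"
    have "compact K" unfolding K_def by (intro compact_diff compact_cball open_ball)
    show "\<forall>\<^sub>F t in F. dist (u0 t) a < e"
    proof (cases "K = {}")
      case True
      show ?thesis using far
      proof eventually_elim
        case (elim t)
        then show ?case using True u0R[of t] by (force simp: K_def dist_commute)
      qed
    next
      case False
      obtain x where x: "x \<in> K" "\<forall>y\<in>K. V x \<le> V y"
        using continuous_attains_inf[OF \<open>compact K\<close> False V_cont] by blast
      have "x \<notin> {a, b}" using x(1) e d(1) by (auto simp: K_def)
      then have "0 < V x" using V_pos ab by metis
      then have "\<forall>\<^sub>F t in F. V (u0 t) < V x" using V0 by (intro order_tendstoD)
      then show ?thesis using far
      proof eventually_elim
        case (elim t)
        then have "u0 t \<notin> K" using x(2) by force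
        then show ?case using elim(2) u0R[of t] by (auto simp: K_def dist_commute)
      qed
    qed
  qed
  have vto: "(v0 \<longlongrightarrow> 0) F" if "((\<lambda>t. V (u0 t)) \<longlongrightarrow> 0) F" for F
  proof -
    have "((\<lambda>t. sqrt (2 * V (u0 t))) \<longlongrightarrow> sqrt (2 * 0)) F" by (intro tendsto_intros that)
    moreover have "sqrt (2 * V (u0 t)) = norm (v0 t)" for t
    proof -
      have "2 * V (u0 t) = (norm (v0 t))\<^sup>2" using energy0[of t] by simp
      then show ?thesis by simp
    qed
    ultimately have "((\<lambda>t. norm (v0 t)) \<longlongrightarrow> 0) F" by simp
    then show ?thesis by (rule tendsto_norm_zero_cancel)
  qed
  have C2conv: "converges_C2_loc (\<lambda>k. u (r k)) u0"
    unfolding converges_C2_loc_def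
  proof (intro conjI allI impI)
    show "C2 (u (r k))" for k by (rule newton_flow_C2[OF flow gradV_cont])
    show "C2 u0" by (rule newton_flow_C2[OF flow0 gradV_cont])
    fix K :: "real set" and j :: nat assume K: "compact K" and j: "j \<le> 2"
    obtain T where T: "K \<subseteq> {-T..T}"
    proof -
      obtain T where "\<forall>t\<in>K. norm t \<le> T" using compact_imp_bounded[OF K] unfolding bounded_iff by blast
      then show thesis by (intro that[of T]) (auto simp: abs_le_iff)
    qed
    have gl: "uniform_limit {-T..T} (\<lambda>k t. gradV (u (r k) t)) (\<lambda>t. gradV (u0 t)) sequentially"
      by (rule uniform_limit_compose_lipschitz[OF L ul]) (use uR u0R in auto)
    have "j = 0 \<or> j = 1 \<or> j = 2" using j by auto
    then have "uniform_limit {-T..T} (\<lambda>k. (vderiv ^^ j) (u (r k))) ((vderiv ^^ j) u0) sequentially"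
      using ul[of T] vl[of T] gl newton_flow_vderiv[OF flow] newton_flow_vderiv[OF flow0]
      by (auto simp: numeral_2_eq_2)
    then show "uniform_limit K (\<lambda>k. (vderiv ^^ j) (u (r k))) ((vderiv ^^ j) u0) sequentially"
      using T by (rule uniform_limit_on_subset)
  qed
  have "(u0 \<longlongrightarrow> ap) at_top"
    by (rule to_well[OF V_top, of ap am]) (use d(2) in \<open>auto intro: eventually_at_top_linorderI[of 1]\<close>)
  moreover have "(u0 \<longlongrightarrow> am) at_bot"
    by (rule to_well[OF V_bot, of am ap]) (use d(3) in \<open>auto simp: eventually_at_bot_linorder\<close>)
  moreover have "solves_newton gradV u0"
    unfolding solves_newton_def using newton_flow_C2[OF flow0 gradV_cont] newton_flow_vderiv[OF flow0] by simp
  \<comment> \<open>The statement subtracts the shift, so its witness is the negative of the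
    equidistant time.\<close>
  moreover have "converges_C2_loc (\<lambda>k t. q (r k) (t - (- \<tau> (r k)))) u0"
    using C2conv unfolding u_def by simp
  ultimately show ?thesis
    using r vto[OF V_top] vto[OF V_bot] unfolding newton_flow_vderiv(1)[OF flow0, symmetric]
    by (intro exI[of _ r] exI[of _ "\<lambda>k. - \<tau> (r k)"] exI[of _ u0]) blast
qed

end

theorem proposition3p3:
  fixes V :: "real ^ 'n \<Rightarrow> real" and gradV :: "real ^ 'n \<Rightarrow> real ^ 'n"
    and am ap :: "real ^ 'n" and nu0 :: ereal and cdw :: real
    and Vm Vp :: "real \<Rightarrow> (real ^ 'n) set"
    and c :: "nat \<Rightarrow> real" and q :: "nat \<Rightarrow> real \<Rightarrow> real ^ 'n"
  assumes "CARD('n) \<ge> 2"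
    and "\<And>x. GDERIV V x :> gradV x"
    and "continuous_on UNIV gradV"
    and "locally_lipschitz gradV"
    and "am \<noteq> ap"
    and "V am = 0" and "V ap = 0"
    and "\<And>x. x \<notin> {am, ap} \<Longrightarrow> V x > 0"
    and "Liminf at_infinity (\<lambda>x. ereal (V x)) = nu0" and "nu0 > 0"
    and "double_well_decomposition V am ap nu0 cdw Vm Vp"
    and "\<And>n. 0 < c n \<and> c n < cdw"
    and "c \<longlonglongrightarrow> 0"
    and "\<And>n. minimization_solution V (c n) (Vm (c n)) (Vp (c n)) (q n)"
  shows "\<exists>(r :: nat \<Rightarrow> nat) (\<tau> :: nat \<Rightarrow> real) (q0 :: real \<Rightarrow> real ^ 'n).
           strict_mono r \<and>
           converges_C2_loc (\<lambda>k t. q (r k) (t - \<tau> k)) q0 \<and>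
           solves_newton gradV q0 \<and>
           (q0 \<longlongrightarrow> am) at_bot \<and> (q0 \<longlongrightarrow> ap) at_top \<and>
           (vderiv q0 \<longlongrightarrow> 0) at_bot \<and> (vderiv q0 \<longlongrightarrow> 0) at_top"
proof -
  interpret double_well V gradV am ap nu0 cdw Vm Vp
    by (unfold_locales) (use assms in auto)
  show ?thesis by (rule heteroclinic_limit[OF assms(12-14)])
qed

end
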